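(* There exists an absolute constant $c>0$ such that the following holds. Let $n\ge 3$, let $K$ be an origin symmetric convex body in $\mathbb{R}^n$ whose John ellipsoid is a Euclidean ball, and let $\varepsilon\in[0,1)$. If $\delta_{\rm BM}(K,W^n)\ge \varepsilon$, then $$\frac{S(K)^n}{V(K)^{n-1}}\le (1-\gamma\,\varepsilon^n)\,\frac{S(W^n)^n}{V(W^n)^{n-1}},\qquad\text{where } \gamma=n^{-cn^3}.$$
   Context: A convex body in $\mathbb{R}^n$ is a compact convex set with non-empty interior. $V(\cdot)$ denotes volume and $S(\cdot)$ surface area in $\mathbb{R}^n$. $W^n=[-1,1]^n$. The John ellipsoid of a convex body $K$ is the unique ellipsoid of maximal volume contained in $K$. For origin symmetric convex bodies $K,M$ in $\mathbb{R}^n$, the Banach-Mazur distance is $$\delta_{\rm BM}(K,M)=\log\min\{\lambda\ge 1:\ K\subseteq \Phi(M)\subseteq \lambda K\text{ for some }\Phi\in {\rm GL}(n)\}.$$ *)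

theory Defs
  imports "HOL-Analysis.Analysis" "HOL-Library.Function_Algebras"
begin

(* The constant c of the theorem must not depend on n, so n is a term and not a type:
   R^n is topspace (Euclidean_space n), the functions nat => real that vanish at all
   indices i >= n.  With the pointwise scalar multiplication below, the library's
   convex and linear apply to this model. *)

instantiation "fun" :: (type, real_vector) real_vector
begin

definition scaleR_fun :: "real \<Rightarrow> ('a \<Rightarrow> 'b) \<Rightarrow> 'a \<Rightarrow> 'b"
  where "scaleR_fun r f = (\<lambda>x. r *\<^sub>R f x)"

instance
  by standard (auto simp: scaleR_fun_def fun_eq_iff scaleR_right_distrib scaleR_left_distrib)

end

definition convex_body :: "nat \<Rightarrow> (nat \<Rightarrow> real) set \<Rightarrow> bool"
  where "convex_body n K \<longleftrightarrow>
    compactin (Euclidean_space n) K \<and> convex K \<and> Euclidean_space n interior_of K \<noteq> {}"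

definition origin_symmetric :: "(nat \<Rightarrow> real) set \<Rightarrow> bool"
  where "origin_symmetric K \<longleftrightarrow> uminus ` K = K"

definition closed_ball :: "nat \<Rightarrow> (nat \<Rightarrow> real) \<Rightarrow> real \<Rightarrow> (nat \<Rightarrow> real) set"
  where "closed_ball n a r = {x \<in> topspace (Euclidean_space n). L2_set (x - a) {..<n} \<le> r}"

definition cube :: "nat \<Rightarrow> (nat \<Rightarrow> real) set"
  where "cube n = {x \<in> topspace (Euclidean_space n). \<forall>i<n. x i \<in> {-1..1}}"

(* restrict passes from functions vanishing outside {..<n} to the extensional functions
   that form the space of the product measure. *)
definition vol :: "nat \<Rightarrow> (nat \<Rightarrow> real) set \<Rightarrow> real"
  where "vol n A = measure (\<Pi>\<^sub>M i\<in>{..<n}. lborel) ((\<lambda>x. restrict x {..<n}) ` A)"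

(* Surface area in Minkowski's sense: the right derivative at t = 0 of the volume of the
   parallel body K + t B, with B the unit ball.  The limit exists for every convex body. *)
definition surface_area :: "nat \<Rightarrow> (nat \<Rightarrow> real) set \<Rightarrow> real"
  where "surface_area n K =
    Lim (at_right 0)
      (\<lambda>t. (vol n {x + t *\<^sub>R u | x u. x \<in> K \<and> u \<in> closed_ball n 0 1} - vol n K) / t)"

(* Phi is linear on all of nat => real, but only its restriction to R^n matters: every linear
   automorphism of R^n extends to such a Phi by precomposition with the projection to R^n. *)
definition GL :: "nat \<Rightarrow> ((nat \<Rightarrow> real) \<Rightarrow> (nat \<Rightarrow> real)) set"
  where "GL n =
    {\<Phi>. linear \<Phi> \<and> bij_betw \<Phi> (topspace (Euclidean_space n)) (topspace (Euclidean_space n))}"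

definition ellipsoid :: "nat \<Rightarrow> (nat \<Rightarrow> real) set \<Rightarrow> bool"
  where "ellipsoid n E \<longleftrightarrow>
    (\<exists>a \<in> topspace (Euclidean_space n). \<exists>\<Phi> \<in> GL n. E = (\<lambda>x. a + \<Phi> x) ` closed_ball n 0 1)"

definition euclidean_ball :: "nat \<Rightarrow> (nat \<Rightarrow> real) set \<Rightarrow> bool"
  where "euclidean_ball n E \<longleftrightarrow>
    (\<exists>a \<in> topspace (Euclidean_space n). \<exists>r>0. E = closed_ball n a r)"

(* For a convex body K exactly one E satisfies this, by John's theorem. *)
definition is_john_ellipsoid :: "nat \<Rightarrow> (nat \<Rightarrow> real) set \<Rightarrow> (nat \<Rightarrow> real) set \<Rightarrow> bool"
  where "is_john_ellipsoid n K E \<longleftrightarrow>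
    ellipsoid n E \<and> E \<subseteq> K \<and> (\<forall>E'. ellipsoid n E' \<and> E' \<subseteq> K \<longrightarrow> vol n E' \<le> vol n E)"

(* For origin symmetric convex bodies the infimum is attained, so Inf is the minimum. *)
definition banach_mazur_distance :: "nat \<Rightarrow> (nat \<Rightarrow> real) set \<Rightarrow> (nat \<Rightarrow> real) set \<Rightarrow> real"
  where "banach_mazur_distance n K M =
    ln (Inf {l. l \<ge> 1 \<and> (\<exists>\<Phi> \<in> GL n. K \<subseteq> \<Phi> ` M \<and> \<Phi> ` M \<subseteq> (\<lambda>x. l *\<^sub>R x) ` K)})"

end

theory Submission
  imports Defs "HOL-Probability.Probability" "Jordan_Normal_Form.Determinant"
begin

text \<open>
  Scale \<open>K\<close> so that its John ellipsoid is the unit ball \<open>B\<close>; by symmetry and convexity the ball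
  may be centred at the origin.  Since \<open>B \<subseteq> K\<close>, the parallel body \<open>K + t B\<close> lies in \<open>(1 + t) K\<close>, so
  \<open>S(K) \<le> n V(K)\<close> and \<open>S(K)\<^sup>n / V(K)^(n - 1) \<le> n\<^sup>n V(K)\<close>.  The cube has surface area at least \<open>n 2\<^sup>n\<close>, and
  the theorem is reduced to \<open>V(K) \<le> (1 - \<gamma> \<epsilon>\<^sup>n) 2\<^sup>n\<close> with \<open>\<gamma> = n\<close> to the power \<open>-2 n\<^sup>3\<close>.

  By \<open>John_decomposition\<close> there are unit vectors \<open>u\<^sub>j\<close> and weights \<open>c\<^sub>j \<ge> 0\<close> such that
  \<open>\<Sum>\<^sub>j c\<^sub>j u\<^sub>j \<otimes> u\<^sub>j\<close> is the identity and \<open>K\<close> lies in every slab \<open>\<bar>\<langle>x, u\<^sub>j\<rangle>\<bar> \<le> 1\<close>.  That the intersection of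
  these slabs has volume at most \<open>2\<^sup>n\<close> is a theorem of Ball.  It is proved here by transport, in a
  form that keeps track of the loss.  Let \<open>T\<close> push the uniform distribution on \<open>[-1, 1]\<close> to the
  standard normal distribution.  The map \<open>\<Theta>(x) = \<Sum>\<^sub>j c\<^sub>j T(\<langle>x, u\<^sub>j\<rangle>) u\<^sub>j\<close> satisfies
  \<open>\<bar>\<Theta>(x)\<bar>\<^sup>2 \<le> \<Sum>\<^sub>j c\<^sub>j T(\<langle>x, u\<^sub>j\<rangle>)\<^sup>2\<close>, and its derivative is \<open>\<Sum>\<^sub>j c\<^sub>j t\<^sub>j u\<^sub>j \<otimes> u\<^sub>j\<close> with
  \<open>t\<^sub>j = T'(\<langle>x, u\<^sub>j\<rangle>)\<close>, whose determinant is at least \<open>exp (\<Sum>\<^sub>j c\<^sub>j ln t\<^sub>j)\<close>.  Together these say that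
  the normal density at \<open>\<Theta>(x)\<close> times the Jacobian of \<open>\<Theta>\<close> is at least \<open>2\<^sup>-\<^sup>n\<close>, and the total mass of the
  normal distribution is \<open>1\<close>.  The determinant inequality is strict unless \<open>t\<^sub>j = t\<^sub>k\<close> whenever
  \<open>\<langle>u\<^sub>j, u\<^sub>k\<rangle> \<noteq> 0\<close> (\<open>dt_weighted_ge\<close>).  Integrating the gain over a small cube yields
  \<open>slab_volume_deficit\<close>: the volume is at most \<open>2\<^sup>n - \<kappa> D\<close> for an explicit \<open>\<kappa> > 0\<close> and the defect
  \<open>D = \<Sum>\<^sub>j\<^sub>k c\<^sub>j c\<^sub>k \<langle>u\<^sub>j, u\<^sub>k\<rangle>\<^sup>2 (1 - \<langle>u\<^sub>j, u\<^sub>k\<rangle>\<^sup>2)\<close>.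

  If \<open>\<epsilon> = 0\<close>, or if \<open>D\<close> is not small compared with \<open>\<epsilon>\<^sup>n\<close>, this is already the claim.  Otherwise \<open>n\<close> of the \<open>u\<^sub>j\<close> can be
  chosen almost orthogonal (\<open>almost_orthogonal_system\<close>).  Their slabs intersect in a parallelotope
  \<open>P \<supseteq> K\<close> of volume \<open>2\<^sup>n / \<bar>det\<bar>\<close> with \<open>\<bar>det\<bar>\<close> close to \<open>1\<close>.  As \<open>K\<close> has distance at least \<open>\<epsilon>\<close> from
  the cube, some point of \<open>exp (-\<epsilon>/2) P\<close> is not in \<open>K\<close>, and a hyperplane separating it from \<open>K\<close> cuts a
  corner off \<open>P\<close> that is at least the fraction \<open>(\<epsilon>/8)\<^sup>n\<close> of \<open>P\<close> (\<open>corner_volume_bound\<close>).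

  Surface area is a one-sided derivative of volume, and the bound on \<open>S(K)\<close> needs its existence.
  It follows from the formula \<open>n! V = \<integral> exp (- gauge)\<close>: the gauge of \<open>K + t B\<close> lies below its
  chords from \<open>t = 0\<close>, so its difference quotients at \<open>0\<close> are monotone, and dominated convergence applies
  (\<open>surface_limit_exists\<close>).
\<close>

section \<open>Linear algebra in coordinates\<close>

text \<open>The dimension is a term, so vectors are functions of one index and matrices functions of two
  indices, and only the values at indices below the dimension matter.  Images under
  \<open>lin\<close> are truncated so as to lie in the model of \<open>\<real>\<^sup>n\<close>.\<close>

abbreviation Rn :: "nat \<Rightarrow> (nat \<Rightarrow> real) set"
  where "Rn n \<equiv> topspace (Euclidean_space n)"

definition ip :: "nat \<Rightarrow> (nat \<Rightarrow> real) \<Rightarrow> (nat \<Rightarrow> real) \<Rightarrow> real"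
  where "ip n x y = (\<Sum>i<n. x i * y i)"

definition lin :: "nat \<Rightarrow> (nat \<Rightarrow> nat \<Rightarrow> real) \<Rightarrow> (nat \<Rightarrow> real) \<Rightarrow> (nat \<Rightarrow> real)"
  where "lin n A x = (\<lambda>i. if i < n then ip n (A i) x else 0)"

definition mm :: "nat \<Rightarrow> (nat \<Rightarrow> nat \<Rightarrow> real) \<Rightarrow> (nat \<Rightarrow> nat \<Rightarrow> real) \<Rightarrow> (nat \<Rightarrow> nat \<Rightarrow> real)"
  where "mm n A B = (\<lambda>i j. \<Sum>k<n. A i k * B k j)"

definition dt :: "nat \<Rightarrow> (nat \<Rightarrow> nat \<Rightarrow> real) \<Rightarrow> real"
  where "dt n A = Determinant.det (mat n n (\<lambda>(i, j). A i j))"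

lemma mem_Rn: "x \<in> Rn n \<longleftrightarrow> (\<forall>i\<ge>n. x i = 0)"
  by (simp add: topspace_Euclidean_space)

lemma dt_cong: "(\<And>i j. i < n \<Longrightarrow> j < n \<Longrightarrow> A i j = B i j) \<Longrightarrow> dt n A = dt n B"
  unfolding dt_def by (rule arg_cong[where f = Determinant.det]) (auto intro!: eq_matI)

lemma dt_mm: "dt n (mm n A B) = dt n A * dt n B"
proof -
  have "mat n n (\<lambda>(i, j). mm n A B i j) = mat n n (\<lambda>(i, j). A i j) * mat n n (\<lambda>(i, j). B i j)"
    by (rule eq_matI) (auto simp: mm_def scalar_prod_def atLeast0LessThan)
  then show ?thesis
    unfolding dt_def by (simp add: det_mult[of _ n])
qed

lemma dt_transpose: "dt n (\<lambda>i j. A j i) = dt n A"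
proof -
  have "mat n n (\<lambda>(i, j). A j i) = transpose_mat (mat n n (\<lambda>(i, j). A i j))"
    by (rule eq_matI) auto
  then show ?thesis
    unfolding dt_def by (simp add: Determinant.det_transpose[of _ n])
qed

lemma dt_Leibniz:
  "dt n A = (\<Sum>p | p permutes {..<n}. of_int (sign p) * (\<Prod>i<n. A i (p i)))"
proof -
  have "dt n A = (\<Sum>p | p permutes {0..<n}. of_int (sign p) * (\<Prod>i=0..<n. A i (p i)))"
    unfolding dt_def
    by (subst det_def'[of _ n]) (auto intro!: sum.cong prod.cong simp: permutes_def)
  then show ?thesis by (simp add: atLeast0LessThan)
qed

lemma dt_id: "dt n (\<lambda>i j. if i = j then 1 else 0) = 1"
proof -
  have "mat n n (\<lambda>(i, j). if i = j then 1 else (0::real)) = 1\<^sub>m n"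
    by (rule eq_matI) auto
  then show ?thesis unfolding dt_def by simp
qed

lemma dt_inverse:
  assumes "dt n A \<noteq> 0"
  obtains B where "\<And>i j. i < n \<Longrightarrow> j < n \<Longrightarrow> mm n A B i j = (if i = j then 1 else 0)"
    and "\<And>i j. i < n \<Longrightarrow> j < n \<Longrightarrow> mm n B A i j = (if i = j then 1 else 0)"
proof -
  let ?A = "mat n n (\<lambda>(i, j). A i j)"
  have "?A \<in> Units (ring_mat TYPE(real) n ())"
    using assms unfolding dt_def by (intro det_non_zero_imp_unit) auto
  then obtain B where B: "B \<in> carrier_mat n n" "B * ?A = 1\<^sub>m n" "?A * B = 1\<^sub>m n"
    unfolding Units_def by (auto simp: ring_mat_simps)
  show ?thesis
  proof (rule that[of "\<lambda>i j. B $$ (i, j)"])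
    fix i j assume ij: "i < n" "j < n"
    have "mm n A (\<lambda>i j. B $$ (i, j)) i j = (?A * B) $$ (i, j)"
      using ij B(1) by (auto simp: mm_def scalar_prod_def atLeast0LessThan)
    then show "mm n A (\<lambda>i j. B $$ (i, j)) i j = (if i = j then 1 else 0)" using B ij by simp
    have "mm n (\<lambda>i j. B $$ (i, j)) A i j = (B * ?A) $$ (i, j)"
      using ij B(1) by (auto simp: mm_def scalar_prod_def atLeast0LessThan)
    then show "mm n (\<lambda>i j. B $$ (i, j)) A i j = (if i = j then 1 else 0)" using B ij by simp
  qed
qed

lemma dt_eq_0_kernel:
  assumes "dt n A = 0"
  obtains v where "v \<in> Rn n" "v \<noteq> 0" "\<And>i. i < n \<Longrightarrow> ip n (A i) v = 0"
proof -
  let ?A = "mat n n (\<lambda>(i, j). A i j)"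
  obtain w where w: "w \<in> carrier_vec n" "w \<noteq> 0\<^sub>v n" "?A *\<^sub>v w = 0\<^sub>v n"
    using assms det_0_iff_vec_prod_zero_field[of ?A n] unfolding dt_def by auto
  let ?v = "\<lambda>i. if i < n then vec_index w i else 0"
  show ?thesis
  proof (rule that[of ?v])
    show "?v \<in> Rn n" by (simp add: mem_Rn)
    show "?v \<noteq> 0"
    proof
      assume v0: "?v = 0"
      have "vec_index w i = 0" if "i < n" for i
        using fun_cong[OF v0, of i] that by simp
      then have "w = 0\<^sub>v n" using w(1) by (intro eq_vecI) auto
      then show False using w(2) by simp
    qed
    fix i assume i: "i < n"
    have "ip n (A i) ?v = vec_index (?A *\<^sub>v w) i"
      using i w(1) by (auto simp: ip_def scalar_prod_def atLeast0LessThan)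
    then show "ip n (A i) ?v = 0" using w(3) i by simp
  qed
qed

lemma lin_mm: "lin n (mm n A B) x = lin n A (lin n B x)"
proof
  fix i
  show "lin n (mm n A B) x i = lin n A (lin n B x) i"
  proof (cases "i < n")
    case True
    have "(\<Sum>j<n. (\<Sum>k<n. A i k * B k j) * x j) = (\<Sum>k<n. \<Sum>j<n. A i k * B k j * x j)"
      unfolding sum_distrib_right by (rule sum.swap)
    then show ?thesis using True
      by (auto simp: lin_def mm_def ip_def sum_distrib_left mult.assoc)
  qed (simp add: lin_def)
qed

lemma lin_id:
  assumes "\<And>i j. i < n \<Longrightarrow> j < n \<Longrightarrow> A i j = (if i = j then 1 else 0)" "x \<in> Rn n"
  shows "lin n A x = x"
proof
  fix i
  have "(\<Sum>j<n. A i j * x j) = x i" if "i < n"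
  proof -
    have "(\<Sum>j<n. A i j * x j) = (\<Sum>j<n. if i = j then x j else 0)"
      using assms(1) that by (intro sum.cong) auto
    then show ?thesis using that by simp
  qed
  then show "lin n A x i = x i" using assms(2) by (auto simp: lin_def ip_def mem_Rn)
qed

lemma lin_Rn [simp]: "lin n A x \<in> Rn n"
  by (simp add: mem_Rn lin_def)

section \<open>Lebesgue measure\<close>

text \<open>Lebesgue measure on the model of \<open>\<real>\<^sup>n\<close>: the product measure, moved to all functions by extension
  with zero.  Its measurable sets are the Borel sets, and the complement of \<open>Rn n\<close> is a null set.\<close>

definition leb :: "nat \<Rightarrow> (nat \<Rightarrow> real) measure"
  where "leb n = distr (\<Pi>\<^sub>M i\<in>{..<n}. lborel) borel (\<lambda>x i. if i < n then x i else 0)"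

lemma zero_extension_measurable [measurable]:
  "(\<lambda>x i. if i < n then x i else 0) \<in> (\<Pi>\<^sub>M i\<in>{..<n}. lborel) \<rightarrow>\<^sub>M (borel :: (nat \<Rightarrow> real) measure)"
proof (rule measurable_coordinatewise_then_product)
  fix i
  show "(\<lambda>x. if i < n then x i else (0::real)) \<in> borel_measurable (\<Pi>\<^sub>M i\<in>{..<n}. lborel)"
    by (cases "i < n") auto
qed

lemma sets_leb [measurable_cong, simp]: "sets (leb n) = sets borel"
  by (simp add: leb_def)

lemma space_leb [simp]: "space (leb n) = UNIV"
  by (simp add: leb_def)

lemma coord_measurable [measurable]: "(\<lambda>x::nat \<Rightarrow> real. x i) \<in> borel_measurable borel"
  by (rule borel_measurable_continuous_onI) simp

lemma nn_integral_leb: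
  assumes [measurable]: "f \<in> borel_measurable borel"
  shows "(\<integral>\<^sup>+x. f x \<partial>leb n) = (\<integral>\<^sup>+x. f (\<lambda>i. if i < n then x i else 0) \<partial>(\<Pi>\<^sub>M i\<in>{..<n}. lborel))"
  unfolding leb_def by (rule nn_integral_distr) auto

lemma vol_eq:
  assumes "A \<in> sets borel" "A \<subseteq> Rn n"
  shows "vol n A = measure (leb n) A"
proof -
  have "(\<lambda>x. restrict x {..<n}) ` A
      = (\<lambda>x i. if i < n then x i else 0) -` A \<inter> space (\<Pi>\<^sub>M i\<in>{..<n}. (lborel :: real measure))"
  proof (intro equalityI subsetI)
    fix z assume "z \<in> (\<lambda>x. restrict x {..<n}) ` A"
    then obtain x where x: "x \<in> A" "z = restrict x {..<n}" by auto
    have z_space: "z \<in> space (\<Pi>\<^sub>M i\<in>{..<n}. (lborel :: real measure))"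
      by (simp add: x(2) space_PiM)
    have "(\<lambda>i. if i < n then z i else 0) = x"
      using x assms(2) by (force simp: mem_Rn fun_eq_iff)
    then show "z \<in> (\<lambda>x i. if i < n then x i else 0) -` A \<inter> space (\<Pi>\<^sub>M i\<in>{..<n}. (lborel :: real measure))"
      using \<open>x \<in> A\<close> z_space by simp
  next
    fix z assume z: "z \<in> (\<lambda>x i. if i < n then x i else 0) -` A \<inter> space (\<Pi>\<^sub>M i\<in>{..<n}. (lborel :: real measure))"
    then have "z = restrict (\<lambda>i. if i < n then z i else 0) {..<n}"
      by (auto simp: space_PiM PiE_def extensional_def fun_eq_iff)
    moreover have "(\<lambda>i. if i < n then z i else 0) \<in> A" using z by auto
    ultimately show "z \<in> (\<lambda>x. restrict x {..<n}) ` A" by (rule image_eqI)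
  qed
  then show ?thesis
    unfolding vol_def leb_def using assms by (simp add: measure_distr)
qed

lemma AE_leb_Rn: "AE x in leb n. x \<in> Rn n"
proof -
  have [measurable]: "Measurable.pred borel (\<lambda>x. x \<in> Rn n)"
    by (simp add: mem_Rn)
  show ?thesis unfolding leb_def by (subst AE_distr_iff) (auto simp: mem_Rn)
qed

text \<open>By Fubini the substitution may be made in the \<open>i\<close>-th coordinate alone, where it is affine because
  \<open>\<phi>\<close> does not depend on that coordinate.\<close>

lemma nn_integral_leb_shear:
  assumes [measurable]: "f \<in> borel_measurable borel" "\<phi> \<in> borel_measurable borel"
    and i: "i < n" and s: "s \<noteq> 0" and \<phi>: "\<And>x y. \<phi> (x(i := y)) = \<phi> x"
  shows "(\<integral>\<^sup>+x. f x \<partial>leb n) = ennreal \<bar>s\<bar> * (\<integral>\<^sup>+x. f (x(i := s * x i + \<phi> x)) \<partial>leb n)"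
proof -
  interpret product_sigma_finite "\<lambda>_::nat. lborel :: real measure" ..
  let ?z = "\<lambda>x i. if i < n then x i else (0::real)"
  let ?I = "{..<n} - {i}"
  have I: "{..<n} = insert i ?I" using i by auto
  have upd [measurable]: "(\<lambda>x::nat \<Rightarrow> real. x(i := s * x i + \<phi> x)) \<in> borel \<rightarrow>\<^sub>M borel"
    by (intro measurable_coordinatewise_then_product) (auto simp: fun_upd_def)
  have upd2 [measurable]: "(\<lambda>y. x(i := y)) \<in> borel \<rightarrow>\<^sub>M borel" for x :: "nat \<Rightarrow> real"
    by (intro measurable_coordinatewise_then_product) (auto simp: fun_upd_def)
  have fub: "(\<integral>\<^sup>+x. g x \<partial>leb n) = (\<integral>\<^sup>+x. (\<integral>\<^sup>+y. g ((?z x)(i := y)) \<partial>lborel) \<partial>(\<Pi>\<^sub>M j\<in>?I. lborel))"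
    if [measurable]: "g \<in> borel_measurable borel" for g :: "(nat \<Rightarrow> real) \<Rightarrow> ennreal"
  proof -
    have "(\<integral>\<^sup>+x. g x \<partial>leb n) = (\<integral>\<^sup>+x. g (?z x) \<partial>(\<Pi>\<^sub>M j\<in>insert i ?I. lborel))"
      unfolding I[symmetric] by (rule nn_integral_leb) simp
    also have "\<dots> = (\<integral>\<^sup>+x. (\<integral>\<^sup>+y. g (?z (x(i := y))) \<partial>lborel) \<partial>(\<Pi>\<^sub>M j\<in>?I. lborel))"
    proof (rule product_nn_integral_insert)
      show "(\<lambda>x. g (?z x)) \<in> borel_measurable (\<Pi>\<^sub>M j\<in>insert i ?I. lborel)"
        unfolding I[symmetric] by measurable
    qed auto
    also have "\<dots> = (\<integral>\<^sup>+x. (\<integral>\<^sup>+y. g ((?z x)(i := y)) \<partial>lborel) \<partial>(\<Pi>\<^sub>M j\<in>?I. lborel))"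
    proof -
      have "?z (x(i := y)) = (?z x)(i := y)" for x y using i by auto
      then show ?thesis by simp
    qed
    finally show ?thesis .
  qed
  have "(\<integral>\<^sup>+y. f (x(i := y)) \<partial>lborel)
      = ennreal \<bar>s\<bar> * (\<integral>\<^sup>+y. f ((x(i := y))(i := s * (x(i := y)) i + \<phi> (x(i := y)))) \<partial>lborel)" for x
    using s by (subst nn_integral_real_affine[where c = s and t = "\<phi> x"]) (auto simp: \<phi> add.commute)
  then have "(\<integral>\<^sup>+x. f x \<partial>leb n) = (\<integral>\<^sup>+x. ennreal \<bar>s\<bar> * f (x(i := s * x i + \<phi> x)) \<partial>leb n)"
    by (subst (1 2) fub) (simp_all add: nn_integral_cmult)
  then show ?thesis by (simp add: nn_integral_cmult)
qed

lemma emeasure_leb_box: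
  assumes [measurable]: "\<And>i. i < n \<Longrightarrow> S i \<in> sets borel"
  shows "emeasure (leb n) {x. \<forall>i<n. x i \<in> S i} = (\<Prod>i<n. emeasure lborel (S i))"
proof -
  interpret product_sigma_finite "\<lambda>_::nat. lborel :: real measure" ..
  have "Measurable.pred borel (\<lambda>x. \<forall>i\<in>{..<n}. x i \<in> S i)" by measurable
  then have "{x \<in> space borel. \<forall>i\<in>{..<n}. x i \<in> S i} \<in> sets borel" unfolding pred_def .
  then have [measurable]: "{x. \<forall>i<n. x i \<in> S i} \<in> sets borel" by (simp add: Ball_def)
  have "emeasure (leb n) {x. \<forall>i<n. x i \<in> S i}
      = emeasure (\<Pi>\<^sub>M i\<in>{..<n}. lborel) ((\<lambda>x i. if i < n then x i else 0) -` {x. \<forall>i<n. x i \<in> S i} \<inter> space (\<Pi>\<^sub>M i\<in>{..<n}. lborel))"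
    unfolding leb_def by (rule emeasure_distr) auto
  also have "(\<lambda>x i. if i < n then x i else 0) -` {x. \<forall>i<n. x i \<in> S i} \<inter> space (\<Pi>\<^sub>M i\<in>{..<n}. lborel)
      = (\<Pi>\<^sub>E i\<in>{..<n}. S i)"
    by (auto simp: space_PiM PiE_def extensional_def Pi_def)
  also have "emeasure (\<Pi>\<^sub>M i\<in>{..<n}. lborel) \<dots> = (\<Prod>i<n. emeasure lborel (S i))"
    by (rule emeasure_PiM) auto
  finally show ?thesis .
qed

lemma emeasure_leb_cbox:
  assumes "\<And>i. i < n \<Longrightarrow> a i \<le> b i"
  shows "emeasure (leb n) {x. \<forall>i<n. a i \<le> x i \<and> x i \<le> b i} = ennreal (\<Prod>i<n. b i - a i)"
proof -
  have "emeasure (leb n) {x. \<forall>i<n. x i \<in> {a i..b i}} = (\<Prod>i<n. emeasure lborel {a i..b i})"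
    by (rule emeasure_leb_box) auto
  also have "\<dots> = (\<Prod>i<n. ennreal (b i - a i))"
    using assms by (intro prod.cong) auto
  also have "\<dots> = ennreal (\<Prod>i<n. b i - a i)"
    using assms by (intro prod_ennreal) auto
  finally show ?thesis by simp
qed

lemma lin_measurable [measurable]: "lin n A \<in> borel \<rightarrow>\<^sub>M borel"
proof (rule measurable_coordinatewise_then_product)
  fix i
  show "(\<lambda>x. lin n A x i) \<in> borel_measurable borel"
    unfolding lin_def ip_def by (cases "i < n") simp_all
qed

lemma dt_smult: "dt n (\<lambda>i j. s * A i j) = s ^ n * dt n A"
proof -
  have "mat n n (\<lambda>(i, j). s * A i j) = s \<cdot>\<^sub>m mat n n (\<lambda>(i, j). A i j)"
    by (rule eq_matI) auto
  then show ?thesis unfolding dt_def by simp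
qed

definition repl_row :: "nat \<Rightarrow> (nat \<Rightarrow> real) \<Rightarrow> nat \<Rightarrow> nat \<Rightarrow> real"
  where "repl_row i r = (\<lambda>k j. if k = i then r j else if k = j then 1 else 0)"

text \<open>In the Leibniz formula only the identity contributes: a permutation that fixes all indices but
  \<open>i\<close> fixes \<open>i\<close> too.\<close>

lemma dt_repl_row:
  assumes i: "i < n"
  shows "dt n (repl_row i r) = r i"
proof -
  have z: "(\<Prod>k<n. repl_row i r k (p k)) = 0" if p: "p permutes {..<n}" "p \<noteq> id" for p
  proof (rule ccontr)
    assume nz: "(\<Prod>k<n. repl_row i r k (p k)) \<noteq> 0"
    have fix1: "p k = k" if "k \<noteq> i" for k
    proof (cases "k < n")
      case True
      then have "repl_row i r k (p k) \<noteq> 0" using nz by auto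
      then show ?thesis using that by (auto simp: repl_row_def split: if_splits)
    next
      case False
      then show ?thesis using p(1) by (auto simp: permutes_def)
    qed
    have "p i = i"
    proof (rule ccontr)
      assume "p i \<noteq> i"
      then have "p (p i) = p i" using fix1 by blast
      then show False using \<open>p i \<noteq> i\<close> permutes_inj[OF p(1)] by (auto dest: injD)
    qed
    then have "p = id" using fix1 by (intro ext) (metis id_apply)
    then show False using p by simp
  qed
  have "dt n (repl_row i r) = (\<Sum>p\<in>{id}. of_int (sign p) * (\<Prod>k<n. repl_row i r k (p k)))"
    unfolding dt_Leibniz
    by (rule sum.mono_neutral_right) (auto simp: finite_permutations permutes_id z)
  also have "\<dots> = (\<Prod>k<n. repl_row i r k k)" by (simp add: sign_id)
  also have "\<dots> = (\<Prod>k<n. if k = i then r i else 1)"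
    by (intro prod.cong) (auto simp: repl_row_def)
  also have "\<dots> = r i" using i by simp
  finally show ?thesis .
qed

lemma nn_integral_leb_repl_row:
  assumes [measurable]: "f \<in> borel_measurable borel"
    and i: "i < n" and r: "r i \<noteq> 0"
  shows "(\<integral>\<^sup>+x. f x \<partial>leb n) = ennreal \<bar>r i\<bar> * (\<integral>\<^sup>+x. f (lin n (repl_row i r) x) \<partial>leb n)"
proof -
  let ?\<phi> = "\<lambda>x::nat \<Rightarrow> real. \<Sum>j\<in>{..<n}-{i}. r j * x j"
  have eq: "lin n (repl_row i r) x = x(i := r i * x i + ?\<phi> x)" if x: "x \<in> Rn n" for x
  proof
    fix k
    have "(\<Sum>j<n. repl_row i r k j * x j) = x k" if "k < n" "k \<noteq> i"
    proof -
      have "(\<Sum>j<n. repl_row i r k j * x j) = (\<Sum>j<n. if k = j then x j else 0)"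
        using that by (intro sum.cong) (auto simp: repl_row_def)
      then show ?thesis using that by simp
    qed
    moreover have "(\<Sum>j<n. repl_row i r i j * x j) = r i * x i + ?\<phi> x"
      using i by (subst sum.remove[of _ i]) (auto simp: repl_row_def)
    ultimately show "lin n (repl_row i r) x k = (x(i := r i * x i + ?\<phi> x)) k"
      using x i by (auto simp: lin_def ip_def mem_Rn)
  qed
  have "(\<integral>\<^sup>+x. f x \<partial>leb n) = ennreal \<bar>r i\<bar> * (\<integral>\<^sup>+x. f (x(i := r i * x i + ?\<phi> x)) \<partial>leb n)"
    using i r by (intro nn_integral_leb_shear) (auto intro!: sum.cong)
  also have "(\<integral>\<^sup>+x. f (x(i := r i * x i + ?\<phi> x)) \<partial>leb n) = (\<integral>\<^sup>+x. f (lin n (repl_row i r) x) \<partial>leb n)"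
  proof (rule nn_integral_cong_AE)
    show "AE x in leb n. f (x(i := r i * x i + ?\<phi> x)) = f (lin n (repl_row i r) x)"
      using AE_leb_Rn[of n] by eventually_elim (simp only: eq)
  qed
  finally show ?thesis .
qed

lemma mm_repl_row:
  assumes "i < n"
  shows "mm n A (repl_row i r) k j = (if j = i then 0 else if j < n then A k j else 0) + A k i * r j"
proof -
  have "mm n A (repl_row i r) k j
      = A k i * r j + (\<Sum>l\<in>{..<n}-{i}. A k l * repl_row i r l j)"
    unfolding mm_def using assms by (subst sum.remove[of _ i]) (simp_all add: repl_row_def)
  also have "(\<Sum>l\<in>{..<n}-{i}. A k l * repl_row i r l j)
      = (\<Sum>l\<in>{..<n}-{i}. if l = j then A k l else 0)"
    by (intro sum.cong) (simp_all add: repl_row_def)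
  also have "\<dots> = (if j = i then 0 else if j < n then A k j else 0)"
    by (simp add: sum.delta')
  finally show ?thesis by simp
qed

text \<open>The change of variables formula for invertible matrices, by elimination.  Multiplication by
  \<open>repl_row i r\<close> on the right is a shear composed with a scaling of coordinate \<open>i\<close>, for which the formula is
  known, so the formula for the product implies it for the matrix itself.  The induction turns one
  more row into a row of the identity matrix in each step.\<close>

theorem nn_integral_leb_lin:
  assumes "f \<in> borel_measurable borel" and "dt n A \<noteq> 0"
  shows "(\<integral>\<^sup>+x. f x \<partial>leb n) = ennreal \<bar>dt n A\<bar> * (\<integral>\<^sup>+x. f (lin n A x) \<partial>leb n)"
proof -
  define P where "P A \<longleftrightarrow> (\<forall>f\<in>borel_measurable borel.
     (\<integral>\<^sup>+x. f x \<partial>leb n) = ennreal \<bar>dt n A\<bar> * (\<integral>\<^sup>+x. f (lin n A x) \<partial>leb n))" for A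
  have step: "P A" if P: "P (mm n A (repl_row i r))" and i: "i < n" and r: "r i \<noteq> 0" for A i r
    unfolding P_def
  proof
    fix f :: "(nat \<Rightarrow> real) \<Rightarrow> ennreal" assume [measurable]: "f \<in> borel_measurable borel"
    have "(\<integral>\<^sup>+x. f x \<partial>leb n) = ennreal (\<bar>dt n A\<bar> * \<bar>r i\<bar>) * (\<integral>\<^sup>+x. f (lin n (mm n A (repl_row i r)) x) \<partial>leb n)"
      using P[unfolded P_def, rule_format, of f] by (simp only: dt_mm dt_repl_row[OF i] abs_mult) simp
    also have "\<dots> = ennreal \<bar>dt n A\<bar> * (ennreal \<bar>r i\<bar> * (\<integral>\<^sup>+x. f (lin n A (lin n (repl_row i r) x)) \<partial>leb n))"
      by (simp only: lin_mm ennreal_mult abs_ge_zero mult.assoc)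
    also have "\<dots> = ennreal \<bar>dt n A\<bar> * (\<integral>\<^sup>+x. f (lin n A x) \<partial>leb n)"
      by (subst nn_integral_leb_repl_row[where f = "\<lambda>x. f (lin n A x)" and i = i and r = r]) (simp_all add: i r)
    finally show "(\<integral>\<^sup>+x. f x \<partial>leb n) = ennreal \<bar>dt n A\<bar> * (\<integral>\<^sup>+x. f (lin n A x) \<partial>leb n)" .
  qed
  have "P A" if "k \<le> n" "dt n A \<noteq> 0" "\<And>i j. i < n - k \<Longrightarrow> j < n \<Longrightarrow> A i j = (if i = j then 1 else 0)" for k A
    using that
  proof (induction k arbitrary: A)
    case 0
    have "dt n A = dt n (\<lambda>i j. if i = j then 1 else 0)"
      using 0 by (intro dt_cong) auto
    moreover have "AE x in leb n. lin n A x = x"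
      using AE_leb_Rn by eventually_elim (rule lin_id, use 0 in auto)
    then have "(\<integral>\<^sup>+x. f (lin n A x) \<partial>leb n) = (\<integral>\<^sup>+x. f x \<partial>leb n)" for f
      by (intro nn_integral_cong_AE) auto
    ultimately show ?case unfolding P_def by (simp add: dt_id)
  next
    case (Suc k)
    define m where "m = n - Suc k"
    have m: "m < n" "n - k = Suc m" using Suc.prems by (auto simp: m_def)
    have rows: "A i j = (if i = j then 1 else 0)" if "i < m" "j < n" for i j
      using Suc.prems that by (auto simp: m_def)
    have pivot: "P A" if rows: "\<And>i j. i < m \<Longrightarrow> j < n \<Longrightarrow> A i j = (if i = j then 1 else 0)"
      and dA: "dt n A \<noteq> 0" and piv: "A m m \<noteq> 0" for A
    proof (rule step)
      let ?r = "\<lambda>j. if j = m then 1 / A m m else - A m j / A m m"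
      show "P (mm n A (repl_row m ?r))"
      proof (rule Suc.IH)
        show "dt n (mm n A (repl_row m ?r)) \<noteq> 0"
          using dA piv m by (simp add: dt_mm dt_repl_row)
        fix i j assume ij: "i < n - k" "j < n"
        then have "i < m \<or> i = m" using m by auto
        then show "mm n A (repl_row m ?r) i j = (if i = j then 1 else 0)"
          using ij m piv rows by (auto simp: mm_repl_row)
      qed (use Suc.prems in auto)
      show "m < n" by fact
      show "?r m \<noteq> 0" using piv by simp
    qed
    show ?case
    proof (cases "A m m = 0")
      case False
      then show ?thesis using pivot rows Suc.prems by blast
    next
      case True
      \<comment> \<open>A zero pivot is repaired by adding to column \<open>m\<close> a later column \<open>p\<close>.  If row \<open>m\<close> vanished from
        the diagonal on, every term of the Leibniz formula would be zero.\<close>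
      obtain p where p: "p < n" "m \<le> p" "A m p \<noteq> 0"
      proof (rule ccontr)
        assume "\<not> thesis"
        then have A0: "A m p = 0" if "m \<le> p" "p < n" for p using that \<open>\<And>p. \<lbrakk>p < n; m \<le> p; A m p \<noteq> 0\<rbrakk> \<Longrightarrow> thesis\<close> by blast
        have "(\<Prod>i<n. A i (q i)) = 0" if q: "q permutes {..<n}" for q
        proof (rule ccontr)
          assume nz: "(\<Prod>i<n. A i (q i)) \<noteq> 0"
          have ql: "q i < n" if "i < n" for i using permutes_in_image[OF q, of i] that by simp
          have fix1: "q i = i" if "i < m" for i
          proof -
            have "A i (q i) \<noteq> 0" using nz that m by auto
            then show ?thesis using rows[of i "q i"] that ql[of i] m by (auto split: if_splits)
          qed
          have "A m (q m) \<noteq> 0" using nz m by auto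
          then have "q m < m" using A0[of "q m"] ql[of m] m by force
          then have "q (q m) = q m" using fix1 by blast
          then have "q m = m" using permutes_inj[OF q] by (rule injD[rotated])
          then show False using \<open>q m < m\<close> by simp
        qed
        then have "dt n A = 0" unfolding dt_Leibniz by (intro sum.neutral) auto
        then show False using Suc.prems by simp
      qed
      then have pm: "p \<noteq> m" using True by auto
      let ?r = "\<lambda>j. if j = p \<or> j = m then 1 else 0 :: real"
      show ?thesis
      proof (rule step)
        show "P (mm n A (repl_row p ?r))"
        proof (rule pivot)
          show "mm n A (repl_row p ?r) i j = (if i = j then 1 else 0)" if "i < m" "j < n" for i j
            using that p pm rows m by (auto simp: mm_repl_row)
          show "dt n (mm n A (repl_row p ?r)) \<noteq> 0"
            using Suc.prems p by (simp add: dt_mm dt_repl_row)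
          show "mm n A (repl_row p ?r) m m \<noteq> 0"
            using p pm m True by (simp add: mm_repl_row)
        qed
      qed (use p in auto)
    qed
  qed
  from this[of n A] have "P A" using assms(2) by simp
  then show ?thesis unfolding P_def using assms(1) by blast
qed

lemma nn_integral_leb_translate:
  assumes [measurable]: "f \<in> borel_measurable borel"
  shows "(\<integral>\<^sup>+x. f (\<lambda>i. if i < n then x i + a i else x i) \<partial>leb n) = (\<integral>\<^sup>+x. f x \<partial>leb n)"
proof -
  have "(\<integral>\<^sup>+x. f (\<lambda>i. if i < k then x i + a i else x i) \<partial>leb n) = (\<integral>\<^sup>+x. f x \<partial>leb n)" if "k \<le> n" for k
    using that
  proof (induction k)
    case (Suc k)
    let ?t = "\<lambda>(x::nat \<Rightarrow> real) i. if i < k then x i + a i else x i"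
    have [measurable]: "?t \<in> borel \<rightarrow>\<^sub>M borel"
      by (intro measurable_coordinatewise_then_product) auto
    have "(\<integral>\<^sup>+x. f x \<partial>leb n) = (\<integral>\<^sup>+x. f (?t x) \<partial>leb n)" using Suc by simp
    also have "\<dots> = ennreal \<bar>1\<bar> * (\<integral>\<^sup>+x. f (?t (x(k := 1 * x k + a k))) \<partial>leb n)"
      using Suc.prems by (intro nn_integral_leb_shear) auto
    also have "(\<lambda>x. ?t (x(k := 1 * x k + a k))) = (\<lambda>x i. if i < Suc k then x i + a i else x i)"
      by (auto simp: fun_eq_iff less_Suc_eq)
    finally show ?case by simp
  qed simp
  then show ?thesis by simp
qed

lemma emeasure_leb_translate:
  assumes [measurable]: "S \<in> sets borel"
  shows "emeasure (leb n) {x. (\<lambda>i. if i < n then x i + a i else x i) \<in> S} = emeasure (leb n) S"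
proof -
  have [measurable]: "(\<lambda>(x::nat \<Rightarrow> real) i. if i < n then x i + a i else x i) \<in> borel \<rightarrow>\<^sub>M borel"
    by (intro measurable_coordinatewise_then_product) auto
  show ?thesis
    using nn_integral_leb_translate[of "indicator S" n a]
    by (simp add: nn_integral_indicator[symmetric] indicator_def[abs_def] del: nn_integral_indicator)
qed

lemma emeasure_leb_lin:
  assumes [measurable]: "S \<in> sets borel" and "dt n A \<noteq> 0"
  shows "emeasure (leb n) S = ennreal \<bar>dt n A\<bar> * emeasure (leb n) {x. lin n A x \<in> S}"
  using nn_integral_leb_lin[of "indicator S" n A] assms(2)
  by (simp add: nn_integral_indicator[symmetric] indicator_def[abs_def] del: nn_integral_indicator)

lemma measure_leb_lin:
  assumes "S \<in> sets borel" and "dt n A \<noteq> 0"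
  shows "measure (leb n) {x. lin n A x \<in> S} = measure (leb n) S / \<bar>dt n A\<bar>"
  using assms emeasure_leb_lin[OF assms] unfolding measure_def by (simp add: enn2real_mult)

section \<open>Inner products and symmetric matrices\<close>

lemma scaleR_fun_apply [simp]: "(a *\<^sub>R f) x = a *\<^sub>R f x"
  by (simp add: scaleR_fun_def)

lemma ip_commute: "ip n x y = ip n y x"
  by (simp add: ip_def mult.commute)

lemma ip_add_left: "ip n (x + y) z = ip n x z + ip n y z"
  by (simp add: ip_def distrib_right sum.distrib)

lemma ip_diff_left: "ip n (x - y) z = ip n x z - ip n y z"
  by (simp add: ip_def left_diff_distrib sum_subtractf)

lemma ip_scaleR_left: "ip n (a *\<^sub>R x) z = a * ip n x z"
  by (simp add: ip_def sum_distrib_left mult.assoc)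

lemma ip_minus_left: "ip n (- x) z = - ip n x z"
  by (simp add: ip_def sum_negf)

lemma ip_add_right: "ip n z (x + y) = ip n z x + ip n z y"
  by (simp add: ip_commute[of n z] ip_add_left)

lemma ip_diff_right: "ip n z (x - y) = ip n z x - ip n z y"
  by (simp add: ip_commute[of n z] ip_diff_left)

lemma ip_scaleR_right: "ip n z (a *\<^sub>R x) = a * ip n z x"
  by (simp add: ip_commute[of n z] ip_scaleR_left)

lemma ip_minus_right: "ip n z (- x) = - ip n z x"
  by (simp add: ip_commute[of n z] ip_minus_left)

lemmas ip_simps = ip_add_left ip_add_right ip_diff_left ip_diff_right ip_scaleR_left ip_scaleR_right
  ip_minus_left ip_minus_right

lemma ip_zero [simp]: "ip n 0 x = 0" "ip n x 0 = 0"
  by (simp_all add: ip_def)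

lemma ip_self_nonneg [simp]: "0 \<le> ip n x x"
  by (simp add: ip_def sum_nonneg)

lemma ip_self_eq_0: "x \<in> Rn n \<Longrightarrow> ip n x x = 0 \<longleftrightarrow> x = 0"
proof
  assume x: "x \<in> Rn n" and "ip n x x = 0"
  then have "\<forall>i<n. x i = 0" by (simp add: ip_def sum_nonneg_eq_0_iff)
  then show "x = 0" using x by (metis mem_Rn not_le ext zero_fun_apply)
qed simp

lemma ip_self_pos: "x \<in> Rn n \<Longrightarrow> x \<noteq> 0 \<Longrightarrow> 0 < ip n x x"
  using ip_self_eq_0[of x n] ip_self_nonneg[of n x] by linarith

lemma ip_Cauchy_Schwarz: "(ip n x y)\<^sup>2 \<le> ip n x x * ip n y y"
  using Cauchy_Schwarz_ineq_sum[of x y "{..<n}"] by (simp add: ip_def power2_eq_square)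

lemma abs_coord_le: "i < n \<Longrightarrow> (x i)\<^sup>2 \<le> ip n x x"
  unfolding ip_def power2_eq_square by (rule member_le_sum) auto

lemma ip_normalized: "0 < ip n x x \<Longrightarrow> ip n ((1 / sqrt (ip n x x)) *\<^sub>R x) ((1 / sqrt (ip n x x)) *\<^sub>R x) = 1"
  unfolding ip_scaleR_left ip_scaleR_right by (simp add: real_div_sqrt)

lemma Rn_arith [simp, intro]:
  "0 \<in> Rn n" "x \<in> Rn n \<Longrightarrow> y \<in> Rn n \<Longrightarrow> x + y \<in> Rn n" "x \<in> Rn n \<Longrightarrow> y \<in> Rn n \<Longrightarrow> x - y \<in> Rn n"
  "x \<in> Rn n \<Longrightarrow> a *\<^sub>R x \<in> Rn n" "x \<in> Rn n \<Longrightarrow> - x \<in> Rn n"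
  by (simp_all add: mem_Rn)

lemma sum_fun_apply: "(\<Sum>j\<in>J. f j) i = (\<Sum>j\<in>J. f j i)" for f :: "'j \<Rightarrow> 'i \<Rightarrow> real"
  by (induction J rule: infinite_finite_induct) simp_all

lemma ip_sum_left: "ip n (\<Sum>j\<in>J. f j) z = (\<Sum>j\<in>J. ip n (f j) z)"
  unfolding ip_def sum_fun_apply sum_distrib_right by (rule sum.swap)

lemma ip_lin_left: "ip n (lin n A x) y = ip n x (lin n (\<lambda>i j. A j i) y)"
proof -
  have "ip n (lin n A x) y = (\<Sum>i<n. \<Sum>j<n. A i j * x j * y i)"
    by (simp add: ip_def lin_def sum_distrib_right)
  also have "\<dots> = (\<Sum>j<n. \<Sum>i<n. A i j * x j * y i)" by (rule sum.swap)
  also have "\<dots> = ip n x (lin n (\<lambda>i j. A j i) y)"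
    by (simp add: ip_def lin_def sum_distrib_left mult_ac)
  finally show ?thesis .
qed

lemma ip_lin_sym:
  assumes "\<And>i j. i < n \<Longrightarrow> j < n \<Longrightarrow> A i j = A j i"
  shows "ip n (lin n A x) y = ip n x (lin n A y)"
proof -
  have "lin n (\<lambda>i j. A j i) y = lin n A y"
    using assms by (auto simp: lin_def ip_def fun_eq_iff intro!: sum.cong)
  then show ?thesis by (simp add: ip_lin_left)
qed

lemma lin_arith:
  "lin n A (x + y) = lin n A x + lin n A y" "lin n A (x - y) = lin n A x - lin n A y"
  "lin n A (a *\<^sub>R x) = a *\<^sub>R lin n A x"
  by (auto simp: lin_def ip_simps fun_eq_iff)

lemma continuous_coord [continuous_intros]: "continuous_on S (\<lambda>x::'i \<Rightarrow> real. x i)"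
  by (rule continuous_on_subset[OF continuous_on_product_coordinates]) (rule subset_UNIV)

lemma continuous_ip [continuous_intros]:
  assumes f: "continuous_on S f" and g: "continuous_on S g"
  shows "continuous_on S (\<lambda>x. ip n (f x) (g x))"
proof -
  have "continuous_on S (\<lambda>x. f x i)" for i by (rule continuous_on_product_then_coordinatewise[OF f])
  moreover have "continuous_on S (\<lambda>x. g x i)" for i by (rule continuous_on_product_then_coordinatewise[OF g])
  ultimately show ?thesis
    unfolding ip_def by (intro continuous_on_sum continuous_on_mult)
qed

lemma continuous_lin [continuous_intros]: "continuous_on S f \<Longrightarrow> continuous_on S (\<lambda>x. lin n A (f x))"
proof (rule continuous_on_coordinatewise_then_product)
  fix i assume f: "continuous_on S f"
  show "continuous_on S (\<lambda>x. lin n A (f x) i)"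
  proof (cases "i < n")
    case True
    have "continuous_on S (\<lambda>x. ip n (A i) (f x))" by (rule continuous_ip[OF continuous_on_const f])
    then show ?thesis using True by (simp only: lin_def if_True)
  next
    case False
    then have "(\<lambda>x. lin n A (f x) i) = (\<lambda>x. 0)" by (simp only: lin_def if_False)
    then show ?thesis by (simp only: continuous_on_const)
  qed
qed

text \<open>Tychonoff's theorem replaces the Heine-Borel theorem in the space of all functions.\<close>

lemma compact_box_subset:
  fixes S :: "('i \<Rightarrow> real) set"
  assumes "closed S" "\<And>x i. x \<in> S \<Longrightarrow> \<bar>x i\<bar> \<le> R i"
  shows "compact S"
proof -
  let ?B = "PiE UNIV (\<lambda>i. {- R i..R i})"
  have "compactin (product_topology (\<lambda>_. euclidean) UNIV) ?B"
    by (rule iffD2[OF compactin_PiE], rule disjI2, rule ballI, rule iffD2[OF compactin_euclidean_iff],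
        rule compact_Icc)
  then have "compactin euclidean ?B" by (rule subst[OF euclidean_product_topology, of "\<lambda>T. compactin T ?B"])
  then have B: "compact ?B" by (rule iffD1[OF compactin_euclidean_iff])
  have "S \<subseteq> ?B"
  proof
    fix x assume "x \<in> S"
    then have "- R i \<le> x i" "x i \<le> R i" for i using assms(2)[of x i] by linarith+
    then show "x \<in> ?B" by (simp add: PiE_iff)
  qed
  then have "S = ?B \<inter> S" by blast
  then show ?thesis using compact_Int_closed[OF B assms(1)] by simp
qed

lemma closed_Rn: "closed (Rn n)"
  using closedin_Euclidean_space_iff[of n "topspace (Euclidean_space n)"] by auto

lemma sum_rotate: "(\<Sum>l\<in>A. \<Sum>i\<in>B. \<Sum>j\<in>C. f l i j) = (\<Sum>i\<in>B. \<Sum>j\<in>C. \<Sum>l\<in>A. f l i j)"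
  by (rule trans[OF sum.swap]) (intro sum.cong refl sum.swap)

text \<open>The matrix with rows \<open>e 0, \<dots>, e (k - 1)\<close> and further rows zero is singular.\<close>

lemma orthogonal_vector_exists:
  assumes "k < n"
  obtains v where "v \<in> Rn n" "ip n v v = 1" "\<And>l. l < k \<Longrightarrow> ip n v (e l) = 0"
proof -
  let ?A = "\<lambda>i j. if i < k then e i j else (0::real)"
  have "(\<Prod>i<n. ?A i (p i)) = 0" for p
    using assms by (intro prod_zero) auto
  then have "dt n ?A = 0" unfolding dt_Leibniz by (simp only: mult_zero_right sum.neutral_const)
  then obtain v where v: "v \<in> Rn n" "v \<noteq> 0" "\<And>i. i < n \<Longrightarrow> ip n (?A i) v = 0"
    by (rule dt_eq_0_kernel) blast
  have pos: "ip n v v > 0" using v ip_self_pos by blast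
  show ?thesis
  proof (rule that[of "(1 / sqrt (ip n v v)) *\<^sub>R v"])
    show "ip n ((1 / sqrt (ip n v v)) *\<^sub>R v) ((1 / sqrt (ip n v v)) *\<^sub>R v) = 1"
      using pos by (rule ip_normalized)
    fix l assume l: "l < k"
    then have "ip n (e l) v = 0" using v(3)[of l] assms by (simp add: ip_def)
    then show "ip n ((1 / sqrt (ip n v v)) *\<^sub>R v) (e l) = 0"
      by (simp add: ip_simps ip_commute)
  qed (use v in auto)
qed

text \<open>The next eigenvector maximizes the quadratic form among the unit vectors orthogonal to those found
  so far.  If the maximizer \<open>v\<close> had \<open>A v = z + q v\<close> with \<open>z \<noteq> 0\<close> orthogonal to \<open>v\<close>, then moving from \<open>v\<close>
  in the direction \<open>z\<close> would increase the form to first order.\<close>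

theorem spectral_theorem:
  assumes sym: "\<And>i j. i < n \<Longrightarrow> j < n \<Longrightarrow> A i j = A j i"
  obtains e a where "\<And>l. l < n \<Longrightarrow> e l \<in> Rn n"
    and "\<And>k l. k < n \<Longrightarrow> l < n \<Longrightarrow> ip n (e k) (e l) = (if k = l then 1 else 0)"
    and "\<And>l. l < n \<Longrightarrow> lin n A (e l) = a l *\<^sub>R e l"
proof -
  define Q where "Q k \<longleftrightarrow> (\<exists>e a. (\<forall>l<k. e l \<in> Rn n \<and> lin n A (e l) = a l *\<^sub>R e l) \<and>
      (\<forall>i<k. \<forall>l<k. ip n (e i) (e l) = (if i = l then 1 else 0)))" for k :: nat
  have "Q k" if "k \<le> n" for k
    using that
  proof (induction k)
    case (Suc k)
    then have "Q k" by simp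
    then obtain e a where e: "\<And>l. l < k \<Longrightarrow> e l \<in> Rn n"
      and ev: "\<And>l. l < k \<Longrightarrow> lin n A (e l) = a l *\<^sub>R e l"
      and on: "\<And>i l. i < k \<Longrightarrow> l < k \<Longrightarrow> ip n (e i) (e l) = (if i = l then 1 else 0)"
      unfolding Q_def by blast
    define S where "S = Rn n \<inter> ({x. ip n x x = 1} \<inter> (\<Inter>l<k. {x. ip n x (e l) = 0}))"
    define q where "q x = ip n (lin n A x) x" for x
    have "closed S" unfolding S_def
      by (intro closed_Int closed_INT ballI closed_Rn closed_Collect_eq continuous_ip continuous_on_const continuous_on_id)
    moreover have "\<bar>x i\<bar> \<le> (if i < n then 1 else 0)" if "x \<in> S" for x i
    proof (cases "i < n")
      case True
      then have "(x i)\<^sup>2 \<le> 1" using abs_coord_le[of i n x] that by (auto simp: S_def)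
      then show ?thesis using True by (simp add: abs_square_le_1)
    qed (use that in \<open>auto simp: S_def mem_Rn\<close>)
    ultimately have "compact S" by (rule compact_box_subset)
    moreover obtain v0 where "v0 \<in> Rn n" "ip n v0 v0 = 1" "\<And>l. l < k \<Longrightarrow> ip n v0 (e l) = 0"
      using orthogonal_vector_exists[of k n e] Suc.prems by auto
    then have "S \<noteq> {}" unfolding S_def by blast
    moreover have "continuous_on S q" unfolding q_def by (intro continuous_ip continuous_lin continuous_on_id)
    ultimately obtain v where vS: "v \<in> S" and max: "\<And>x. x \<in> S \<Longrightarrow> q x \<le> q v"
      using continuous_attains_sup by metis
    have v: "v \<in> Rn n" "ip n v v = 1" "\<And>l. l < k \<Longrightarrow> ip n v (e l) = 0"
      using vS by (auto simp: S_def)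
    define z where "z = lin n A v - q v *\<^sub>R v"
    have Av: "lin n A v = z + q v *\<^sub>R v" by (simp add: z_def)
    have z: "z \<in> Rn n" unfolding z_def using v by auto
    have zv: "ip n z v = 0" using v by (simp add: z_def ip_simps q_def)
    have ze: "ip n z (e l) = 0" if "l < k" for l
    proof -
      have "ip n (lin n A v) (e l) = ip n v (lin n A (e l))" using sym by (rule ip_lin_sym)
      then show ?thesis using that v ev by (simp add: z_def ip_simps)
    qed
    have "ip n z z = 0"
    proof (rule ccontr)
      assume nz: "ip n z z \<noteq> 0"
      define C where "C = q v * ip n z z - q z"
      \<comment> \<open>Small enough for the first-order gain \<open>2 s \<bar>z\<bar>\<^sup>2\<close> to exceed the second-order term \<open>s\<^sup>2 C\<close>.\<close>
      define s where "s = ip n z z / (\<bar>C\<bar> + 1)"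
      have zz: "ip n z z > 0" using nz ip_self_nonneg[of n z] by linarith
      then have s: "s > 0" by (simp add: s_def)
      let ?w = "v + s *\<^sub>R z"
      have ww: "ip n ?w ?w = 1 + s\<^sup>2 * ip n z z"
        using v zv by (simp add: ip_simps ip_commute[of n v z] power2_eq_square)
      then have wpos: "ip n ?w ?w > 0" by (simp add: add_pos_nonneg)
      let ?y = "(1 / sqrt (ip n ?w ?w)) *\<^sub>R ?w"
      have "ip n ?y ?y = 1" using wpos by (rule ip_normalized)
      moreover have "ip n ?y (e l) = 0" if "l < k" for l
        unfolding ip_scaleR_left ip_add_left using v(3) ze that by simp
      moreover have "?y \<in> Rn n" using v z by (intro Rn_arith)
      ultimately have "?y \<in> S" unfolding S_def by blast
      then have "q ?y \<le> q v" by (rule max)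
      moreover have "q ?y = q ?w / ip n ?w ?w"
        unfolding q_def lin_arith(3) ip_scaleR_left ip_scaleR_right using wpos by (simp add: field_simps)
      ultimately have "q ?w / ip n ?w ?w \<le> q v" by simp
      then have "q ?w \<le> q v * ip n ?w ?w" using wpos by (simp only: pos_divide_le_eq)
      moreover have "q ?w = q v + 2 * s * ip n z z + s\<^sup>2 * q z"
      proof -
        have "ip n (lin n A z) v = ip n z (lin n A v)" using sym by (rule ip_lin_sym)
        also have "\<dots> = ip n z z" unfolding Av using zv by (simp add: ip_simps)
        finally have 1: "ip n (lin n A z) v = ip n z z" .
        have 2: "ip n (lin n A v) z = ip n z z" unfolding Av using zv by (simp add: ip_simps ip_commute[of n v])
        show ?thesis unfolding q_def lin_arith
          using 1 2 by (simp add: ip_simps power2_eq_square algebra_simps)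
      qed
      ultimately have "2 * s * ip n z z \<le> s\<^sup>2 * C" unfolding ww C_def by (simp add: algebra_simps)
      then have "s * (2 * ip n z z) \<le> s * (s * C)" by (simp add: power2_eq_square algebra_simps)
      then have "2 * ip n z z \<le> s * C" using s by simp
      also have "s * C \<le> s * (\<bar>C\<bar> + 1)" using s by (intro mult_left_mono) auto
      also have "\<dots> = ip n z z" by (simp add: s_def)
      finally show False using zz by simp
    qed
    then have "z = 0" using z ip_self_eq_0 by blast
    then have evv: "lin n A v = q v *\<^sub>R v" using Av by simp
    show ?case unfolding Q_def
      by (rule exI[of _ "e(k := v)"], rule exI[of _ "a(k := q v)"])
        (use e ev on v evv in \<open>auto simp: less_Suc_eq ip_commute\<close>)
  qed (simp add: Q_def)
  from this[of n] that show ?thesis unfolding Q_def by blast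
qed

lemma dt_diag: "dt n (\<lambda>i j. if i = j then a i else 0) = (\<Prod>i<n. a i)"
proof -
  have z: "(\<Prod>k<n. if k = p k then a k else 0) = 0" if p: "p permutes {..<n}" "p \<noteq> id" for p
  proof -
    obtain k where "p k \<noteq> k" using p(2) by (auto simp: fun_eq_iff)
    moreover then have "k < n" using p(1) by (meson lessThan_iff permutes_not_in)
    ultimately show ?thesis by (intro prod_zero) (auto intro!: bexI[of _ k])
  qed
  have "dt n (\<lambda>i j. if i = j then a i else 0) = (\<Sum>p\<in>{id}. of_int (sign p) * (\<Prod>k<n. if k = p k then a k else 0))"
    unfolding dt_Leibniz
    by (rule sum.mono_neutral_right) (auto simp: finite_permutations permutes_id z)
  then show ?thesis by (simp add: sign_id)
qed

locale orthonormal_basis =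
  fixes n :: nat and e :: "nat \<Rightarrow> nat \<Rightarrow> real"
  assumes e_Rn: "\<And>l. l < n \<Longrightarrow> e l \<in> Rn n"
    and e_ip: "\<And>k l. k < n \<Longrightarrow> l < n \<Longrightarrow> ip n (e k) (e l) = (if k = l then 1 else 0)"
begin

lemma mm_e_eT: "i < n \<Longrightarrow> j < n \<Longrightarrow> mm n e (\<lambda>i j. e j i) i j = (if i = j then 1 else 0)"
  using e_ip by (simp add: mm_def ip_def)

lemma dt_sq: "dt n e * dt n e = 1"
proof -
  have "dt n e * dt n (\<lambda>i j. e j i) = dt n (mm n e (\<lambda>i j. e j i))" by (simp add: dt_mm)
  also have "\<dots> = dt n (\<lambda>i j. if i = j then 1 else 0)" by (intro dt_cong mm_e_eT)
  finally show ?thesis by (simp only: dt_id dt_transpose[of n e])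
qed

text \<open>Orthonormal rows say that the transpose is a right inverse; a left inverse of the same square
  matrix must agree with it.\<close>

lemma columns: "i < n \<Longrightarrow> j < n \<Longrightarrow> (\<Sum>l<n. e l i * e l j) = (if i = j then 1 else 0)"
proof -
  assume ij: "i < n" "j < n"
  have "dt n e \<noteq> 0" using dt_sq by auto
  then obtain B where B: "\<And>i j. i < n \<Longrightarrow> j < n \<Longrightarrow> mm n B e i j = (if i = j then 1 else 0)"
    by (rule dt_inverse) blast
  have BT: "B i k = e k i" if "i < n" "k < n" for i k
  proof -
    have "B i k = (\<Sum>m<n. B i m * (if m = k then 1 else 0))"
      using that by (simp add: if_distrib[of "\<lambda>x. _ * x"] cong: if_cong)
    also have "\<dots> = (\<Sum>m<n. B i m * (\<Sum>j<n. e m j * e k j))"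
      using that by (intro sum.cong) (auto simp: e_ip[unfolded ip_def])
    also have "\<dots> = (\<Sum>j<n. (\<Sum>m<n. B i m * e m j) * e k j)"
      by (simp add: sum_distrib_left sum_distrib_right mult.assoc) (rule sum.swap)
    also have "\<dots> = (\<Sum>j<n. (if i = j then 1 else 0) * e k j)"
      using that B by (intro sum.cong) (auto simp: mm_def)
    also have "\<dots> = e k i" using that by (simp add: if_distrib[of "\<lambda>x. x * _"] cong: if_cong)
    finally show ?thesis .
  qed
  have "(\<Sum>l<n. e l i * e l j) = mm n B e i j" unfolding mm_def
    using ij BT by (intro sum.cong) auto
  then show ?thesis using B[OF ij] by simp
qed

lemma Parseval: "(\<Sum>l<n. ip n x (e l) * ip n y (e l)) = ip n x y"
proof -
  have "(\<Sum>l<n. ip n x (e l) * ip n y (e l)) = (\<Sum>l<n. \<Sum>i<n. \<Sum>j<n. x i * y j * (e l i * e l j))"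
    unfolding ip_def sum_product by (simp add: mult_ac)
  also have "\<dots> = (\<Sum>i<n. \<Sum>j<n. \<Sum>l<n. x i * y j * (e l i * e l j))"
    by (rule sum_rotate)
  also have "\<dots> = (\<Sum>i<n. \<Sum>j<n. x i * y j * (if i = j then 1 else 0))"
    unfolding sum_distrib_left[symmetric] by (intro sum.cong refl) (simp add: columns)
  also have "\<dots> = ip n x y"
    by (simp add: ip_def if_distrib[of "\<lambda>x. _ * x"] cong: if_cong)
  finally show ?thesis .
qed

lemma dt_eigenvalues:
  assumes "\<And>l. l < n \<Longrightarrow> lin n A (e l) = a l *\<^sub>R e l"
  shows "dt n A = (\<Prod>l<n. a l)"
proof -
  have "mm n e (mm n A (\<lambda>i j. e j i)) k l = (if k = l then a k else 0)" if "k < n" "l < n" for k l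
  proof -
    have "mm n e (mm n A (\<lambda>i j. e j i)) k l = ip n (e k) (lin n A (e l))"
      by (simp add: mm_def ip_def lin_def)
    then show ?thesis using that assms e_ip by (simp add: ip_simps)
  qed
  then have "dt n (mm n e (mm n A (\<lambda>i j. e j i))) = dt n (\<lambda>k l. if k = l then a k else 0)"
    by (intro dt_cong) auto
  then have "dt n e * (dt n A * dt n e) = (\<Prod>l<n. a l)"
    by (simp only: dt_mm dt_diag dt_transpose[of n e])
  then show ?thesis using dt_sq by (simp add: mult_ac)
qed

end

section \<open>The determinant inequality\<close>

text \<open>A decomposition \<open>\<Sum>\<^sub>j c\<^sub>j u\<^sub>j \<otimes> u\<^sub>j = 1\<close> of the identity, written in matrix entries.\<close>

definition tight_frame :: "nat \<Rightarrow> 'j set \<Rightarrow> ('j \<Rightarrow> real) \<Rightarrow> ('j \<Rightarrow> nat \<Rightarrow> real) \<Rightarrow> bool"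
  where "tight_frame n J c u \<longleftrightarrow> finite J \<and> (\<forall>j\<in>J. 0 \<le> c j \<and> u j \<in> Rn n \<and> ip n (u j) (u j) = 1) \<and>
    (\<forall>a<n. \<forall>b<n. (\<Sum>j\<in>J. c j * u j a * u j b) = (if a = b then 1 else 0))"

locale tight =
  fixes n :: nat and J :: "'j set" and c :: "'j \<Rightarrow> real" and u :: "'j \<Rightarrow> nat \<Rightarrow> real"
  assumes tight: "tight_frame n J c u"
begin

lemma finJ [simp]: "finite J" and c_nonneg: "j \<in> J \<Longrightarrow> 0 \<le> c j"
  and u_Rn: "j \<in> J \<Longrightarrow> u j \<in> Rn n" and u_unit: "j \<in> J \<Longrightarrow> ip n (u j) (u j) = 1"
  using tight by (auto simp: tight_frame_def)

lemma frame_ip: "(\<Sum>j\<in>J. c j * ip n x (u j) * ip n y (u j)) = ip n x y"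
proof -
  have "(\<Sum>j\<in>J. c j * ip n x (u j) * ip n y (u j)) = (\<Sum>j\<in>J. c j * (ip n x (u j) * ip n y (u j)))"
    by (simp add: mult.assoc)
  also have "\<dots> = (\<Sum>j\<in>J. \<Sum>a<n. \<Sum>b<n. x a * y b * (c j * u j a * u j b))"
    unfolding ip_def sum_product by (simp add: sum_distrib_left mult_ac)
  also have "\<dots> = (\<Sum>a<n. \<Sum>b<n. \<Sum>j\<in>J. x a * y b * (c j * u j a * u j b))"
    by (rule sum_rotate)
  also have "\<dots> = (\<Sum>a<n. \<Sum>b<n. x a * y b * (if a = b then 1 else 0))"
    unfolding sum_distrib_left[symmetric] using tight
    by (intro sum.cong refl) (simp add: tight_frame_def)
  also have "\<dots> = ip n x y"
    by (simp add: ip_def if_distrib[of "\<lambda>x. _ * x"] cong: if_cong)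
  finally show ?thesis .
qed

lemma sum_c: "(\<Sum>j\<in>J. c j) = real n"
proof -
  have "(\<Sum>j\<in>J. c j) = (\<Sum>j\<in>J. \<Sum>a<n. c j * u j a * u j a)"
    using u_unit by (intro sum.cong) (auto simp: sum_distrib_left[symmetric] ip_def mult.assoc)
  also have "\<dots> = (\<Sum>a<n. \<Sum>j\<in>J. c j * u j a * u j a)" by (rule sum.swap)
  also have "\<dots> = (\<Sum>a<n. 1)" using tight by (intro sum.cong) (auto simp: tight_frame_def)
  finally show ?thesis by simp
qed

definition weighted :: "('j \<Rightarrow> real) \<Rightarrow> nat \<Rightarrow> nat \<Rightarrow> real"
  where "weighted t = (\<lambda>a b. \<Sum>j\<in>J. c j * t j * u j a * u j b)"

lemma lin_weighted: "lin n (weighted t) x = (\<Sum>j\<in>J. (c j * t j * ip n (u j) x) *\<^sub>R u j)"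
proof
  fix i
  have "(\<Sum>b<n. (\<Sum>j\<in>J. c j * t j * u j i * u j b) * x b) = (\<Sum>j\<in>J. \<Sum>b<n. c j * t j * u j i * u j b * x b)"
    unfolding sum_distrib_right by (rule sum.swap)
  also have "\<dots> = (\<Sum>j\<in>J. c j * t j * ip n (u j) x * u j i)"
    by (intro sum.cong) (auto simp: ip_def sum_distrib_left sum_distrib_right mult_ac)
  finally show "lin n (weighted t) x i = (\<Sum>j\<in>J. (c j * t j * ip n (u j) x) *\<^sub>R u j) i"
    using u_Rn by (auto simp: lin_def weighted_def ip_def sum_fun_apply mem_Rn intro!: sum.neutral[symmetric])
qed

lemma ip_lin_weighted: "ip n (lin n (weighted t) x) y = (\<Sum>j\<in>J. c j * t j * ip n (u j) x * ip n (u j) y)"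
  by (simp add: lin_weighted ip_sum_left ip_simps)

lemma ip_lin_weighted_right: "ip n y (lin n (weighted t) x) = (\<Sum>j\<in>J. c j * t j * ip n (u j) x * ip n y (u j))"
  unfolding ip_commute[of n y "lin n (weighted t) x"] ip_lin_weighted by (simp add: ip_commute[of n y])

end

text \<open>On \<open>(0, M]\<close> the second derivative of \<open>ln\<close> is at most \<open>-1 / M\<^sup>2\<close>, so the graph lies below its tangent
  by at least the corresponding quadratic term.\<close>

lemma ln_le_parabola:
  fixes t a M :: real
  assumes t: "0 < t" "t \<le> M" and a: "0 < a" "a \<le> M"
  shows "ln t \<le> ln a + (t - a) / a - (t - a)\<^sup>2 / (2 * M\<^sup>2)"
proof -
  define f where "f x = ln a + (x - a) / a - (x - a)\<^sup>2 / (2 * M\<^sup>2) - ln x" for x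
  have M: "M > 0" using t by linarith
  have D: "(f has_real_derivative (x - a) * (1 / (a * x) - 1 / M\<^sup>2)) (at x)" if "x > 0" for x
    unfolding f_def using that a M
    by (auto intro!: derivative_eq_intros simp: field_simps power2_eq_square)
  have pos: "1 / (a * x) - 1 / M\<^sup>2 \<ge> 0" if "0 < x" "x \<le> M" for x
  proof -
    have "a * x \<le> M\<^sup>2" unfolding power2_eq_square using that a by (intro mult_mono) auto
    then show ?thesis using that a by (simp add: frac_le)
  qed
  have "f a \<le> f t"
  proof (cases "a \<le> t")
    case True
    show ?thesis
    proof (rule DERIV_nonneg_imp_nondecreasing[OF True])
      fix x assume "a \<le> x" "x \<le> t"
      then show "\<exists>y. (f has_real_derivative y) (at x) \<and> 0 \<le> y"
        using D[of x] pos[of x] a t by (intro exI[of _ "(x - a) * (1 / (a * x) - 1 / M\<^sup>2)"]) auto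
    qed
  next
    case False
    then have ta: "t \<le> a" by simp
    show ?thesis
    proof (rule DERIV_nonpos_imp_nonincreasing[OF ta])
      fix x assume "t \<le> x" "x \<le> a"
      then show "\<exists>y. (f has_real_derivative y) (at x) \<and> y \<le> 0"
        using D[of x] pos[of x] a t
        by (intro exI[of _ "(x - a) * (1 / (a * x) - 1 / M\<^sup>2)"]) (auto intro!: mult_nonpos_nonneg)
    qed
  qed
  then show ?thesis by (simp add: f_def)
qed

context tight
begin

text \<open>The eigenvalues \<open>a\<^sub>l\<close> of \<open>\<Sum>\<^sub>j c\<^sub>j t\<^sub>j u\<^sub>j \<otimes> u\<^sub>j\<close> are averages of the \<open>t\<^sub>j\<close> with the weights \<open>c\<^sub>j p\<^sub>j\<^sub>l\<close>, where
  \<open>p\<^sub>j\<^sub>l = \<langle>u\<^sub>j, e\<^sub>l\<rangle>\<^sup>2\<close> and \<open>\<Sum>\<^sub>l p\<^sub>j\<^sub>l = 1\<close>.  Jensen's inequality for \<open>ln\<close>, summed over \<open>l\<close>, gives the determinant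
  inequality without the second factor.  The quadratic term of \<open>ln_le_parabola\<close> adds the weighted variance of
  the \<open>t\<^sub>j\<close>; summed over \<open>l\<close> it no longer involves the eigenvectors, since
  \<open>\<Sum>\<^sub>l a\<^sub>l\<^sup>2\<close> is the trace of the squared matrix.\<close>

theorem dt_weighted_ge:
  assumes t: "\<And>j. j \<in> J \<Longrightarrow> 1 \<le> t j" "\<And>j. j \<in> J \<Longrightarrow> t j \<le> M" and M: "1 \<le> M"
  shows "exp (\<Sum>j\<in>J. c j * ln (t j)) *
      (1 + (\<Sum>j\<in>J. \<Sum>k\<in>J. c j * c k * (ip n (u j) (u k))\<^sup>2 * (t j - t k)\<^sup>2) / (4 * M\<^sup>2))
    \<le> dt n (weighted t)"
proof -
  have sym: "weighted t i j = weighted t j i" for i j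
    by (simp add: weighted_def mult_ac)
  obtain e a where e: "\<And>l. l < n \<Longrightarrow> e l \<in> Rn n"
      "\<And>k l. k < n \<Longrightarrow> l < n \<Longrightarrow> ip n (e k) (e l) = (if k = l then 1 else 0)"
    and ev: "\<And>l. l < n \<Longrightarrow> lin n (weighted t) (e l) = a l *\<^sub>R e l"
    using spectral_theorem[of n "weighted t"] sym by metis
  interpret orthonormal_basis n e by standard (use e in auto)
  define p where "p j l = (ip n (u j) (e l))\<^sup>2" for j l
  have p_nonneg: "0 \<le> p j l" for j l by (simp add: p_def)
  have p1: "(\<Sum>j\<in>J. c j * p j l) = 1" if "l < n" for l
    using frame_ip[of "e l" "e l"] e_ip[of l l] that
    by (simp add: p_def power2_eq_square ip_commute mult.assoc)
  have p2: "(\<Sum>l<n. p j l) = 1" if "j \<in> J" for j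
    using Parseval[of "u j" "u j"] u_unit that by (simp add: p_def power2_eq_square)
  have a_eq: "a l = (\<Sum>j\<in>J. c j * p j l * t j)" if "l < n" for l
  proof -
    have "a l = ip n (lin n (weighted t) (e l)) (e l)" using ev e_ip that by (simp add: ip_simps)
    also have "\<dots> = (\<Sum>j\<in>J. c j * p j l * t j)"
      unfolding ip_lin_weighted by (simp add: p_def power2_eq_square mult_ac)
    finally show ?thesis .
  qed
  have a1: "1 \<le> a l" if "l < n" for l
  proof -
    have "(\<Sum>j\<in>J. c j * p j l * 1) \<le> a l" unfolding a_eq[OF that]
      using t c_nonneg p_nonneg by (intro sum_mono mult_left_mono) auto
    then show ?thesis using p1[OF that] by simp
  qed
  have a_pos: "0 < a l" if "l < n" for l using a1[OF that] by simp
  have t_pos: "0 < t j" if "j \<in> J" for j using t(1)[OF that] by simp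
  have aM: "a l \<le> M" if "l < n" for l
  proof -
    have "a l \<le> (\<Sum>j\<in>J. c j * p j l * M)" unfolding a_eq[OF that]
      using t c_nonneg p_nonneg by (intro sum_mono mult_left_mono) auto
    then show ?thesis using p1[OF that] by (simp add: sum_distrib_right[symmetric])
  qed
  have Jensen: "(\<Sum>j\<in>J. c j * p j l * ln (t j)) + ((\<Sum>j\<in>J. c j * p j l * (t j)\<^sup>2) - (a l)\<^sup>2) / (2 * M\<^sup>2) \<le> ln (a l)"
    if l: "l < n" for l
  proof -
    have "(\<Sum>j\<in>J. c j * p j l * ln (t j))
        \<le> (\<Sum>j\<in>J. c j * p j l * (ln (a l) + (t j - a l) / a l - (t j - a l)\<^sup>2 / (2 * M\<^sup>2)))"
      using t t_pos c_nonneg p_nonneg a_pos[OF l] aM[OF l]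
      by (intro sum_mono mult_left_mono ln_le_parabola mult_nonneg_nonneg) blast+
    also have "\<dots> = (\<Sum>j\<in>J. (c j * p j l) * (ln (a l) - 1 - (a l)\<^sup>2 / (2 * M\<^sup>2))
        + (c j * p j l * t j) * (1 / a l + a l / M\<^sup>2) - (c j * p j l * (t j)\<^sup>2) / (2 * M\<^sup>2))"
      using a1[OF l] M by (intro sum.cong refl) (simp add: field_simps power2_eq_square)
    also have "\<dots> = (\<Sum>j\<in>J. c j * p j l) * (ln (a l) - 1 - (a l)\<^sup>2 / (2 * M\<^sup>2))
        + (\<Sum>j\<in>J. c j * p j l * t j) * (1 / a l + a l / M\<^sup>2) - (\<Sum>j\<in>J. c j * p j l * (t j)\<^sup>2) / (2 * M\<^sup>2)"
      by (simp only: sum_subtractf sum.distrib sum_distrib_right sum_divide_distrib)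
    also have "\<dots> = (ln (a l) - 1 - (a l)\<^sup>2 / (2 * M\<^sup>2))
        + a l * (1 / a l + a l / M\<^sup>2) - (\<Sum>j\<in>J. c j * p j l * (t j)\<^sup>2) / (2 * M\<^sup>2)"
      using p1[OF l] a_eq[OF l] by simp
    also have "\<dots> = ln (a l) - ((\<Sum>j\<in>J. c j * p j l * (t j)\<^sup>2) - (a l)\<^sup>2) / (2 * M\<^sup>2)"
      using a1[OF l] M by (simp add: field_simps power2_eq_square)
    finally show ?thesis by simp
  qed
  have S1: "(\<Sum>l<n. \<Sum>j\<in>J. c j * p j l * f j) = (\<Sum>j\<in>J. c j * f j)" for f
  proof -
    have "(\<Sum>l<n. \<Sum>j\<in>J. c j * p j l * f j) = (\<Sum>j\<in>J. \<Sum>l<n. c j * p j l * f j)" by (rule sum.swap)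
    also have "\<dots> = (\<Sum>j\<in>J. (c j * f j) * (\<Sum>l<n. p j l))" by (simp add: sum_distrib_left mult_ac)
    finally show ?thesis using p2 by simp
  qed
  let ?g = "\<lambda>j k. (ip n (u j) (u k))\<^sup>2"
  have S2: "(\<Sum>l<n. (a l)\<^sup>2) = (\<Sum>j\<in>J. \<Sum>k\<in>J. c j * c k * ?g j k * (t j * t k))"
  proof -
    have "(\<Sum>l<n. (a l)\<^sup>2) = (\<Sum>l<n. ip n (lin n (weighted t) (e l)) (lin n (weighted t) (e l)))"
      using ev e_ip by (intro sum.cong) (auto simp: ip_simps power2_eq_square)
    also have "\<dots> = (\<Sum>l<n. \<Sum>j\<in>J. \<Sum>k\<in>J. (c j * c k * ip n (u j) (u k) * (t j * t k)) * (ip n (u j) (e l) * ip n (u k) (e l)))"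
    proof (intro sum.cong refl)
      fix l
      show "ip n (lin n (weighted t) (e l)) (lin n (weighted t) (e l))
        = (\<Sum>j\<in>J. \<Sum>k\<in>J. (c j * c k * ip n (u j) (u k) * (t j * t k)) * (ip n (u j) (e l) * ip n (u k) (e l)))"
        unfolding ip_lin_weighted ip_lin_weighted_right
        by (simp add: sum_distrib_left mult_ac ip_commute[of n "u _" "u _"])
    qed
    also have "\<dots> = (\<Sum>j\<in>J. \<Sum>k\<in>J. \<Sum>l<n. (c j * c k * ip n (u j) (u k) * (t j * t k)) * (ip n (u j) (e l) * ip n (u k) (e l)))"
      by (rule sum_rotate)
    also have "\<dots> = (\<Sum>j\<in>J. \<Sum>k\<in>J. c j * c k * ?g j k * (t j * t k))"
      unfolding sum_distrib_left[symmetric] Parseval by (simp add: power2_eq_square mult_ac)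
    finally show ?thesis .
  qed
  have g1: "(\<Sum>k\<in>J. c k * ?g j k) = 1" if "j \<in> J" for j
    using frame_ip[of "u j" "u j"] u_unit[OF that] by (simp add: power2_eq_square mult.assoc)
  have S3: "(\<Sum>j\<in>J. \<Sum>k\<in>J. c j * c k * ?g j k * (t j - t k)\<^sup>2)
      = 2 * ((\<Sum>j\<in>J. c j * (t j)\<^sup>2) - (\<Sum>j\<in>J. \<Sum>k\<in>J. c j * c k * ?g j k * (t j * t k)))"
  proof -
    have "(\<Sum>j\<in>J. \<Sum>k\<in>J. c j * c k * ?g j k * (t j - t k)\<^sup>2)
      = (\<Sum>j\<in>J. \<Sum>k\<in>J. c j * c k * ?g j k * (t j)\<^sup>2) + (\<Sum>j\<in>J. \<Sum>k\<in>J. c j * c k * ?g j k * (t k)\<^sup>2)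
        - 2 * (\<Sum>j\<in>J. \<Sum>k\<in>J. c j * c k * ?g j k * (t j * t k))"
      by (simp add: sum.distrib[symmetric] sum_subtractf[symmetric] sum_distrib_left power2_eq_square algebra_simps)
    moreover have "(\<Sum>j\<in>J. \<Sum>k\<in>J. c j * c k * ?g j k * (t j)\<^sup>2) = (\<Sum>j\<in>J. c j * (t j)\<^sup>2)"
    proof (rule sum.cong[OF refl])
      fix j assume "j \<in> J"
      have "(\<Sum>k\<in>J. c j * c k * ?g j k * (t j)\<^sup>2) = (c j * (t j)\<^sup>2) * (\<Sum>k\<in>J. c k * ?g j k)"
        by (simp add: sum_distrib_left mult_ac)
      then show "(\<Sum>k\<in>J. c j * c k * ?g j k * (t j)\<^sup>2) = c j * (t j)\<^sup>2" using g1[OF \<open>j \<in> J\<close>] by simp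
    qed
    moreover have "(\<Sum>j\<in>J. \<Sum>k\<in>J. c j * c k * ?g j k * (t k)\<^sup>2) = (\<Sum>j\<in>J. \<Sum>k\<in>J. c j * c k * ?g j k * (t j)\<^sup>2)"
      by (subst sum.swap) (simp add: mult_ac ip_commute)
    ultimately show ?thesis by simp
  qed
  let ?D = "(\<Sum>j\<in>J. \<Sum>k\<in>J. c j * c k * ?g j k * (t j - t k)\<^sup>2) / (4 * M\<^sup>2)"
  have "(\<Sum>j\<in>J. c j * ln (t j)) + ?D
      = (\<Sum>l<n. (\<Sum>j\<in>J. c j * p j l * ln (t j)) + ((\<Sum>j\<in>J. c j * p j l * (t j)\<^sup>2) - (a l)\<^sup>2) / (2 * M\<^sup>2))"
    unfolding sum.distrib sum_divide_distrib[symmetric] sum_subtractf S1 S2 S3 using M by (simp add: field_simps)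
  also have "\<dots> \<le> (\<Sum>l<n. ln (a l))" by (intro sum_mono Jensen) auto
  also have "\<dots> = ln (\<Prod>l<n. a l)" using a_pos by (subst ln_prod) (auto, metis less_irrefl)
  also have "\<dots> = ln (dt n (weighted t))" using dt_eigenvalues[OF ev] by simp
  finally have ln: "(\<Sum>j\<in>J. c j * ln (t j)) + ?D \<le> ln (dt n (weighted t))" .
  have dt_eq: "dt n (weighted t) = (\<Prod>l<n. a l)" by (rule dt_eigenvalues) (rule ev)
  have pos: "dt n (weighted t) > 0" unfolding dt_eq
    using a_pos by (intro prod_pos) auto
  have "exp (\<Sum>j\<in>J. c j * ln (t j)) * (1 + ?D) \<le> exp (\<Sum>j\<in>J. c j * ln (t j)) * exp ?D"
    by (intro mult_left_mono exp_ge_add_one_self) auto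
  also have "\<dots> \<le> exp (ln (dt n (weighted t)))" using ln by (simp add: exp_add[symmetric])
  finally show ?thesis using pos by simp
qed

end

section \<open>Separation and convex hulls in finitely many coordinates\<close>

text \<open>The normal \<open>h = p - q\<close> comes from the point \<open>q\<close> of \<open>C\<close> nearest to \<open>p\<close>.  The index type is arbitrary, so
  that the lemma also serves for matrices, indexed by pairs.\<close>

lemma separate_point_compact_convex:
  fixes C :: "('i \<Rightarrow> real) set"
  assumes I: "finite I" and C: "compact C" "convex C" and p: "p \<notin> C"
    and supp: "\<And>x i. x \<in> insert p C \<Longrightarrow> i \<notin> I \<Longrightarrow> x i = 0"
  obtains h \<delta> where "0 < \<delta>" "\<And>x. x \<in> C \<Longrightarrow> (\<Sum>i\<in>I. h i * x i) \<le> (\<Sum>i\<in>I. h i * p i) - \<delta>"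
    "\<And>i. i \<notin> I \<Longrightarrow> h i = 0"
proof (cases "C = {}")
  case True
  then show ?thesis using that[of 1 "\<lambda>_. 0"] by auto
next
  case False
  define d where "d x = (\<Sum>i\<in>I. (p i - x i)\<^sup>2)" for x
  have cont: "continuous_on C d"
    unfolding d_def by (intro continuous_on_sum continuous_on_power continuous_on_diff continuous_on_const continuous_coord)
  obtain q where q: "q \<in> C" and min: "\<And>x. x \<in> C \<Longrightarrow> d q \<le> d x"
    using continuous_attains_inf[OF C(1) False cont] by blast
  define h where "h i = p i - q i" for i
  define \<delta> where "\<delta> = (\<Sum>i\<in>I. (h i)\<^sup>2)"
  have "\<delta> \<noteq> 0"
  proof
    assume "\<delta> = 0"
    then have "\<forall>i\<in>I. h i = 0" unfolding \<delta>_def using I by (simp add: sum_nonneg_eq_0_iff)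
    then have "p i = q i" for i
      using supp[of p i] supp[of q i] q by (cases "i \<in> I") (auto simp: h_def)
    then have "p = q" by (rule ext)
    then show False using p q by simp
  qed
  then have \<delta>: "0 < \<delta>" unfolding \<delta>_def by (simp add: sum_nonneg less_le)
  show ?thesis
  proof (rule that[OF \<delta>, of h])
    fix x assume x: "x \<in> C"
    define g where "g = (\<Sum>i\<in>I. h i * (x i - q i))"
    define e where "e = (\<Sum>i\<in>I. (x i - q i)\<^sup>2)"
    have e0: "0 \<le> e" unfolding e_def by (simp add: sum_nonneg)
    have le: "2 * t * g \<le> t\<^sup>2 * e" if t: "0 < t" "t \<le> 1" for t
    proof -
      have "(1 - t) *\<^sub>R q + t *\<^sub>R x \<in> C" using C(2) q x t by (intro convexD) auto
      then have "d q \<le> d ((1 - t) *\<^sub>R q + t *\<^sub>R x)" by (rule min)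
      also have "d ((1 - t) *\<^sub>R q + t *\<^sub>R x) = (\<Sum>i\<in>I. (h i)\<^sup>2 - 2 * t * (h i * (x i - q i)) + t\<^sup>2 * (x i - q i)\<^sup>2)"
        unfolding d_def h_def by (intro sum.cong refl) (simp add: power2_eq_square algebra_simps)
      also have "\<dots> = d q - 2 * t * g + t\<^sup>2 * e"
        unfolding g_def e_def d_def h_def by (simp add: sum.distrib sum_subtractf sum_distrib_left)
      finally show ?thesis by simp
    qed
    have "g \<le> 0"
    proof (rule ccontr)
      assume "\<not> g \<le> 0"
      then have g: "0 < g" by simp
      define t where "t = min 1 (g / (e + 1))"
      have "t \<le> g / (e + 1)" "t \<le> 1" "0 < t" using g e0 by (simp_all add: t_def)
      then have t: "0 < t" "t \<le> 1" "t * (e + 1) \<le> g" using e0 by (simp_all add: pos_le_divide_eq)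
      have "t * (2 * g) \<le> t * (t * e)" using le[OF t(1,2)] by (simp add: power2_eq_square mult_ac)
      then have "2 * g \<le> t * e" using t by simp
      also have "t * e \<le> t * (e + 1)" using t by simp
      finally show False using t g by simp
    qed
    moreover have "g = (\<Sum>i\<in>I. h i * x i) - (\<Sum>i\<in>I. h i * p i) + \<delta>"
      unfolding g_def \<delta>_def h_def
      by (simp add: sum.distrib[symmetric] sum_subtractf[symmetric] power2_eq_square algebra_simps)
    ultimately show "(\<Sum>i\<in>I. h i * x i) \<le> (\<Sum>i\<in>I. h i * p i) - \<delta>" by simp
  next
    fix i assume "i \<notin> I"
    then show "h i = 0" using supp[of p i] supp[of q i] q by (simp add: h_def)
  qed
qed

lemma separate_Rn:
  assumes C: "compact C" "convex C" "C \<subseteq> Rn n" and p: "p \<in> Rn n" "p \<notin> C" and C0: "C \<noteq> {}"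
  obtains v \<delta> where "v \<in> Rn n" "0 < \<delta>" "ip n v v = 1" "\<And>x. x \<in> C \<Longrightarrow> ip n x v \<le> ip n p v - \<delta>"
proof -
  obtain h \<delta> where \<delta>: "0 < \<delta>" and h: "\<And>x. x \<in> C \<Longrightarrow> ip n h x \<le> ip n h p - \<delta>" "\<And>i. i \<notin> {..<n} \<Longrightarrow> h i = 0"
    unfolding ip_def
    by (rule separate_point_compact_convex[of "{..<n}" C p]) (use C p in \<open>auto simp: mem_Rn subset_iff\<close>)
  have hR: "h \<in> Rn n" using h(2) by (auto simp: mem_Rn)
  have "h \<noteq> 0" using h(1) \<delta> C0 by fastforce
  then have pos: "0 < ip n h h" using hR ip_self_pos by blast
  let ?r = "1 / sqrt (ip n h h)"
  show ?thesis
  proof (rule that[of "?r *\<^sub>R h" "?r * \<delta>"])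
    show "ip n (?r *\<^sub>R h) (?r *\<^sub>R h) = 1" using pos by (rule ip_normalized)
    fix x assume "x \<in> C"
    then have "?r * ip n h x \<le> ?r * (ip n h p - \<delta>)" using h(1) pos by (intro mult_left_mono) auto
    then show "ip n x (?r *\<^sub>R h) \<le> ip n p (?r *\<^sub>R h) - ?r * \<delta>"
      unfolding ip_scaleR_right ip_commute[of n x h] ip_commute[of n p h] by (simp only: right_diff_distrib)
  qed (use hR pos \<delta> in auto)
qed

text \<open>In a convex combination with the least number of points these are affinely independent: otherwise
  an affine dependence could be subtracted until one weight vanishes.\<close>

lemma Caratheodory_hull:
  fixes S :: "('i \<Rightarrow> real) set"
  assumes I: "finite I" and supp: "\<forall>x\<in>S. \<forall>i. i \<notin> I \<longrightarrow> x i = 0" and p: "p \<in> convex hull S"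
  obtains T w where "finite T" "T \<subseteq> S" "card T \<le> card I + 1" "\<And>x. x \<in> T \<Longrightarrow> 0 \<le> w x"
    "sum w T = 1" "(\<Sum>x\<in>T. w x *\<^sub>R x) = p"
proof -
  define P where "P k \<longleftrightarrow> (\<exists>T w. finite T \<and> T \<subseteq> S \<and> card T = k \<and> (\<forall>x\<in>T. 0 \<le> w x) \<and> sum w T = 1 \<and> (\<Sum>x\<in>T. w x *\<^sub>R x) = p)" for k
  obtain T0 w0 where "finite T0" "T0 \<subseteq> S" "\<forall>x\<in>T0. 0 \<le> w0 x" "sum w0 T0 = 1" "(\<Sum>x\<in>T0. w0 x *\<^sub>R x) = p"
    using p unfolding convex_hull_explicit by blast
  then have "P (card T0)" unfolding P_def by blast
  then have Pl: "P (LEAST k. P k)" by (rule LeastI)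
  define k where "k = (LEAST k. P k)"
  obtain T w where T: "finite T" "T \<subseteq> S" "card T = k" "\<forall>x\<in>T. 0 \<le> w x" "sum w T = 1" "(\<Sum>x\<in>T. w x *\<^sub>R x) = p"
    using Pl unfolding P_def k_def by blast
  have "k \<le> card I + 1"
  proof (rule ccontr)
    assume big: "\<not> k \<le> card I + 1"
    then have "T \<noteq> {}" using T(3) by (metis card.empty le_0_eq not_le zero_le)
    then obtain x0 where x0: "x0 \<in> T" by blast
    define T' where "T' = T - {x0}"
    have T': "T = insert x0 T'" "x0 \<notin> T'" "finite T'" "card T' > card I"
      using x0 T big by (auto simp: T'_def)
    define D where "D = (\<lambda>x. x - x0) ` T'"
    have cardD: "card D = card T'" unfolding D_def by (rule card_image) (simp add: inj_on_def)
    define B where "B = (\<lambda>i j. if i = j then 1 else 0 :: real) ` I"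
    have "D \<subseteq> span B"
    proof
      fix y assume "y \<in> D"
      then obtain x where x: "x \<in> T'" "y = x - x0" unfolding D_def by blast
      then have "x \<in> S" "x0 \<in> S" using T(2) T'(1) by auto
      then have y0: "y i = 0" if "i \<notin> I" for i
        using supp[rule_format, of x i] supp[rule_format, of x0 i] that x(2) by simp
      have "y = (\<Sum>i\<in>I. y i *\<^sub>R (\<lambda>j. if i = j then 1 else 0))"
      proof
        fix j
        have "(\<Sum>i\<in>I. y i *\<^sub>R (\<lambda>j. if i = j then 1 else 0)) j = (\<Sum>i\<in>I. if i = j then y i else 0)"
          unfolding sum_fun_apply by (intro sum.cong) auto
        also have "\<dots> = y j" using I y0 by simp
        finally show "y j = (\<Sum>i\<in>I. y i *\<^sub>R (\<lambda>j. if i = j then 1 else 0)) j" by simp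
      qed
      also have "\<dots> \<in> span B" by (intro span_sum span_scale span_base) (auto simp: B_def)
      finally show "y \<in> span B" .
    qed
    moreover have "finite B" "card B \<le> card I" using I by (auto simp: B_def card_image_le)
    ultimately have "dependent D" using independent_span_bound[of B D] cardD T'(4) by force
    then have "affine_dependent T"
      unfolding T'(1) D_def using affine_dependent_iff_dependent[OF T'(2)] by simp
    then obtain U v where U: "sum U T = 0" "v \<in> T" "U v \<noteq> 0" "(\<Sum>x\<in>T. U x *\<^sub>R x) = 0"
      using affine_dependent_explicit_finite[OF T(1)] by blast
    have "\<exists>x\<in>T. 0 < U x"
    proof (rule ccontr)
      assume "\<not> (\<exists>x\<in>T. 0 < U x)"
      then have "\<forall>x\<in>T. 0 \<le> - U x" by (auto simp: not_less)
      moreover have "(\<Sum>x\<in>T. - U x) = 0" using U(1) by (simp add: sum_negf)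
      ultimately have "- U v = 0" using sum_nonneg_eq_0_iff[of T "\<lambda>x. - U x"] T(1) U(2) by blast
      then show False using U(3) by simp
    qed
    define Q where "Q = {x \<in> T. 0 < U x}"
    have Q: "finite Q" "Q \<noteq> {}" using T(1) \<open>\<exists>x\<in>T. 0 < U x\<close> by (auto simp: Q_def)
    obtain z where z: "z \<in> Q" and zmin: "\<And>x. x \<in> Q \<Longrightarrow> w z / U z \<le> w x / U x"
      using arg_min_if_finite[OF Q, of "\<lambda>x. w x / U x"] by (meson not_le)
    define t where "t = w z / U z"
    have t0: "0 \<le> t" using z T(4) by (auto simp: t_def Q_def)
    define w' where "w' x = w x - t * U x" for x
    have w'z: "w' z = 0" using z by (simp add: w'_def t_def Q_def)
    have w'0: "0 \<le> w' x" if "x \<in> T" for x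
    proof (cases "0 < U x")
      case True
      then have "t \<le> w x / U x" using zmin that by (simp add: t_def Q_def)
      then show ?thesis using True by (simp add: w'_def field_simps)
    next
      case False
      then have "t * U x \<le> 0" using t0 by (simp add: mult_nonneg_nonpos)
      then show ?thesis using T(4) that by (fastforce simp: w'_def)
    qed
    have zT: "z \<in> T" using z by (simp add: Q_def)
    have "sum w' T = 1" using T(5) U(1) by (simp add: w'_def sum_subtractf sum_distrib_left[symmetric])
    then have s1: "sum w' (T - {z}) = 1" using zT T(1) w'z by (simp add: sum_diff1)
    have "(\<Sum>x\<in>T. w' x *\<^sub>R x) = (\<Sum>x\<in>T. w x *\<^sub>R x) - t *\<^sub>R (\<Sum>x\<in>T. U x *\<^sub>R x)"
      by (simp add: w'_def sum_subtractf scaleR_diff_left scaleR_sum_right)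
    then have "(\<Sum>x\<in>T. w' x *\<^sub>R x) = p" using T(6) U(4) by simp
    then have s2: "(\<Sum>x\<in>T-{z}. w' x *\<^sub>R x) = p" using zT T(1) w'z by (simp add: sum.remove)
    have "P (card (T - {z}))" unfolding P_def
      by (rule exI[of _ "T - {z}"], rule exI[of _ w']) (use T s1 s2 w'0 in auto)
    then have "k \<le> card (T - {z})" unfolding k_def by (rule Least_le)
    moreover have "card (T - {z}) < card T" using T(1) zT by (rule card_Diff1_less)
    ultimately show False using T(3) by simp
  qed
  then show ?thesis using that T by blast
qed

text \<open>Starting with \<open>S\<close> and repeatedly joining with points of \<open>S\<close> produces compact sets inside the hull; by
  \<open>Caratheodory_hull\<close> the hull is reached after \<open>card I\<close> steps.\<close>

lemma compact_convex_hull_coordinates: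
  fixes S :: "('i \<Rightarrow> real) set"
  assumes I: "finite I" and supp: "\<forall>x\<in>S. \<forall>i. i \<notin> I \<longrightarrow> x i = 0" and S: "compact S"
  shows "compact (convex hull S)"
proof -
  define N :: "('i \<Rightarrow> real) set \<Rightarrow> ('i \<Rightarrow> real) set"
    where "N X = (\<lambda>(t, x, y). (1 - t) *\<^sub>R x + t *\<^sub>R y) ` ({0..1} \<times> X \<times> S)" for X
  define Cs where "Cs k = (N ^^ k) S" for k :: nat
  have Cs_simps: "Cs 0 = S" "Cs (Suc k) = N (Cs k)" for k by (simp_all add: Cs_def)
  have cont: "continuous_on UNIV (\<lambda>(t, x, y). (1 - t) *\<^sub>R x + t *\<^sub>R y :: 'i \<Rightarrow> real)"
  proof (rule continuous_on_coordinatewise_then_product)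
    fix i
    let ?Z = "UNIV :: (real \<times> ('i \<Rightarrow> real) \<times> ('i \<Rightarrow> real)) set"
    have snd: "continuous_on ?Z snd" and fst: "continuous_on ?Z fst"
      by (rule continuous_on_snd[OF continuous_on_id], rule continuous_on_fst[OF continuous_on_id])
    have 1: "continuous_on ?Z (\<lambda>z. fst (snd z) i)"
      by (rule continuous_on_product_then_coordinatewise, rule continuous_on_fst, rule snd)
    have 2: "continuous_on ?Z (\<lambda>z. snd (snd z) i)"
      by (rule continuous_on_product_then_coordinatewise, rule continuous_on_snd, rule snd)
    have "continuous_on ?Z (\<lambda>z. (1 - fst z) * (fst (snd z) i) + fst z * (snd (snd z) i))"
      by (intro continuous_on_add continuous_on_mult continuous_on_diff continuous_on_const fst 1 2)
    then show "continuous_on UNIV (\<lambda>z. (\<lambda>(t, x, y). (1 - t) *\<^sub>R x + t *\<^sub>R y :: 'i \<Rightarrow> real) z i)"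
      by (simp only: case_prod_unfold plus_fun_apply scaleR_fun_apply real_scaleR_def)
  qed
  have compN: "compact (N X)" if "compact X" for X unfolding N_def
    by (rule compact_continuous_image[OF continuous_on_subset[OF cont]]) (auto intro!: compact_Times that S)
  have comp: "compact (Cs k)" for k by (induction k) (simp_all only: Cs_simps S compN)
  have sub: "Cs k \<subseteq> convex hull S" for k
  proof (induction k)
    case (Suc k)
    show ?case
    proof
      fix z assume "z \<in> Cs (Suc k)"
      then obtain t x y where z: "z = (1 - t) *\<^sub>R x + t *\<^sub>R y" "0 \<le> t" "t \<le> 1" "x \<in> Cs k" "y \<in> S"
        unfolding Cs_simps N_def by auto
      then show "z \<in> convex hull S"
        using Suc convexD[OF convex_convex_hull, of x S y "1 - t" t] hull_inc[of y S] by auto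
    qed
  qed (simp only: Cs_simps hull_subset)
  have mono: "Cs k \<subseteq> Cs (Suc k)" for k
  proof
    fix x assume x: "x \<in> Cs k"
    then have "S \<noteq> {}" using sub[of k] by auto
    then obtain y where "y \<in> S" by blast
    then show "x \<in> Cs (Suc k)" unfolding Cs_simps N_def using x by (auto intro!: image_eqI[of _ _ "(0, x, y)"])
  qed
  have Cs_mono: "Cs j \<subseteq> Cs k" if "j \<le> k" for j k
    using that mono by (rule lift_Suc_mono_le[of Cs, rotated])
  define lc where "lc T w = (\<Sum>x\<in>T. w x *\<^sub>R x)" for T :: "('i \<Rightarrow> real) set" and w
  have fin: "lc T w \<in> Cs (card T - 1)"
    if "finite T" "T \<noteq> {}" "T \<subseteq> S" "\<forall>x\<in>T. 0 \<le> w x" "sum w T = 1" for T w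
    using that
  proof (induction T arbitrary: w rule: finite_ne_induct)
    case (singleton x)
    then show ?case by (simp add: Cs_simps lc_def)
  next
    case (insert x F)
    have cF: "card F \<ge> 1" using insert by (simp add: Suc_le_eq card_gt_0_iff)
    have sF: "sum w F = 1 - w x" using insert by simp
    have wx: "0 \<le> w x" "w x \<le> 1" using insert sum_nonneg[of F w] sF by auto
    show ?case
    proof (cases "w x = 1")
      case True
      have "\<forall>y\<in>F. w y = 0" using sF True insert by (simp add: sum_nonneg_eq_0_iff)
      then have "lc (insert x F) w = x" using True insert by (simp add: lc_def)
      moreover have "x \<in> Cs 0" using insert by (simp add: Cs_simps)
      ultimately show ?thesis using Cs_mono[of 0 "card (insert x F) - 1"] by auto
    next
      case False
      define w' where "w' y = w y / (1 - w x)" for y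
      have "sum w' F = 1" using sF False by (simp add: w'_def sum_divide_distrib[symmetric])
      then have 1: "lc F w' \<in> Cs (card F - 1)"
        using insert wx by (intro insert.IH) (auto simp: w'_def)
      have "lc (insert x F) w = (1 - w x) *\<^sub>R lc F w' + w x *\<^sub>R x"
        using insert False by (simp add: lc_def w'_def scaleR_sum_right add.commute)
      then have "lc (insert x F) w \<in> N (Cs (card F - 1))"
        unfolding N_def using 1 wx insert by (intro image_eqI[of _ _ "(w x, lc F w', x)"]) auto
      moreover have "card (insert x F) - 1 = Suc (card F - 1)" using insert cF by simp
      ultimately show ?thesis by (simp only: Cs_simps)
    qed
  qed
  have "convex hull S \<subseteq> Cs (card I)"
  proof
    fix p assume "p \<in> convex hull S"
    then obtain T w where T: "finite T" "T \<subseteq> S" "card T \<le> card I + 1" "\<And>x. x \<in> T \<Longrightarrow> 0 \<le> w x"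
      "sum w T = 1" "(\<Sum>x\<in>T. w x *\<^sub>R x) = p"
      using Caratheodory_hull[OF I supp, of p] by blast
    then have "T \<noteq> {}" by auto
    then have "p \<in> Cs (card T - 1)" using fin[of T w] T by (auto simp: lc_def)
    then show "p \<in> Cs (card I)" using Cs_mono[of "card T - 1" "card I"] T(3) by (meson le_diff_conv subsetD)
  qed
  then have "convex hull S = Cs (card I)" using sub by blast
  then show ?thesis using comp by simp
qed

section \<open>John's decomposition of the identity\<close>

text \<open>A permutation other than the identity moves at least two indices, so its term is of second order
  in \<open>s\<close>; the derivative of the determinant at the identity is the trace.\<close>

lemma dt_perturb_derivative:
  "((\<lambda>s. dt n (\<lambda>a b. (if a = b then 1 else 0) + s * H a b)) has_real_derivative (\<Sum>a<n. H a a)) (at 0)"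
proof -
  let ?f = "\<lambda>p i s. (if i = p i then 1 else 0) + s * H i (p i)"
  let ?d = "\<lambda>p. \<Sum>i<n. H i (p i) * (\<Prod>j\<in>{..<n}-{i}. ?f p j 0)"
  have "((\<lambda>s. \<Prod>i<n. ?f p i s) has_real_derivative ?d p) (at 0)" for p
    by (rule has_field_derivative_prod) (auto intro!: derivative_eq_intros)
  then have "((\<lambda>s. \<Sum>p | p permutes {..<n}. of_int (sign p) * (\<Prod>i<n. ?f p i s)) has_real_derivative
      (\<Sum>p | p permutes {..<n}. of_int (sign p) * ?d p)) (at 0)"
    by (intro DERIV_sum DERIV_cmult)
  moreover have "(\<Sum>p | p permutes {..<n}. of_int (sign p) * ?d p) = (\<Sum>a<n. H a a)"
  proof -
    have z: "?d p = 0" if p: "p permutes {..<n}" "p \<noteq> id" for p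
    proof (rule sum.neutral, rule ballI)
      fix i assume "i \<in> {..<n}"
      have "\<exists>j\<in>{..<n}-{i}. p j \<noteq> j"
      proof (rule ccontr)
        assume "\<not> (\<exists>j\<in>{..<n}-{i}. p j \<noteq> j)"
        then have fx: "p j = j" if "j \<noteq> i" for j using that p(1) by (cases "j < n") (auto simp: permutes_def)
        moreover have "p i = i"
        proof (rule ccontr)
          assume "p i \<noteq> i"
          then have "p (p i) = p i" using fx by blast
          then have "p i = i" using permutes_inj[OF p(1)] by (rule injD[rotated])
          with \<open>p i \<noteq> i\<close> show False ..
        qed
        ultimately have "p = id" by (intro ext) (metis id_apply)
        then show False using p by simp
      qed
      then obtain j where "j \<in> {..<n}-{i}" "p j \<noteq> j" by blast
      then have "(\<Prod>j\<in>{..<n}-{i}. ?f p j 0) = 0" by (intro prod_zero bexI[of _ j]) auto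
      then show "H i (p i) * (\<Prod>j\<in>{..<n}-{i}. ?f p j 0) = 0" by simp
    qed
    have "(\<Sum>p | p permutes {..<n}. of_int (sign p) * ?d p) = (\<Sum>p\<in>{id}. of_int (sign p) * ?d p)"
    proof (rule sum.mono_neutral_right)
      show "\<forall>p\<in>{p. p permutes {..<n}} - {id}. of_int (sign p) * ?d p = 0"
      proof
        fix p assume "p \<in> {p. p permutes {..<n}} - {id}"
        then have "?d p = 0" by (intro z) auto
        then show "of_int (sign p) * ?d p = 0" by (simp only: mult_zero_right)
      qed
    qed (auto simp: finite_permutations permutes_id)
    then show ?thesis by (simp add: sign_id)
  qed
  ultimately show ?thesis unfolding dt_Leibniz by simp
qed

definition ball1 :: "nat \<Rightarrow> (nat \<Rightarrow> real) set"
  where "ball1 n = {x \<in> Rn n. ip n x x \<le> 1}"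

text \<open>The claim is that \<open>1/n\<close> times the identity matrix, called \<open>p\<close>, lies in the convex hull of the matrices
  \<open>u \<otimes> u\<close>, where \<open>u\<close> runs over the unit vectors whose supporting half-space \<open>\<langle>x, u\<rangle> \<le> 1\<close> contains
  \<open>K\<close>.  Otherwise a matrix \<open>H\<close> separates them: it has positive trace and \<open>\<langle>u, H u\<rangle> \<le> -\<delta>/2\<close> for those
  \<open>u\<close>.  Then \<open>1 + s H\<close> has determinant greater than \<open>1\<close> for small \<open>s > 0\<close> and still maps the ball into
  \<open>K\<close>, against maximality.  For the inclusion, let the unit vector \<open>v\<close> separate an image point from \<open>K\<close>.  If
  \<open>\<langle>v, H v\<rangle>\<close> is negative enough, then \<open>\<langle>y, v\<rangle> \<le> 1\<close> on the image of the ball, while \<open>v\<close> itself is in \<open>K\<close>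
  and \<open>\<langle>v, v\<rangle> = 1\<close>.  The remaining \<open>v\<close> form a compact set \<open>V\<close> on which no half-space \<open>\<langle>x, v\<rangle> \<le> 1\<close> contains
  \<open>K\<close>; there \<open>\<langle>x, v\<rangle>\<close> reaches \<open>1 + \<eta>\<close> on \<open>K\<close> with a fixed \<open>\<eta>\<close>, but stays smaller on the image of the
  ball if \<open>s\<close> is small.\<close>

theorem John_decomposition:
  assumes n: "0 < n" and K: "compact K" "convex K" "K \<subseteq> Rn n" and B: "ball1 n \<subseteq> K"
    and max: "\<And>A. dt n A \<noteq> 0 \<Longrightarrow> lin n A ` ball1 n \<subseteq> K \<Longrightarrow> \<bar>dt n A\<bar> \<le> 1"
  obtains J :: "(nat \<times> nat \<Rightarrow> real) set" and c u where "tight_frame n J c u"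
    "\<And>j x. j \<in> J \<Longrightarrow> x \<in> K \<Longrightarrow> ip n x (u j) \<le> 1"
proof -
  define Sp where "Sp = Rn n \<inter> {u. ip n u u = 1}"
  have coord: "\<bar>x i\<bar> \<le> (if i < n then 1 else 0)" if "x \<in> Sp" for x i
  proof (cases "i < n")
    case True
    then have "(x i)\<^sup>2 \<le> 1" using abs_coord_le[of i n x] that by (auto simp: Sp_def)
    then show ?thesis using True by (simp add: abs_square_le_1)
  qed (use that in \<open>auto simp: Sp_def mem_Rn\<close>)
  have "closed Sp" unfolding Sp_def
    by (intro closed_Int closed_Rn closed_Collect_eq continuous_ip continuous_on_const continuous_on_id)
  then have Sp_compact: "compact Sp" using coord by (rule compact_box_subset)
  define U where "U = Sp \<inter> (\<Inter>x\<in>K. {u. ip n x u \<le> 1})"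
  have "closed (\<Inter>x\<in>K. {u. ip n x u \<le> 1})"
    by (intro closed_INT ballI closed_Collect_le continuous_ip continuous_on_const continuous_on_id)
  then have U_compact: "compact U" unfolding U_def by (rule compact_Int_closed[OF Sp_compact])
  define I where "I = {..<n} \<times> {..<n}"
  have I: "finite I" by (simp add: I_def)
  define tens where "tens u = (\<lambda>(a, b). if a < n \<and> b < n then u a * u b else (0::real))" for u :: "nat \<Rightarrow> real"
  define p where "p = (\<lambda>(a, b). if a < n \<and> a = b then 1 / real n else (0::real))"
  have tens_cont: "continuous_on X tens" for X
  proof (rule continuous_on_coordinatewise_then_product)
    fix z :: "nat \<times> nat"
    have "continuous_on X (\<lambda>u::nat \<Rightarrow> real. u (fst z) * u (snd z))"
      by (intro continuous_on_mult continuous_coord)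
    then show "continuous_on X (\<lambda>u. tens u z)"
      by (cases "fst z < n \<and> snd z < n") (auto simp: tens_def case_prod_unfold)
  qed
  have S_compact: "compact (tens ` U)" by (rule compact_continuous_image[OF tens_cont U_compact])
  have S_supp: "\<forall>x\<in>tens ` U. \<forall>i. i \<notin> I \<longrightarrow> x i = 0" by (auto simp: tens_def I_def)
  have hull_supp: "x i = 0" if x: "x \<in> convex hull (tens ` U)" and i: "i \<notin> I" for x i
  proof -
    obtain T w where "T \<subseteq> tens ` U" "(\<Sum>v\<in>T. w v *\<^sub>R v) = x"
      using x unfolding convex_hull_explicit by blast
    then have "x i = (\<Sum>v\<in>T. w v * v i)" by (auto simp: sum_fun_apply)
    moreover have "v i = 0" if "v \<in> T" for v using S_supp \<open>T \<subseteq> tens ` U\<close> i that by blast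
    then have "(\<Sum>v\<in>T. w v * v i) = 0" by (intro sum.neutral ballI) simp
    ultimately have "x i = 0" by simp
    then show ?thesis .
  qed
  have "p \<in> convex hull (tens ` U)"
  proof (rule ccontr)
    assume "p \<notin> convex hull (tens ` U)"
    then obtain h \<delta> where \<delta>: "0 < \<delta>"
      and h: "\<And>x. x \<in> convex hull (tens ` U) \<Longrightarrow> (\<Sum>i\<in>I. h i * x i) \<le> (\<Sum>i\<in>I. h i * p i) - \<delta>"
    proof (rule separate_point_compact_convex[OF I compact_convex_hull_coordinates[OF I S_supp S_compact]
          convex_convex_hull])
      show "x i = 0" if "x \<in> insert p (convex hull (tens ` U))" "i \<notin> I" for x i
        proof (cases "x = p")
          case True
          have "i \<noteq> (a, b)" if "a < n" "a = b" for a b using \<open>i \<notin> I\<close> that by (auto simp: I_def)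
          then show ?thesis by (cases i) (auto simp: True p_def)
        next
          case False
          then show ?thesis using that hull_supp[of x i] by blast
        qed
    qed blast+
    define \<tau> where "\<tau> = (\<Sum>i\<in>I. h i * p i)"
    \<comment> \<open>Subtracting a multiple of the identity moves the separating value to zero, since \<open>\<bar>u\<bar> = 1\<close>.\<close>
    define H where "H a b = h (a, b) - (if a = b then \<tau> - \<delta> / 2 else 0)" for a b
    have tr: "(\<Sum>a<n. H a a) > 0"
    proof -
      have "\<tau> = (\<Sum>a<n. \<Sum>b<n. h (a, b) * (if a = b then 1 / real n else 0))"
        unfolding \<tau>_def I_def sum.cartesian_product p_def by (intro sum.cong) auto
      also have "\<dots> = (\<Sum>a<n. h (a, a)) / real n"
        by (simp add: if_distrib[of "\<lambda>x. _ * x"] sum_divide_distrib cong: if_cong)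
      finally have "(\<Sum>a<n. h (a, a)) = real n * \<tau>" using n by (simp add: field_simps)
      then have "(\<Sum>a<n. H a a) = real n * (\<delta> / 2)"
        unfolding H_def sum_subtractf by (simp add: algebra_simps)
      then show ?thesis using n \<delta> by (simp only: mult_pos_pos of_nat_0_less_iff half_gt_zero_iff)
    qed
    have ipH: "ip n u (lin n H u) = (\<Sum>i\<in>I. h i * tens u i) - (\<tau> - \<delta> / 2)" if "u \<in> Sp" for u
    proof -
      have "ip n u (lin n H u) = (\<Sum>a<n. \<Sum>b<n. H a b * (u a * u b))"
        by (simp add: ip_def lin_def sum_distrib_left mult_ac)
      also have "\<dots> = (\<Sum>a<n. \<Sum>b<n. h (a, b) * (u a * u b)) - (\<Sum>a<n. \<Sum>b<n. (if a = b then (\<tau> - \<delta> / 2) * (u a * u b) else 0))"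
        unfolding H_def sum_subtractf[symmetric] by (intro sum.cong refl) (auto simp: algebra_simps)
      also have "(\<Sum>a<n. \<Sum>b<n. (if a = b then (\<tau> - \<delta> / 2) * (u a * u b) else 0)) = (\<tau> - \<delta> / 2) * ip n u u"
        by (simp add: ip_def sum_distrib_left)
      also have "(\<Sum>a<n. \<Sum>b<n. h (a, b) * (u a * u b)) = (\<Sum>i\<in>I. h i * tens u i)"
        unfolding I_def sum.cartesian_product tens_def by (intro sum.cong) auto
      finally show ?thesis using that by (simp add: Sp_def)
    qed
    have HU: "ip n u (lin n H u) \<le> - \<delta> / 2" if "u \<in> U" for u
    proof -
      have "(\<Sum>i\<in>I. h i * tens u i) \<le> \<tau> - \<delta>"
        unfolding \<tau>_def using that by (intro h hull_inc) auto
      then show ?thesis using ipH[of u] that by (simp add: U_def)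
    qed
    define HT where "HT = (\<lambda>a b. H b a)"
    have ipHT: "ip n v (lin n HT v) = ip n v (lin n H v)" for v
      using ip_lin_left[of n H v v] by (simp add: HT_def ip_commute)
    define V where "V = Sp \<inter> {v. - \<delta> / 4 \<le> ip n v (lin n H v)}"
    have V_compact: "compact V" unfolding V_def
      by (rule compact_Int_closed[OF Sp_compact])
        (intro closed_Collect_le continuous_ip continuous_lin continuous_on_const continuous_on_id)
    have "\<exists>\<eta>>0. \<forall>v\<in>V. \<exists>y\<in>K. 1 + \<eta> \<le> ip n y v"
    proof -
      define O' where "O' = (\<lambda>y. {v. 1 < ip n y v})"
      let ?C = "(\<lambda>(y, m). {v. 1 + inverse (real (Suc m)) < ip n y v}) ` (K \<times> UNIV)"
      have "V \<subseteq> \<Union>?C"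
      proof
        fix v assume v: "v \<in> V"
        then have "v \<notin> U" using HU[of v] \<delta> by (auto simp: V_def)
        then obtain y where y: "y \<in> K" "1 < ip n y v" using v by (auto simp: U_def V_def not_le)
        then obtain m where "inverse (real (Suc m)) < ip n y v - 1" using reals_Archimedean[of "ip n y v - 1"] by auto
        then have "v \<in> {v. 1 + inverse (real (Suc m)) < ip n y v}" by simp
        then show "v \<in> \<Union>?C" using y by blast
      qed
      moreover have "open c" if "c \<in> ?C" for c
        using that by (auto intro!: open_Collect_less continuous_ip continuous_on_const continuous_on_id)
      ultimately obtain F where F: "F \<subseteq> ?C" "finite F" "V \<subseteq> \<Union>F"
        using compactE[OF V_compact, of ?C] by metis
      obtain G where G: "G \<subseteq> K \<times> (UNIV :: nat set)" "finite G"
        "F = (\<lambda>(y, m). {v. 1 + inverse (real (Suc m)) < ip n y v}) ` G"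
        using finite_subset_image[OF F(2) F(1)] by blast
      define m0 where "m0 = Max (insert 0 (snd ` G))"
      show ?thesis
      proof (intro exI[of _ "inverse (real (Suc m0))"] conjI ballI)
        fix v assume "v \<in> V"
        then obtain y m where ym: "(y, m) \<in> G" "1 + inverse (real (Suc m)) < ip n y v" using F(3) G(3) by auto
        have "m \<le> m0" unfolding m0_def using ym(1) G(2) by (intro Max_ge) force+
        then have "inverse (real (Suc m0)) \<le> inverse (real (Suc m))" by (intro le_imp_inverse_le) auto
        then have "1 + inverse (real (Suc m0)) \<le> ip n y v" using ym(2) by linarith
        moreover have "y \<in> K" using ym(1) G(1) by auto
        ultimately show "\<exists>y\<in>K. 1 + inverse (real (Suc m0)) \<le> ip n y v" by blast
      qed simp
    qed
    then obtain \<eta> where \<eta>: "0 < \<eta>" "\<And>v. v \<in> V \<Longrightarrow> \<exists>y\<in>K. 1 + \<eta> \<le> ip n y v" by blast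
    obtain v1 where v1: "v1 \<in> Sp" using orthogonal_vector_exists[of 0 n] n by (auto simp: Sp_def)
    have "continuous_on Sp (\<lambda>v. ip n (lin n HT v) (lin n HT v))"
      by (intro continuous_ip continuous_lin continuous_on_id)
    then obtain v2 where "v2 \<in> Sp" "\<And>v. v \<in> Sp \<Longrightarrow> ip n (lin n HT v) (lin n HT v) \<le> ip n (lin n HT v2) (lin n HT v2)"
      using continuous_attains_sup[OF Sp_compact] v1 by blast
    then obtain M where M: "0 \<le> M" "\<And>v. v \<in> Sp \<Longrightarrow> ip n (lin n HT v) (lin n HT v) \<le> M" using ip_self_nonneg by metis
    let ?A = "\<lambda>s a b. (if a = b then 1 else 0) + s * H a b"
    obtain d where d: "0 < d" "\<And>s. 0 < s \<Longrightarrow> s < d \<Longrightarrow> 1 < dt n (?A s)"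
    proof -
      have "dt n (?A 0) = 1" using dt_id by simp
      then show ?thesis using DERIV_pos_inc_right[OF dt_perturb_derivative[of n H] tr] that by auto
    qed
    \<comment> \<open>The first entry keeps the determinant above \<open>1\<close>; the others make the image of the ball stay in \<open>K\<close> in the
      directions inside and outside \<open>V\<close>, where \<open>M\<close> bounds \<open>\<bar>H\<^sup>T v\<bar>\<^sup>2\<close> on the sphere.\<close>
    define s where "s = Min {d / 2, 1, \<eta> / (3 * M + 2), \<delta> / (2 * (M + 1))}"
    have s: "0 < s" "s < d" "s \<le> 1" "s * (3 * M + 2) \<le> \<eta>" "s * (M + 1) \<le> \<delta> / 2"
    proof -
      have pos: "0 < 3 * M + 2" "0 < M + 1" using M(1) by auto
      have le: "s \<le> d / 2" "s \<le> 1" "s \<le> \<eta> / (3 * M + 2)" "s \<le> \<delta> / (2 * (M + 1))"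
        unfolding s_def by (rule Min_le, simp, simp)+
      show "0 < s" unfolding s_def using d(1) \<eta>(1) \<delta> pos by (simp add: field_simps)
      show "s < d" using le d(1) by simp
      show "s \<le> 1" by fact
      show "s * (3 * M + 2) \<le> \<eta>" using le(3) pos by (simp add: pos_le_divide_eq)
      have "s * (2 * (M + 1)) \<le> \<delta>" using le(4) pos by (simp add: pos_le_divide_eq)
      then show "s * (M + 1) \<le> \<delta> / 2" by (simp add: algebra_simps)
    qed
    have "lin n (?A s) ` ball1 n \<subseteq> K"
    proof (rule image_subsetI, rule ccontr)
      fix x assume x: "x \<in> ball1 n" and nK: "lin n (?A s) x \<notin> K"
      have K0: "K \<noteq> {}" using B x by auto
      obtain v \<epsilon> where v: "v \<in> Rn n" "0 < \<epsilon>" "ip n v v = 1" "\<And>y. y \<in> K \<Longrightarrow> ip n y v \<le> ip n (lin n (?A s) x) v - \<epsilon>"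
        using separate_Rn[OF K lin_Rn nK K0] by blast
      define w where "w = v + s *\<^sub>R lin n HT v"
      have linA: "lin n (\<lambda>a b. ?A s b a) v = w"
      proof
        fix i
        show "lin n (\<lambda>a b. ?A s b a) v i = w i"
        proof (cases "i < n")
          case True
          have "(\<Sum>j<n. ((if j = i then 1 else 0) + s * H j i) * v j) = (\<Sum>j<n. if j = i then v j else 0) + s * (\<Sum>j<n. H j i * v j)"
            unfolding sum_distrib_left sum.distrib[symmetric] by (intro sum.cong) (auto simp: algebra_simps)
          then show ?thesis using True by (simp add: w_def lin_def ip_def HT_def)
        next
          case False
          then show ?thesis using v(1) by (simp add: w_def lin_def mem_Rn)
        qed
      qed
      have vSp: "v \<in> Sp" using v by (simp add: Sp_def)
      have less: "ip n y v < ip n x w" if "y \<in> K" for y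
        using v(4)[OF that] v(2) ip_lin_left[of n "?A s" x v] linA by simp
      have "(ip n x w)\<^sup>2 \<le> ip n x x * ip n w w" by (rule ip_Cauchy_Schwarz)
      also have "\<dots> \<le> 1 * ip n w w" using x by (intro mult_right_mono) (auto simp: ball1_def)
      finally have CS: "(ip n x w)\<^sup>2 \<le> ip n w w" by simp
      have ww: "ip n w w = 1 + 2 * s * ip n v (lin n H v) + s\<^sup>2 * ip n (lin n HT v) (lin n HT v)"
        unfolding w_def using v(3) ipHT[of v]
        by (simp add: ip_simps ip_commute[of n "lin n HT v" v] power2_eq_square algebra_simps)
      have s2: "s\<^sup>2 * ip n (lin n HT v) (lin n HT v) \<le> s * (s * M)"
        unfolding power2_eq_square mult.assoc using s(1) M(2)[OF vSp] by (intro mult_left_mono) auto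
      show False
      proof (cases "v \<in> V")
        case True
        then obtain y where y: "y \<in> K" "1 + \<eta> \<le> ip n y v" using \<eta> by blast
        then have "1 + \<eta> < ip n x w" using less[of y] by simp
        then have "(1 + \<eta>)\<^sup>2 \<le> (ip n x w)\<^sup>2" using \<eta>(1) by (intro power_mono) auto
        then have 1: "(1 + \<eta>)\<^sup>2 \<le> ip n w w" using CS by simp
        have "(ip n v (lin n HT v))\<^sup>2 \<le> ip n v v * ip n (lin n HT v) (lin n HT v)" by (rule ip_Cauchy_Schwarz)
        also have "\<dots> \<le> (M + 1)\<^sup>2" using v(3) M(2)[OF vSp] M(1) by (simp add: power2_eq_square algebra_simps) (smt (verit) mult_nonneg_nonneg)
        finally have "ip n v (lin n H v) \<le> M + 1" unfolding ipHT using M(1) by (simp add: power2_le_iff_abs_le)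
        then have "s * ip n v (lin n H v) \<le> s * (M + 1)" using s(1) by (intro mult_left_mono) auto
        moreover have "s * (s * M) \<le> s * M" using s(1,3) M(1) by (intro mult_left_mono mult_left_le_one_le) auto
        ultimately have "ip n w w \<le> 1 + s * (3 * M + 2)" using ww s2 by (simp add: algebra_simps)
        then have "ip n w w \<le> 1 + \<eta>" using s(4) by simp
        then have "(1 + \<eta>)\<^sup>2 \<le> 1 + \<eta>" using 1 by simp
        then show False using \<eta>(1) by (simp add: power2_eq_square algebra_simps) (smt (verit) mult_pos_pos)
      next
        case False
        then have "ip n v (lin n H v) \<le> - \<delta> / 4" using vSp by (simp add: V_def)
        then have "s * ip n v (lin n H v) \<le> s * (- \<delta> / 4)" using s(1) by (intro mult_left_mono) auto
        moreover have "s * (s * M) \<le> s * (\<delta> / 2)" using s(1,5) by (intro mult_left_mono) (auto simp: algebra_simps)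
        ultimately have "ip n w w \<le> 1" using ww s2 by (simp add: algebra_simps)
        moreover have "v \<in> K" using B v by (auto simp: ball1_def)
        then have "1 < ip n x w" using less[of v] v(3) by simp
        then have "1 < (ip n x w)\<^sup>2" by simp
        ultimately show False using CS by simp
      qed
    qed
    then have "\<bar>dt n (?A s)\<bar> \<le> 1" using d(2)[OF s(1,2)] by (intro max) auto
    then show False using d(2)[OF s(1,2)] by simp
  qed
  then obtain T w where T: "finite T" "T \<subseteq> tens ` U" "\<forall>x\<in>T. 0 \<le> w x" "sum w T = 1" "(\<Sum>v\<in>T. w v *\<^sub>R v) = p"
    unfolding convex_hull_explicit by blast
  define u where "u x = (SOME u. u \<in> U \<and> x = tens u)" for x
  have u: "u x \<in> U \<and> x = tens (u x)" if "x \<in> T" for x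
  proof -
    have "\<exists>v. v \<in> U \<and> x = tens v" using T(2) that by blast
    then show ?thesis unfolding u_def by (rule someI_ex)
  qed
  show ?thesis
  proof (rule that[of T "\<lambda>x. real n * w x" u])
    show "tight_frame n T (\<lambda>x. real n * w x) u" unfolding tight_frame_def
    proof (intro conjI allI impI ballI)
      fix a b assume ab: "a < n" "b < n"
      have "(\<Sum>x\<in>T. real n * w x * u x a * u x b) = real n * (\<Sum>x\<in>T. w x * tens (u x) (a, b))"
        unfolding sum_distrib_left using ab by (intro sum.cong) (auto simp: tens_def)
      also have "(\<Sum>x\<in>T. w x * tens (u x) (a, b)) = (\<Sum>x\<in>T. w x * x (a, b))"
      proof (rule sum.cong[OF refl])
        fix x assume "x \<in> T"
        then have "tens (u x) = x" using u[of x] by (simp only:)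
        then show "w x * tens (u x) (a, b) = w x * x (a, b)" by (simp only:)
      qed
      also have "\<dots> = (\<Sum>x\<in>T. w x *\<^sub>R x) (a, b)" by (simp add: sum_fun_apply)
      also have "real n * \<dots> = (if a = b then 1 else 0)" unfolding T(5) using ab n by (simp add: p_def)
      finally show "(\<Sum>x\<in>T. real n * w x * u x a * u x b) = (if a = b then 1 else 0)" .
    qed (use T u in \<open>auto simp: U_def Sp_def\<close>)
    fix j x assume "j \<in> T" "x \<in> K"
    then show "ip n x (u j) \<le> 1" using u[of j] by (auto simp: U_def)
  qed
qed

section \<open>Transport of the uniform density on an interval to the normal density\<close>

abbreviation nd :: "real \<Rightarrow> real" where "nd \<equiv> std_normal_density"

lemma nd_pos: "0 < nd s"
  by (rule normal_density_pos) simp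

lemma nd_eq: "nd s = exp (- s\<^sup>2 / 2) / sqrt (2 * pi)"
  by (simp add: std_normal_density_def)

lemma nd_continuous: "continuous_on S nd"
  unfolding nd_eq[abs_def] by (intro continuous_intros) auto

text \<open>The inverse of the transport: the normal distribution function, rescaled to the range \<open>(-1, 1)\<close>.\<close>

definition G :: "real \<Rightarrow> real" where "G s = 2 * cdf std_normal_distribution s - 1"

lemma cdf_diff_nd:
  assumes "a \<le> b"
  shows "cdf std_normal_distribution b - cdf std_normal_distribution a = integral {a..b} nd"
proof (cases "a = b")
  case False
  then have ab: "a < b" using assms by simp
  interpret real_distribution std_normal_distribution by (rule real_dist_normal_dist)
  have int: "set_integrable lborel {a..b} nd"
    by (rule borel_integrable_atLeastAtMost') (rule nd_continuous)
  have "emeasure std_normal_distribution {a<..b} = (\<integral>\<^sup>+x. ennreal (nd x) * indicator {a<..b} x \<partial>lborel)"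
    by (rule emeasure_density) auto
  also have "\<dots> = (\<integral>\<^sup>+x. ennreal (indicator {a..b} x *\<^sub>R nd x) \<partial>lborel)"
  proof (rule nn_integral_cong_AE)
    show "AE x in lborel. ennreal (nd x) * indicator {a<..b} x = ennreal (indicator {a..b} x *\<^sub>R nd x)"
      using AE_lborel_singleton[of a] by eventually_elim (auto simp: indicator_def)
  qed
  finally have "emeasure std_normal_distribution {a<..b} = (\<integral>\<^sup>+x. ennreal (indicator {a..b} x *\<^sub>R nd x) \<partial>lborel)" .
  then have "measure std_normal_distribution {a<..b} = enn2real (\<integral>\<^sup>+x. ennreal (indicator {a..b} x *\<^sub>R nd x) \<partial>lborel)"
    by (simp add: measure_def)
  also have "\<dots> = (LINT x : {a..b} | lborel. nd x)"
    unfolding set_lebesgue_integral_def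
    by (rule integral_eq_nn_integral[symmetric]) (auto simp: less_imp_le[OF nd_pos])
  also have "\<dots> = integral {a..b} nd" by (rule set_borel_integral_eq_integral(2)[OF int])
  finally show ?thesis
    using cdf_diff_eq[OF ab] by simp
qed simp

lemma G_deriv: "(G has_real_derivative 2 * nd s) (at s)"
proof -
  let ?F = "cdf std_normal_distribution"
  have "((\<lambda>x. integral {s-1..x} nd) has_real_derivative nd s) (at s within {s-1..s+1})"
    by (rule integral_has_real_derivative) (auto intro: nd_continuous)
  then have "((\<lambda>x. integral {s-1..x} nd) has_real_derivative nd s) (at s)"
    by (simp add: at_within_Icc_at)
  then have "((\<lambda>x. 2 * (?F (s - 1) + integral {s-1..x} nd) - 1) has_real_derivative 2 * nd s) (at s)"
    by (auto intro!: derivative_eq_intros)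
  then show ?thesis
  proof (rule has_field_derivative_transform_within[where d = 1])
    fix x assume "dist x s < 1"
    then have "s - 1 \<le> x" by (auto simp: dist_real_def)
    then show "2 * (?F (s - 1) + integral {s-1..x} nd) - 1 = G x"
      using cdf_diff_nd[of "s - 1" x] by (simp add: G_def)
  qed auto
qed

lemma G_less: "a < b \<Longrightarrow> G a < G b"
  by (rule DERIV_pos_imp_increasing) (use G_deriv nd_pos in \<open>auto intro!: exI mult_pos_pos\<close>)

lemma G_inj: "G a = G b \<Longrightarrow> a = b"
  using G_less[of a b] G_less[of b a] by (cases a b rule: linorder_cases) auto

lemma G_bounds: "-1 < G s" "G s < 1"
proof -
  interpret real_distribution std_normal_distribution by (rule real_dist_normal_dist)
  have "G (s + 1) \<le> 1" using cdf_bounded_prob[of "s + 1"] by (simp add: G_def)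
  then show "G s < 1" using G_less[of s "s + 1"] by simp
  have "-1 \<le> G (s - 1)" using cdf_nonneg[of "s - 1"] by (simp add: G_def)
  then show "-1 < G s" using G_less[of "s - 1" s] by simp
qed

lemma G_at_top: "(G \<longlongrightarrow> 1) at_top"
proof -
  interpret real_distribution std_normal_distribution by (rule real_dist_normal_dist)
  have "((\<lambda>s. 2 * cdf std_normal_distribution s - 1) \<longlongrightarrow> 2 * 1 - 1) at_top"
    by (intro tendsto_intros cdf_lim_at_top_prob)
  then show ?thesis by (simp add: G_def[abs_def])
qed

lemma G_at_bot: "(G \<longlongrightarrow> -1) at_bot"
proof -
  interpret real_distribution std_normal_distribution by (rule real_dist_normal_dist)
  have "((\<lambda>s. 2 * cdf std_normal_distribution s - 1) \<longlongrightarrow> 2 * 0 - 1) at_bot"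
    by (intro tendsto_intros cdf_lim_at_bot)
  then show ?thesis by (simp add: G_def[abs_def])
qed

lemma G_odd: "G (- s) = - G s"
proof -
  have nd_even: "nd (- s) = nd s" for s by (simp add: nd_eq)
  have "((\<lambda>s. G s + G (- s)) has_real_derivative 0) (at s)" for s
  proof -
    have "((\<lambda>s. G (- s)) has_real_derivative (2 * nd (- s)) * (-1)) (at s)"
      by (rule DERIV_chain2[where g = uminus]) (auto intro: G_deriv intro!: derivative_eq_intros)
    from DERIV_add[OF G_deriv[of s] this] show ?thesis by (simp add: nd_even)
  qed
  then have const: "G s + G (- s) = G 0 + G (- 0)" for s
    by (rule DERIV_isconst_all[of "\<lambda>s. G s + G (- s)" s 0, rule_format])
  have "((\<lambda>s. G s + G (- s)) \<longlongrightarrow> 1 + - 1) at_top"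
    by (intro tendsto_add G_at_top filterlim_compose[OF G_at_bot] filterlim_uminus_at_bot_at_top)
  moreover have "(\<lambda>s. G s + G (- s)) = (\<lambda>_. G 0 + G (- 0))" by (rule ext) (rule const)
  ultimately have "((\<lambda>_::real. G 0 + G (- 0)) \<longlongrightarrow> 1 + - 1) at_top" by (simp only:)
  then have "((\<lambda>_::real. G 0 + G (- 0)) \<longlongrightarrow> 0) at_top" by (simp only: add.right_inverse)
  then have "G 0 + G (- 0) = 0" by (intro tendsto_unique[OF _ tendsto_const]) (rule trivial_limit_at_top_linorder)
  then show ?thesis using const[of s] by simp
qed

lemma G_surj:
  assumes "\<bar>t\<bar> < 1"
  shows "\<exists>s. G s = t"
proof -
  have "eventually (\<lambda>s. t < G s) at_top" using G_at_top by (rule order_tendstoD) (use assms in auto)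
  then obtain b where b: "t < G b" by (auto simp: eventually_at_top_linorder)
  have "eventually (\<lambda>s. G s < t) at_bot" using G_at_bot by (rule order_tendstoD) (use assms in auto)
  then obtain a where a: "G a < t" by (auto simp: eventually_at_bot_linorder)
  have "a \<le> b" using a b G_less[of b a] by (cases "a \<le> b") auto
  then have "\<exists>x\<ge>a. x \<le> b \<and> G x = t"
    using a b by (intro IVT') (auto intro!: continuous_at_imp_continuous_on DERIV_isCont[OF G_deriv])
  then show ?thesis by auto
qed

text \<open>The monotone map that sends the uniform distribution on \<open>(-1, 1)\<close> to the standard normal
  distribution.\<close>

definition T :: "real \<Rightarrow> real" where "T t = (SOME s. G s = t)"

lemma G_T: "\<bar>t\<bar> < 1 \<Longrightarrow> G (T t) = t"
  unfolding T_def by (rule someI_ex) (rule G_surj)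

lemma T_G: "T (G s) = s"
proof -
  have "G (T (G s)) = G s" unfolding T_def by (rule someI_ex) auto
  then show ?thesis by (rule G_inj)
qed

lemma T_odd: "\<bar>t\<bar> < 1 \<Longrightarrow> T (- t) = - T t"
  using T_G[of "- T t"] by (simp add: G_odd G_T)

lemma T_0 [simp]: "T 0 = 0"
  using T_G[of 0] G_odd[of 0] by simp

lemma T_mono: "\<bar>t\<bar> < 1 \<Longrightarrow> \<bar>t'\<bar> < 1 \<Longrightarrow> t \<le> t' \<Longrightarrow> T t \<le> T t'"
proof (rule ccontr)
  assume t: "\<bar>t\<bar> < 1" "\<bar>t'\<bar> < 1" "t \<le> t'" and "\<not> T t \<le> T t'"
  then have "G (T t') < G (T t)" by (intro G_less) simp
  then show False using t by (simp only: G_T)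
qed

text \<open>The derivative of \<open>T\<close>.\<close>

definition T1 :: "real \<Rightarrow> real" where "T1 t = inverse (2 * nd (T t))"

lemma T1_eq: "T1 t = sqrt (2 * pi) / 2 * exp ((T t)\<^sup>2 / 2)"
  by (simp add: T1_def nd_eq exp_minus field_simps)

lemma T_deriv: "\<bar>t\<bar> < 1 \<Longrightarrow> (T has_real_derivative T1 t) (at t)"
proof -
  assume t: "\<bar>t\<bar> < 1"
  have "isCont T (G (T t))"
    by (rule isCont_inverse_function[where d = 1]) (auto simp: T_G intro: DERIV_isCont[OF G_deriv])
  then show ?thesis unfolding T1_def using t nd_pos[of "T t"]
    by (intro DERIV_inverse_function[where f = G and a = "-1" and b = 1]) (auto simp: G_T G_deriv)
qed

lemma T1_ge_1: "1 \<le> T1 t"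
proof -
  have "2 \<le> sqrt (2 * pi)" using pi_gt3 by (intro real_le_rsqrt) auto
  then have "1 * 1 \<le> sqrt (2 * pi) / 2 * exp ((T t)\<^sup>2 / 2)" by (intro mult_mono) auto
  then show ?thesis by (simp add: T1_eq)
qed

lemma T1_even: "\<bar>t\<bar> < 1 \<Longrightarrow> T1 (- t) = T1 t"
  by (simp add: T1_eq T_odd)

text \<open>By the explicit formula \<open>T1_eq\<close>, the function \<open>T1\<close> satisfies \<open>T1' = T \<cdot> T1\<^sup>2\<close>.\<close>

lemma T1_deriv:
  assumes "\<bar>t\<bar> < 1"
  shows "(T1 has_real_derivative T t * (T1 t)\<^sup>2) (at t)"
proof -
  have "((\<lambda>t. sqrt (2 * pi) / 2 * exp ((T t)\<^sup>2 / 2)) has_real_derivative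
      sqrt (2 * pi) / 2 * (exp ((T t)\<^sup>2 / 2) * (T t * T1 t))) (at t)"
    using T_deriv[OF assms] by (auto intro!: derivative_eq_intros)
  also have "sqrt (2 * pi) / 2 * (exp ((T t)\<^sup>2 / 2) * (T t * T1 t)) = T t * (T1 t)\<^sup>2"
    using T1_eq[of t] by (simp add: power2_eq_square)
  finally show ?thesis unfolding T1_eq[abs_def] .
qed

lemma T_ge: "0 \<le> t \<Longrightarrow> t < 1 \<Longrightarrow> t \<le> T t"
proof -
  assume t: "0 \<le> t" "t < 1"
  have "(\<lambda>x. T x - x) 0 \<le> (\<lambda>x. T x - x) t"
  proof (rule DERIV_nonneg_imp_nondecreasing[OF t(1)])
    fix x assume "0 \<le> x" "x \<le> t"
    then show "\<exists>y. ((\<lambda>x. T x - x) has_real_derivative y) (at x) \<and> 0 \<le> y"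
      using t T_deriv[of x] T1_ge_1[of x]
      by (intro exI[of _ "T1 x - 1"]) (auto intro!: derivative_eq_intros)
  qed
  then show ?thesis by simp
qed

lemma T_abs_le: "\<bar>t\<bar> \<le> r \<Longrightarrow> r < 1 \<Longrightarrow> \<bar>T t\<bar> \<le> T r"
proof -
  assume t: "\<bar>t\<bar> \<le> r" "r < 1"
  then have b: "\<bar>t\<bar> < 1" "\<bar>r\<bar> < 1" "\<bar>- r\<bar> < 1" "t \<le> r" "- r \<le> t" by linarith+
  show ?thesis
    using T_mono[OF b(1,2,4)] T_mono[OF b(3,1,5)] T_odd[OF b(2)] by linarith
qed

lemma T1_le: "\<bar>t\<bar> \<le> r \<Longrightarrow> r < 1 \<Longrightarrow> T1 t \<le> T1 r"
proof -
  assume "\<bar>t\<bar> \<le> r" "r < 1"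
  then have "\<bar>T t\<bar>\<^sup>2 \<le> (T r)\<^sup>2" by (intro power_mono T_abs_le) auto
  then show ?thesis unfolding T1_eq by (intro mult_left_mono) auto
qed

text \<open>For \<open>x \<ge> 0\<close> the derivative of \<open>T1\<close> is \<open>T \<cdot> T1\<^sup>2 \<ge> x\<close>, the derivative of \<open>x\<^sup>2 / 2\<close>; and both functions
  are even.  This turns differences of squared inner products into differences of the weights
  to which the determinant inequality is applied.\<close>

lemma T1_diff_ge:
  assumes "\<bar>a\<bar> < 1" "\<bar>b\<bar> < 1"
  shows "(a\<^sup>2 - b\<^sup>2)\<^sup>2 \<le> 4 * (T1 a - T1 b)\<^sup>2"
proof -
  have T1_abs: "T1 x = T1 \<bar>x\<bar>" if "\<bar>x\<bar> < 1" for x using T1_even[of x] that by (auto simp: abs_if)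
  have main: "0 \<le> b\<^sup>2 - a\<^sup>2 \<and> b\<^sup>2 - a\<^sup>2 \<le> 2 * (T1 b - T1 a)" if ab: "0 \<le> a" "a \<le> b" "b < 1" for a b
  proof -
    have "(\<lambda>x. 2 * T1 x - x\<^sup>2) a \<le> (\<lambda>x. 2 * T1 x - x\<^sup>2) b"
    proof (rule DERIV_nonneg_imp_nondecreasing[OF ab(2)])
      fix x assume x: "a \<le> x" "x \<le> b"
      have "x * 1 \<le> T x * (T1 x)\<^sup>2"
        using x ab T_ge[of x] T1_ge_1[of x] by (intro mult_mono) (auto simp: one_le_power)
      then show "\<exists>y. ((\<lambda>x. 2 * T1 x - x\<^sup>2) has_real_derivative y) (at x) \<and> 0 \<le> y"
        using x ab T1_deriv[of x]
        by (intro exI[of _ "2 * (T x * (T1 x)\<^sup>2) - 2 * x"]) (auto intro!: derivative_eq_intros)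
    qed
    moreover have "a\<^sup>2 \<le> b\<^sup>2" using ab by (intro power_mono) auto
    ultimately show ?thesis by simp
  qed
  have sq: "(a\<^sup>2 - b\<^sup>2)\<^sup>2 \<le> 4 * (T1 a - T1 b)\<^sup>2" if "0 \<le> a" "a \<le> b" "b < 1" for a b
  proof -
    have "(b\<^sup>2 - a\<^sup>2)\<^sup>2 \<le> (2 * (T1 b - T1 a))\<^sup>2" using main[OF that] by (intro power_mono) auto
    then show ?thesis by (simp add: power2_eq_square algebra_simps)
  qed
  show ?thesis
  proof (cases "\<bar>a\<bar> \<le> \<bar>b\<bar>")
    case True
    then show ?thesis using sq[of "\<bar>a\<bar>" "\<bar>b\<bar>"] T1_abs[OF assms(1)] T1_abs[OF assms(2)] assms by simp
  next
    case False
    then show ?thesis using sq[of "\<bar>b\<bar>" "\<bar>a\<bar>"] T1_abs[OF assms(1)] T1_abs[OF assms(2)] assms by (simp add: power2_commute)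
  qed
qed

text \<open>By the mean value theorem \<open>G 1 \<ge> 1/3\<close>, hence \<open>\<bar>T t\<bar> \<le> 1\<close>, and \<open>T1\<close> is at most
  \<open>(3/2) exp (1/2) \<le> 3\<close>.\<close>

lemma T1_le_3: "\<bar>t\<bar> \<le> 1/3 \<Longrightarrow> T1 t \<le> 3"
proof -
  assume t: "\<bar>t\<bar> \<le> 1/3"
  have sq: "sqrt (2 * pi) \<le> 3" using pi_less_4 by (intro real_le_lsqrt) auto
  have e: "exp (1/2 :: real) \<le> 2"
    using exp_ge_add_one_self[of "- (1/2) :: real"] by (simp add: exp_minus field_simps)
  obtain z where z: "0 < z" "z < 1" "G 1 - G 0 = (1 - 0) * (2 * nd z)"
    using MVT2[of 0 1 G "\<lambda>s. 2 * nd s"] G_deriv by auto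
  have "1/3 \<le> 2 * nd z"
  proof -
    have "z\<^sup>2 \<le> 1" using z by (simp add: power_le_one)
    then have "- (1/2) \<le> - z\<^sup>2 / 2" by linarith
    then have "exp (- (1/2)) \<le> exp (- z\<^sup>2 / 2)" by (simp only: exp_le_cancel_iff)
    moreover have "1/2 \<le> exp (- (1/2) :: real)" using e by (simp add: exp_minus field_simps)
    ultimately have "1/2 \<le> exp (- z\<^sup>2 / 2)" by linarith
    then have "(1/2) / 3 \<le> exp (- z\<^sup>2 / 2) / sqrt (2 * pi)" using sq by (intro frac_le) auto
    then show ?thesis by (simp add: nd_eq)
  qed
  then have "1/3 \<le> G 1" using z G_odd[of 0] by simp
  moreover have G1: "\<bar>G 1\<bar> < 1"
    using G_bounds[of 1] by linarith
  ultimately have "T (1/3) \<le> T (G 1)" by (intro T_mono) auto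
  then have "T (1/3) \<le> 1" by (simp add: T_G)
  then have "\<bar>T t\<bar> \<le> 1" using T_abs_le[OF t] by simp
  then have "(T t)\<^sup>2 \<le> 1" by (simp add: abs_square_le_1)
  then have "(T t)\<^sup>2 / 2 \<le> 1/2" by linarith
  then have "exp ((T t)\<^sup>2 / 2) \<le> exp (1/2)" by (simp only: exp_le_cancel_iff)
  then have "exp ((T t)\<^sup>2 / 2) \<le> 2" using e by linarith
  moreover have "sqrt (2 * pi) / 2 \<le> 3 / 2" using sq by simp
  ultimately have "sqrt (2 * pi) / 2 * exp ((T t)\<^sup>2 / 2) \<le> 3 / 2 * 2" by (intro mult_mono) auto
  then show ?thesis by (simp add: T1_eq)
qed

lemma T1_Lipschitz:
  assumes "\<bar>a\<bar> \<le> r" "\<bar>b\<bar> \<le> r" "r < 1"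
  shows "\<bar>T1 a - T1 b\<bar> \<le> T r * (T1 r)\<^sup>2 * \<bar>a - b\<bar>"
proof -
  have "norm (T1 a - T1 b) \<le> T r * (T1 r)\<^sup>2 * norm (a - b)"
  proof (rule field_differentiable_bound[where S = "{- r..r}" and f = T1
        and f' = "\<lambda>z. T z * (T1 z)\<^sup>2" and x = a and y = b])
    show "convex {- r..r}" by (rule convex_real_interval)
    show "a \<in> {- r..r}" "b \<in> {- r..r}" using assms by auto
  next
    fix z assume "z \<in> {- r..r}"
    then have z: "\<bar>z\<bar> \<le> r" by (simp add: abs_le_iff)
    then show "(T1 has_field_derivative T z * (T1 z)\<^sup>2) (at z within {- r..r})"
      using assms(3) by (intro has_field_derivative_at_within[OF T1_deriv]) linarith
    have Tz: "\<bar>T z\<bar> \<le> T r" using z assms(3) by (rule T_abs_le)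
    have "0 \<le> T1 z" using T1_ge_1[of z] by linarith
    then have "(T1 z)\<^sup>2 \<le> (T1 r)\<^sup>2" using T1_le[OF z assms(3)] by (intro power_mono)
    then have "\<bar>T z\<bar> * (T1 z)\<^sup>2 \<le> T r * (T1 r)\<^sup>2"
      using Tz by (intro mult_mono) (auto intro: order_trans[OF abs_ge_zero])
    then show "norm (T z * (T1 z)\<^sup>2) \<le> T r * (T1 r)\<^sup>2" by (simp only: real_norm_def abs_mult abs_power2)
  qed
  then show ?thesis by (simp only: real_norm_def)
qed

text \<open>A uniform first-order expansion of \<open>T\<close> on \<open>[-r, r]\<close>, with the difference quotient \<open>m\<close> bounded below.\<close>

lemma T_difference_quotient:
  assumes "\<bar>a\<bar> \<le> r" "\<bar>b\<bar> \<le> r" "r < 1"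
  shows "\<exists>m. T a - T b = m * (a - b) \<and> 1 \<le> m \<and> \<bar>m - T1 b\<bar> \<le> T r * (T1 r)\<^sup>2 * \<bar>a - b\<bar>"
proof -
  have "\<exists>z. \<bar>z\<bar> \<le> r \<and> \<bar>z - b\<bar> \<le> \<bar>a - b\<bar> \<and> T a - T b = T1 z * (a - b)"
  proof (cases a b rule: linorder_cases)
    case less
    have D: "(T has_real_derivative T1 x) (at x)" if "a \<le> x" "x \<le> b" for x
      using that assms by (intro T_deriv) linarith
    obtain z where "a < z" "z < b" "T b - T a = (b - a) * T1 z"
      using MVT2[OF less D] by blast
    then show ?thesis using assms by (intro exI[of _ z]) (auto simp: algebra_simps)
  next
    case greater
    have D: "(T has_real_derivative T1 x) (at x)" if "b \<le> x" "x \<le> a" for x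
      using that assms by (intro T_deriv) linarith
    obtain z where "b < z" "z < a" "T a - T b = (a - b) * T1 z"
      using MVT2[OF greater D] by blast
    then show ?thesis using assms by (intro exI[of _ z]) (auto simp: algebra_simps)
  qed (use assms in auto)
  then obtain z where z: "\<bar>z\<bar> \<le> r" "\<bar>z - b\<bar> \<le> \<bar>a - b\<bar>" "T a - T b = T1 z * (a - b)" by blast
  have "0 \<le> T r" using T_abs_le[OF assms(1,3)] by linarith
  then have "T r * (T1 r)\<^sup>2 * \<bar>z - b\<bar> \<le> T r * (T1 r)\<^sup>2 * \<bar>a - b\<bar>"
    using z(2) by (intro mult_left_mono) auto
  then show ?thesis
    using z T1_ge_1[of z] T1_Lipschitz[OF z(1) assms(2,3)] by (intro exI[of _ "T1 z"]) auto
qed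

lemma T_measurable [measurable]: "T \<in> borel_measurable borel"
proof -
  \<comment> \<open>Outside \<open>(-1, 1)\<close> the choice in the definition of \<open>T\<close> is from the same empty set.\<close>
  have const: "T t = T 1" if "\<not> \<bar>t\<bar> < 1" for t
  proof -
    have "(G s = t) = (G s = 1)" for s using G_bounds[of s] that by auto
    then show ?thesis unfolding T_def by simp
  qed
  have "continuous_on {-1<..<1} T"
    by (rule continuous_at_imp_continuous_on) (auto intro!: DERIV_isCont[OF T_deriv])
  then have [measurable]: "(\<lambda>t. indicator {-1<..<1} t *\<^sub>R T t) \<in> borel_measurable borel"
    by (intro borel_measurable_continuous_on_indicator) auto
  have "T = (\<lambda>t. indicator {-1<..<1} t *\<^sub>R T t + indicator (- {-1<..<1}) t * T 1)"
  proof
    fix t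
    show "T t = indicator {-1<..<1} t *\<^sub>R T t + indicator (- {-1<..<1}) t * T 1"
    proof (cases "t \<in> {-1<..<1}")
      case False
      then have "T t = T 1" by (intro const) auto
      then show ?thesis using False by (simp only: indicator_simps Compl_iff) simp
    qed simp
  qed
  also have "\<dots> \<in> borel_measurable borel" by measurable
  finally show ?thesis .
qed

section \<open>Transport of an intersection of slabs\<close>

lemma cbox_borel [measurable]: "{x::nat \<Rightarrow> real. \<forall>i<n. a i \<le> x i \<and> x i \<le> b i} \<in> sets borel"
proof -
  have "Measurable.pred borel (\<lambda>x::nat \<Rightarrow> real. \<forall>i\<in>{..<n}. a i \<le> x i \<and> x i \<le> b i)" by measurable
  then show ?thesis by (simp add: pred_def Ball_def)
qed

lemma sigma_finite_leb: "sigma_finite_measure (leb n)"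
proof
  let ?A = "\<lambda>k::nat. {x::nat \<Rightarrow> real. \<forall>i<n. - real k \<le> x i \<and> x i \<le> real k}"
  show "\<exists>A. countable A \<and> A \<subseteq> sets (leb n) \<and> \<Union> A = space (leb n) \<and> (\<forall>a\<in>A. emeasure (leb n) a \<noteq> \<infinity>)"
  proof (intro exI[of _ "range ?A"] conjI ballI)
    have "x \<in> \<Union>(range ?A)" for x
    proof -
      obtain k :: nat where k: "(\<Sum>i<n. \<bar>x i\<bar>) \<le> real k" using real_arch_simple by blast
      have "\<bar>x i\<bar> \<le> real k" if "i < n" for i
      proof -
        have "\<bar>x i\<bar> \<le> (\<Sum>i<n. \<bar>x i\<bar>)" using that by (intro member_le_sum) auto
        then show ?thesis using k by simp
      qed
      then have "x \<in> ?A k" by (auto simp: abs_le_iff) (metis minus_le_iff)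
      then show ?thesis by blast
    qed
    then show "\<Union>(range ?A) = space (leb n)" by auto
    show "range ?A \<subseteq> sets (leb n)" by auto
    fix a assume "a \<in> range ?A"
    then obtain k where "a = ?A k" by auto
    then show "emeasure (leb n) a \<noteq> \<infinity>" by (simp add: emeasure_leb_cbox)
  qed auto
qed

lemma emeasure_lin_cbox:
  assumes A: "0 < dt n A" and r: "0 \<le> r"
  shows "emeasure (leb n) {x. \<forall>l<n. z l - r \<le> lin n A x l \<and> lin n A x l \<le> z l + r} = ennreal ((2 * r) ^ n / dt n A)"
proof -
  let ?S = "{x::nat \<Rightarrow> real. \<forall>l<n. z l - r \<le> x l \<and> x l \<le> z l + r}"
  let ?X = "emeasure (leb n) {x. lin n A x \<in> ?S}"
  have "emeasure (leb n) ?S = ennreal (\<Prod>l<n. (z l + r) - (z l - r))"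
    using r by (intro emeasure_leb_cbox) auto
  also have "(\<Prod>l<n. (z l + r) - (z l - r)) = (2 * r) ^ n" by simp
  finally have "ennreal ((2 * r) ^ n) = ennreal \<bar>dt n A\<bar> * ?X"
    using emeasure_leb_lin[of ?S n A] A by simp
  then have "?X * ennreal (dt n A) / ennreal (dt n A) = ennreal ((2 * r) ^ n) / ennreal (dt n A)"
    using A by (simp add: mult.commute)
  then have "?X = ennreal ((2 * r) ^ n) / ennreal (dt n A)"
    using A by (subst (asm) mult_divide_eq_ennreal) auto
  also have "\<dots> = ennreal ((2 * r) ^ n / dt n A)" using A r by (intro divide_ennreal) auto
  finally show ?thesis by simp
qed

lemma nn_integral_normal_product: "(\<integral>\<^sup>+y. ennreal (\<Prod>l<n. nd (y l)) \<partial>leb n) = 1"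
proof -
  interpret product_sigma_finite "\<lambda>_::nat. lborel :: real measure" ..
  have one: "(\<integral>\<^sup>+x. ennreal (nd x) \<partial>lborel) = 1"
  proof -
    interpret prob_space std_normal_distribution by (rule prob_space_normal_density) simp
    show ?thesis using emeasure_space_1 by (simp add: emeasure_density)
  qed
  have "(\<integral>\<^sup>+y. ennreal (\<Prod>l<n. nd (y l)) \<partial>leb n)
      = (\<integral>\<^sup>+y. (\<Prod>l<n. ennreal (nd (y l))) \<partial>(\<Pi>\<^sub>M i\<in>{..<n}. lborel))"
    by (subst nn_integral_leb) (auto simp: prod_ennreal less_imp_le[OF nd_pos] intro!: nn_integral_cong)
  also have "\<dots> = (\<Prod>l<n. \<integral>\<^sup>+x. ennreal (nd x) \<partial>lborel)"
    by (rule product_nn_integral_prod) auto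
  finally show ?thesis by (simp add: one)
qed

lemma normal_product_eq: "(\<Prod>l<n. nd (y l)) = exp (- ip n y y / 2) / sqrt (2 * pi) ^ n"
proof -
  have "(\<Prod>l<n. nd (y l)) = (\<Prod>l<n. exp (- (y l)\<^sup>2 / 2)) / sqrt (2 * pi) ^ n"
    unfolding nd_eq prod_dividef by simp
  also have "(\<Prod>l<n. exp (- (y l)\<^sup>2 / 2)) = exp (\<Sum>l<n. - (y l)\<^sup>2 / 2)" by (simp add: exp_sum)
  also have "(\<Sum>l<n. - (y l)\<^sup>2 / 2) = - ip n y y / 2"
    by (simp add: ip_def power2_eq_square sum_negf sum_divide_distrib)
  finally show ?thesis .
qed

lemma ip_measurable [measurable]: "(\<lambda>x. ip n x v) \<in> borel_measurable borel"
  unfolding ip_def by measurable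

context tight
begin

definition slab :: "real \<Rightarrow> (nat \<Rightarrow> real) set"
  where "slab \<rho> = {x. \<forall>j\<in>J. \<bar>ip n x (u j)\<bar> \<le> \<rho>}"

definition transport :: "(nat \<Rightarrow> real) \<Rightarrow> nat \<Rightarrow> real"
  where "transport x = (\<Sum>j\<in>J. (c j * T (ip n x (u j))) *\<^sub>R u j)"

definition dtransport :: "(nat \<Rightarrow> real) \<Rightarrow> nat \<Rightarrow> nat \<Rightarrow> real"
  where "dtransport x = weighted (\<lambda>j. T1 (ip n x (u j)))"

lemma slab_borel [measurable]: "slab \<rho> \<in> sets borel"
proof -
  have "Measurable.pred borel (\<lambda>x. \<forall>j\<in>J. \<bar>ip n x (u j)\<bar> \<le> \<rho>)" by measurable
  then show ?thesis by (simp add: pred_def slab_def)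
qed

lemma transport_measurable [measurable]: "(\<lambda>x. transport x l) \<in> borel_measurable borel"
proof -
  have "(\<lambda>x. \<Sum>j\<in>J. c j * T (ip n x (u j)) * u j l) \<in> borel_measurable borel" by measurable
  then show ?thesis by (simp only: transport_def sum_fun_apply scaleR_fun_apply real_scaleR_def)
qed

lemma ip_self_frame: "ip n x x = (\<Sum>j\<in>J. c j * (ip n x (u j))\<^sup>2)"
proof -
  have "(\<Sum>j\<in>J. c j * (ip n x (u j))\<^sup>2) = (\<Sum>j\<in>J. c j * ip n x (u j) * ip n x (u j))"
    by (rule sum.cong, rule refl, simp only: power2_eq_square mult.assoc)
  then show ?thesis unfolding frame_ip by (rule sym)
qed

text \<open>Write \<open>\<Delta> = \<Theta>(x) - \<Theta>(x\<^sub>0) = \<Sum>\<^sub>j c\<^sub>j m\<^sub>j \<langle>d, u\<^sub>j\<rangle> u\<^sub>j\<close> with \<open>d = x - x\<^sub>0\<close> and difference quotients \<open>m\<^sub>j \<ge> 1\<close>.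
  Then \<open>\<bar>d\<bar>\<^sup>2 \<le> \<langle>\<Delta>, d\<rangle>\<close>, so \<open>\<Theta>\<close> is expanding and \<open>d\<close> is small; replacing \<open>m\<^sub>j\<close> by the derivative at
  \<open>x\<^sub>0\<close> costs an amount of order \<open>\<bar>d\<bar>\<^sup>2\<close>.\<close>

lemma transport_close:
  assumes \<rho>: "\<rho> < 1" and x: "x \<in> slab \<rho>" "x0 \<in> slab \<rho>" and h: "0 \<le> h"
    and close: "\<And>l. l < n \<Longrightarrow> \<bar>transport x l - transport x0 l\<bar> \<le> 2 * h" and l: "l < n"
  shows "\<bar>lin n (dtransport x0) (x - x0) l - (transport x l - transport x0 l)\<bar>
    \<le> T \<rho> * (T1 \<rho>)\<^sup>2 * (4 * real n * h\<^sup>2)"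
proof -
  define L where "L = T \<rho> * (T1 \<rho>)\<^sup>2"
  define d where "d = x - x0"
  define \<Delta> where "\<Delta> = transport x - transport x0"
  have "\<forall>j\<in>J. \<exists>m. T (ip n x (u j)) - T (ip n x0 (u j)) = m * ip n d (u j) \<and> 1 \<le> m \<and>
      \<bar>m - T1 (ip n x0 (u j))\<bar> \<le> L * \<bar>ip n d (u j)\<bar>"
  proof
    fix j assume "j \<in> J"
    then have "\<bar>ip n x (u j)\<bar> \<le> \<rho>" "\<bar>ip n x0 (u j)\<bar> \<le> \<rho>" using x by (simp_all add: slab_def)
    from T_difference_quotient[OF this \<rho>] show "\<exists>m. T (ip n x (u j)) - T (ip n x0 (u j)) = m * ip n d (u j) \<and> 1 \<le> m \<and>
      \<bar>m - T1 (ip n x0 (u j))\<bar> \<le> L * \<bar>ip n d (u j)\<bar>"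
      unfolding d_def ip_diff_left L_def .
  qed
  then obtain m where m: "\<And>j. j \<in> J \<Longrightarrow> T (ip n x (u j)) - T (ip n x0 (u j)) = m j * ip n d (u j)"
    "\<And>j. j \<in> J \<Longrightarrow> 1 \<le> m j" "\<And>j. j \<in> J \<Longrightarrow> \<bar>m j - T1 (ip n x0 (u j))\<bar> \<le> L * \<bar>ip n d (u j)\<bar>"
    unfolding bchoice_iff by blast
  have \<Delta>: "\<Delta> = (\<Sum>j\<in>J. (c j * m j * ip n d (u j)) *\<^sub>R u j)"
    unfolding \<Delta>_def transport_def sum_subtractf[symmetric] scaleR_diff_left[symmetric] right_diff_distrib[symmetric]
    by (intro sum.cong refl) (simp add: m(1) mult.assoc)
  have "ip n d d \<le> (\<Sum>j\<in>J. c j * m j * (ip n d (u j))\<^sup>2)"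
    unfolding ip_self_frame
  proof (intro sum_mono mult_right_mono)
    fix j assume "j \<in> J"
    then show "c j \<le> c j * m j" using m(2)[of j] c_nonneg[of j] mult_left_mono[of 1 "m j" "c j"] by simp
  qed auto
  also have "\<dots> = ip n \<Delta> d"
    unfolding \<Delta> ip_sum_left ip_scaleR_left
    by (intro sum.cong refl) (simp add: power2_eq_square ip_commute[of n "u _" d])
  finally have le: "ip n d d \<le> ip n \<Delta> d" .
  have dd: "ip n d d \<le> ip n \<Delta> \<Delta>"
  proof (cases "ip n d d = 0")
    case False
    then have pos: "0 < ip n d d" using ip_self_nonneg[of n d] by linarith
    have "(ip n d d)\<^sup>2 \<le> (ip n \<Delta> d)\<^sup>2" using le pos by (intro power_mono) auto
    also have "\<dots> \<le> ip n \<Delta> \<Delta> * ip n d d" by (rule ip_Cauchy_Schwarz)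
    finally show ?thesis using pos by (simp add: power2_eq_square)
  qed simp
  have "ip n \<Delta> \<Delta> \<le> (\<Sum>l<n. (2 * h)\<^sup>2)"
    unfolding ip_def
  proof (rule sum_mono)
    fix l assume "l \<in> {..<n}"
    then have "\<bar>\<Delta> l\<bar> \<le> 2 * h" using close by (simp add: \<Delta>_def)
    then have "\<bar>\<Delta> l\<bar>\<^sup>2 \<le> (2 * h)\<^sup>2" by (intro power_mono) auto
    then show "\<Delta> l * \<Delta> l \<le> (2 * h)\<^sup>2" by (simp add: power2_eq_square)
  qed
  then have dd2: "ip n d d \<le> 4 * real n * h\<^sup>2" using dd by (simp add: power2_eq_square)
  have L0: "0 \<le> L"
  proof (cases "J = {}")
    case True
    then have "n = 0" using sum_c by simp
    then show ?thesis using l by simp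
  next
    case False
    then obtain j where "j \<in> J" by blast
    then have "\<bar>ip n x (u j)\<bar> \<le> \<rho>" using x by (auto simp: slab_def)
    then have "0 \<le> T \<rho>" using T_abs_le[OF _ \<rho>] by fastforce
    then show ?thesis by (simp add: L_def)
  qed
  have "lin n (dtransport x0) d l - \<Delta> l = (\<Sum>j\<in>J. c j * (T1 (ip n x0 (u j)) - m j) * ip n d (u j) * u j l)"
    unfolding dtransport_def lin_weighted \<Delta> sum_fun_apply sum_subtractf[symmetric]
    by (intro sum.cong refl) (simp add: algebra_simps ip_commute[of n "u _" d])
  also have "\<bar>\<dots>\<bar> \<le> (\<Sum>j\<in>J. \<bar>c j * (T1 (ip n x0 (u j)) - m j) * ip n d (u j) * u j l\<bar>)"
    by (rule sum_abs)
  also have "\<dots> \<le> (\<Sum>j\<in>J. L * (c j * (ip n d (u j))\<^sup>2))"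
  proof (rule sum_mono)
    fix j assume j: "j \<in> J"
    have "(u j l)\<^sup>2 \<le> 1" using abs_coord_le[OF l, of "u j"] u_unit[OF j] by simp
    then have u1: "\<bar>u j l\<bar> \<le> 1" by (simp add: abs_square_le_1)
    have "\<bar>T1 (ip n x0 (u j)) - m j\<bar> \<le> L * \<bar>ip n d (u j)\<bar>" using m(3)[OF j] by (simp add: abs_minus_commute)
    then have "c j * \<bar>T1 (ip n x0 (u j)) - m j\<bar> * \<bar>ip n d (u j)\<bar> * \<bar>u j l\<bar>
        \<le> c j * (L * \<bar>ip n d (u j)\<bar>) * \<bar>ip n d (u j)\<bar> * 1"
      using u1 c_nonneg[OF j] L0 by (intro mult_mono) auto
    then show "\<bar>c j * (T1 (ip n x0 (u j)) - m j) * ip n d (u j) * u j l\<bar> \<le> L * (c j * (ip n d (u j))\<^sup>2)"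
      using c_nonneg[OF j] by (simp add: abs_mult power2_eq_square mult_ac)
  qed
  also have "\<dots> = L * ip n d d" by (simp only: sum_distrib_left[symmetric] ip_self_frame[of d])
  also have "\<dots> \<le> L * (4 * real n * h\<^sup>2)" using dd2 L0 by (rule mult_left_mono)
  finally show ?thesis by (simp add: L_def d_def \<Delta>_def)
qed

text \<open>Estimate \<open>\<bar>\<Theta>\<bar>\<^sup>2 = \<Sum>\<^sub>j c\<^sub>j t\<^sub>j \<langle>\<Theta>, u\<^sub>j\<rangle>\<close> by \<open>2 a b \<le> a\<^sup>2 + b\<^sup>2\<close> and use
  \<open>\<Sum>\<^sub>j c\<^sub>j \<langle>\<Theta>, u\<^sub>j\<rangle>\<^sup>2 = \<bar>\<Theta>\<bar>\<^sup>2\<close>.\<close>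

lemma ip_transport_le: "ip n (transport x) (transport x) \<le> (\<Sum>j\<in>J. c j * (T (ip n x (u j)))\<^sup>2)"
proof -
  let ?\<Theta> = "transport x"
  let ?t = "\<lambda>j. T (ip n x (u j))"
  have "ip n ?\<Theta> v = (\<Sum>j\<in>J. c j * (?t j * ip n v (u j)))" for v
    unfolding transport_def ip_sum_left ip_scaleR_left
    by (intro sum.cong refl) (simp only: mult.assoc ip_commute[of n v])
  then have "ip n ?\<Theta> ?\<Theta> = (\<Sum>j\<in>J. c j * (?t j * ip n ?\<Theta> (u j)))" by (simp only:)
  also have "\<dots> \<le> (\<Sum>j\<in>J. c j * ((?t j)\<^sup>2 / 2 + (ip n ?\<Theta> (u j))\<^sup>2 / 2))"
  proof (intro sum_mono mult_left_mono)
    fix j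
    show "?t j * ip n ?\<Theta> (u j) \<le> (?t j)\<^sup>2 / 2 + (ip n ?\<Theta> (u j))\<^sup>2 / 2"
      using sum_squares_bound[of "?t j" "ip n ?\<Theta> (u j)"] by simp
  qed (rule c_nonneg)
  also have "\<dots> = (\<Sum>j\<in>J. c j * (?t j)\<^sup>2) / 2 + ip n ?\<Theta> ?\<Theta> / 2"
    unfolding ip_self_frame[of ?\<Theta>] by (simp add: sum.distrib sum_divide_distrib distrib_left)
  finally show ?thesis by simp
qed

lemma exp_sum_ln_T1:
  "exp (\<Sum>j\<in>J. c j * ln (T1 (ip n x (u j)))) =
    (sqrt (2 * pi) / 2) ^ n * exp ((\<Sum>j\<in>J. c j * (T (ip n x (u j)))\<^sup>2) / 2)"
proof -
  have ln: "ln (T1 t) = ln (sqrt (2 * pi) / 2) + (T t)\<^sup>2 / 2" for t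
    unfolding T1_eq by (subst ln_mult) auto
  have "(\<Sum>j\<in>J. c j * ln (T1 (ip n x (u j)))) = (\<Sum>j\<in>J. c j) * ln (sqrt (2 * pi) / 2) + (\<Sum>j\<in>J. c j * (T (ip n x (u j)))\<^sup>2) / 2"
    unfolding ln sum_distrib_right sum_divide_distrib sum.distrib[symmetric] by (simp add: algebra_simps)
  also have "exp \<dots> = exp (real n * ln (sqrt (2 * pi) / 2)) * exp ((\<Sum>j\<in>J. c j * (T (ip n x (u j)))\<^sup>2) / 2)"
    by (simp add: exp_add sum_c)
  also have "exp (real n * ln (sqrt (2 * pi) / 2)) = (sqrt (2 * pi) / 2) ^ n"
    by (simp only: exp_of_nat_mult) simp
  finally show ?thesis .
qed

definition cell :: "real \<Rightarrow> real \<Rightarrow> (nat \<Rightarrow> real) \<Rightarrow> (nat \<Rightarrow> real) set"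
  where "cell \<rho> h y = {x \<in> slab \<rho>. \<forall>l<n. \<bar>transport x l - y l\<bar> \<le> h}"

lemma near_transport_norm:
  assumes \<rho>: "\<rho> < 1" and x: "x \<in> cell \<rho> h y" and h: "0 < h" "h < 1"
  shows "ip n y y \<le> (\<Sum>j\<in>J. c j * (T (ip n x (u j)))\<^sup>2) + h * (real n * ((T \<rho>)\<^sup>2 + 2))"
proof -
  let ?\<Theta> = "transport x"
  let ?S = "\<Sum>j\<in>J. c j * (T (ip n x (u j)))\<^sup>2"
  define e where "e = y - ?\<Theta>"
  have S: "?S \<le> real n * (T \<rho>)\<^sup>2"
  proof -
    have "?S \<le> (\<Sum>j\<in>J. c j * (T \<rho>)\<^sup>2)"
    proof (intro sum_mono mult_left_mono)
      fix j assume j: "j \<in> J"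
      then have "\<bar>T (ip n x (u j))\<bar> \<le> T \<rho>" using x \<rho> by (intro T_abs_le) (auto simp: cell_def slab_def)
      then have "\<bar>T (ip n x (u j))\<bar>\<^sup>2 \<le> (T \<rho>)\<^sup>2" by (intro power_mono) auto
      then show "(T (ip n x (u j)))\<^sup>2 \<le> (T \<rho>)\<^sup>2" by simp
      show "0 \<le> c j" by (rule c_nonneg[OF j])
    qed
    then show ?thesis by (simp add: sum_distrib_right[symmetric] sum_c)
  qed
  have ee: "ip n e e \<le> real n * h\<^sup>2"
  proof -
    have "ip n e e \<le> (\<Sum>l<n. h\<^sup>2)" unfolding ip_def
    proof (rule sum_mono)
      fix l assume "l \<in> {..<n}"
      then have "\<bar>e l\<bar> \<le> h" using x by (simp add: cell_def e_def abs_minus_commute)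
      then have "\<bar>e l\<bar>\<^sup>2 \<le> h\<^sup>2" by (intro power_mono) auto
      then show "e l * e l \<le> h\<^sup>2" by (simp add: power2_eq_square)
    qed
    then show ?thesis by simp
  qed
  have "0 \<le> ip n (h *\<^sub>R ?\<Theta> - e) (h *\<^sub>R ?\<Theta> - e)" by simp
  then have "h * (2 * ip n ?\<Theta> e) \<le> h * (h * ip n ?\<Theta> ?\<Theta>) + ip n e e"
    by (simp add: ip_simps ip_commute[of n e ?\<Theta>] algebra_simps)
  also have "\<dots> \<le> h * (h * ip n ?\<Theta> ?\<Theta> + real n * h)" using ee by (simp add: power2_eq_square algebra_simps)
  finally have cross: "2 * ip n ?\<Theta> e \<le> h * ip n ?\<Theta> ?\<Theta> + real n * h" using h by simp
  have y: "y = ?\<Theta> + e" by (simp add: e_def)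
  have "ip n y y = ip n ?\<Theta> ?\<Theta> + 2 * ip n ?\<Theta> e + ip n e e"
    unfolding y by (simp add: ip_simps ip_commute[of n e ?\<Theta>])
  also have "\<dots> \<le> ip n ?\<Theta> ?\<Theta> + h * ip n ?\<Theta> ?\<Theta> + real n * h + real n * h\<^sup>2" using cross ee by simp
  also have "h * ip n ?\<Theta> ?\<Theta> \<le> h * (real n * (T \<rho>)\<^sup>2)"
    using ip_transport_le[of x] S h by (intro mult_left_mono) auto
  also have "real n * h\<^sup>2 \<le> real n * h" using h by (intro mult_left_mono) (auto simp: power2_eq_square mult_left_le)
  finally have "ip n y y \<le> ip n ?\<Theta> ?\<Theta> + h * (real n * ((T \<rho>)\<^sup>2 + 2))" by (simp add: algebra_simps)
  then show ?thesis using ip_transport_le[of x] by simp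
qed

text \<open>The error factor of \<open>cell_integral_le\<close>; it tends to \<open>1\<close> as \<open>h\<close> tends to \<open>0\<close>.\<close>

definition err :: "real \<Rightarrow> real \<Rightarrow> real"
  where "err \<rho> h = (1 + h) * (1 + 4 * real n * (T \<rho> * (T1 \<rho>)\<^sup>2) * h) ^ n * exp (h * (real n * ((T \<rho>)\<^sup>2 + 2)) / 2)"

text \<open>Up to an error of second order in \<open>h\<close>, the transport is affine on the cell with linear part
  \<open>dtransport x\<^sub>0\<close>, so the cell lies in the preimage of a cube of side \<open>2 r \<approx> 2 h\<close> and has volume at most
  \<open>(2 r)\<^sup>n / det\<close>.  The hypothesis on \<open>w\<close> bounds \<open>w / det\<close> by \<open>exp (- \<Sum>\<^sub>j c\<^sub>j ln t\<^sub>j)\<close>, which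
  is \<open>2\<^sup>n\<close> times the normal density at \<open>y\<close> up to the error of \<open>near_transport_norm\<close>.  The point \<open>x\<^sub>0\<close>
  nearly maximizes \<open>w\<close> on the cell.\<close>

lemma cell_integral_le:
  assumes \<rho>: "0 < \<rho>" "\<rho> < 1" and h: "0 < h" "h < 1"
    and w1: "\<And>x. x \<in> slab \<rho> \<Longrightarrow> 1 \<le> w x" and wM: "\<And>x. x \<in> slab \<rho> \<Longrightarrow> w x \<le> Wm"
    and wdet: "\<And>x. x \<in> slab \<rho> \<Longrightarrow> exp (\<Sum>j\<in>J. c j * ln (T1 (ip n x (u j)))) * w x \<le> dt n (dtransport x)"
  shows "(\<integral>\<^sup>+x. ennreal (w x) * indicator (cell \<rho> h y) x \<partial>leb n)
    \<le> ennreal ((2 * h) ^ n * (err \<rho> h * 2 ^ n)) * ennreal (\<Prod>l<n. nd (y l))"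
proof (cases "cell \<rho> h y = {}")
  case False
  define Sw where "Sw = (SUP x\<in>cell \<rho> h y. w x)"
  have bdd: "bdd_above (w ` cell \<rho> h y)" using wM by (auto simp: cell_def bdd_above_def)
  have Sw: "w x \<le> Sw" if "x \<in> cell \<rho> h y" for x unfolding Sw_def using that bdd by (rule cSUP_upper)
  have "0 < Sw" using False Sw w1 by (force simp: cell_def)
  then have "Sw / (1 + h) < Sw" using h by (simp add: field_simps)
  then obtain x0 where x0: "x0 \<in> cell \<rho> h y" "Sw / (1 + h) < w x0"
    unfolding Sw_def using less_cSUP_iff[OF False bdd] by blast
  have w_le: "w x \<le> (1 + h) * w x0" if "x \<in> cell \<rho> h y" for x
    using Sw[OF that] x0(2) h by (simp add: field_simps)
  have x0s: "x0 \<in> slab \<rho>" using x0 by (simp add: cell_def)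
  define A where "A = dtransport x0"
  define L where "L = T \<rho> * (T1 \<rho>)\<^sup>2"
  have "0 \<le> T \<rho>" using T_abs_le[of 0 \<rho>] \<rho> by simp
  then have L0: "0 \<le> L" by (simp add: L_def)
  define r where "r = h * (1 + 4 * real n * L * h)"
  have r0: "0 \<le> r" using L0 h by (simp add: r_def)
  define K where "K = exp (\<Sum>j\<in>J. c j * ln (T1 (ip n x0 (u j))))"
  have K0: "0 < K" by (simp add: K_def)
  have wx0: "1 \<le> w x0" by (rule w1[OF x0s])
  have Kw: "K * w x0 \<le> dt n A" unfolding K_def A_def by (rule wdet[OF x0s])
  have Kw0: "0 < K * w x0" using K0 wx0 by simp
  then have dA: "0 < dt n A" using Kw by simp
  define z where "z l = lin n A x0 l - transport x0 l + y l" for l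
  have sub: "cell \<rho> h y \<subseteq> {x. \<forall>l<n. z l - r \<le> lin n A x l \<and> lin n A x l \<le> z l + r}"
  proof (intro subsetI CollectI allI impI)
    fix x l assume x: "x \<in> cell \<rho> h y" and l: "l < n"
    have "\<bar>transport x l - transport x0 l\<bar> \<le> 2 * h" if "l < n" for l
    proof -
      have "\<bar>transport x l - y l\<bar> \<le> h" "\<bar>transport x0 l - y l\<bar> \<le> h" using x x0 that by (auto simp: cell_def)
      then show ?thesis by linarith
    qed
    then have "\<bar>lin n A (x - x0) l - (transport x l - transport x0 l)\<bar> \<le> L * (4 * real n * h\<^sup>2)"
      unfolding A_def L_def using x x0s \<rho> h l by (intro transport_close) (auto simp: cell_def)
    moreover have "\<bar>transport x l - y l\<bar> \<le> h" using x l by (auto simp: cell_def)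
    moreover have "lin n A (x - x0) l = lin n A x l - lin n A x0 l" by (simp add: lin_arith)
    moreover have "r = h + L * (4 * real n * h\<^sup>2)" by (simp add: r_def power2_eq_square algebra_simps)
    ultimately show "z l - r \<le> lin n A x l \<and> lin n A x l \<le> z l + r"
      unfolding z_def by linarith
  qed
  have [measurable]: "{x. \<forall>l<n. z l - r \<le> lin n A x l \<and> lin n A x l \<le> z l + r} \<in> sets borel"
  proof -
    have "lin n A -` {x. \<forall>l<n. z l - r \<le> x l \<and> x l \<le> z l + r} \<inter> space borel \<in> sets borel"
      by (rule measurable_sets[OF lin_measurable cbox_borel])
    then show ?thesis by (simp add: vimage_def)
  qed
  have "(\<integral>\<^sup>+x. ennreal (w x) * indicator (cell \<rho> h y) x \<partial>leb n)
      \<le> (\<integral>\<^sup>+x. ennreal ((1 + h) * w x0) * indicator {x. \<forall>l<n. z l - r \<le> lin n A x l \<and> lin n A x l \<le> z l + r} x \<partial>leb n)"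
  proof (rule nn_integral_mono)
    fix x
    show "ennreal (w x) * indicator (cell \<rho> h y) x
      \<le> ennreal ((1 + h) * w x0) * indicator {x. \<forall>l<n. z l - r \<le> lin n A x l \<and> lin n A x l \<le> z l + r} x"
    proof (cases "x \<in> cell \<rho> h y")
      case True
      then have "x \<in> {x. \<forall>l<n. z l - r \<le> lin n A x l \<and> lin n A x l \<le> z l + r}" using sub by blast
      then show ?thesis using True w_le[OF True] by (simp only: indicator_simps mult_1_right) (rule ennreal_leI)
    qed simp
  qed
  also have "\<dots> = ennreal ((1 + h) * w x0) * ennreal ((2 * r) ^ n / dt n A)"
    using emeasure_lin_cbox[OF dA r0, of z] by (simp add: nn_integral_cmult_indicator)
  also have "\<dots> = ennreal ((1 + h) * w x0 * ((2 * r) ^ n / dt n A))"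
    using h wx0 r0 dA by (intro ennreal_mult[symmetric]) auto
  also have "\<dots> \<le> ennreal ((2 * h) ^ n * (err \<rho> h * 2 ^ n) * (\<Prod>l<n. nd (y l)))"
  proof (rule ennreal_leI)
    have "(1 + h) * w x0 * ((2 * r) ^ n / dt n A) \<le> (1 + h) * w x0 * ((2 * r) ^ n / (K * w x0))"
      using Kw Kw0 h wx0 r0 by (intro mult_left_mono divide_left_mono) auto
    also have "\<dots> = (1 + h) * (2 * r) ^ n * (1 / K)" using wx0 K0 by (simp add: field_simps)
    also have "1 / K \<le> 2 ^ n * (\<Prod>l<n. nd (y l)) * exp (h * (real n * ((T \<rho>)\<^sup>2 + 2)) / 2)"
    proof -
      let ?S = "\<Sum>j\<in>J. c j * (T (ip n x0 (u j)))\<^sup>2"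
      have "1 / K = (2 / sqrt (2 * pi)) ^ n * exp (- ?S / 2)"
        unfolding K_def exp_sum_ln_T1 by (simp add: exp_minus power_divide field_simps)
      also have "\<dots> \<le> (2 / sqrt (2 * pi)) ^ n * exp (- ip n y y / 2 + h * (real n * ((T \<rho>)\<^sup>2 + 2)) / 2)"
        using near_transport_norm[OF \<rho>(2) x0(1) h] by (intro mult_left_mono) auto
      also have "\<dots> = 2 ^ n * (\<Prod>l<n. nd (y l)) * exp (h * (real n * ((T \<rho>)\<^sup>2 + 2)) / 2)"
        unfolding normal_product_eq exp_add by (simp add: power_divide)
      finally show ?thesis .
    qed
    also have "(1 + h) * (2 * r) ^ n * (2 ^ n * (\<Prod>l<n. nd (y l)) * exp (h * (real n * ((T \<rho>)\<^sup>2 + 2)) / 2))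
        = (2 * h) ^ n * (err \<rho> h * 2 ^ n) * (\<Prod>l<n. nd (y l))"
      unfolding err_def r_def L_def by (simp add: power_mult_distrib)
    finally show "(1 + h) * w x0 * ((2 * r) ^ n / dt n A) \<le> (2 * h) ^ n * (err \<rho> h * 2 ^ n) * (\<Prod>l<n. nd (y l))"
      using h r0 by (simp add: mult_left_mono)
  qed
  also have "\<dots> = ennreal ((2 * h) ^ n * (err \<rho> h * 2 ^ n)) * ennreal (\<Prod>l<n. nd (y l))"
    using h \<rho> \<open>0 \<le> T \<rho>\<close> by (intro ennreal_mult) (auto simp: err_def prod_nonneg less_imp_le[OF nd_pos])
  finally show ?thesis .
qed simp

text \<open>Integrate \<open>w(x)\<close> over all pairs \<open>(x, y)\<close> with \<open>\<Theta>(x)\<close> in the cube of side \<open>2 h\<close> around \<open>y\<close>.  Integrating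
  over \<open>y\<close> first gives \<open>(2 h)\<^sup>n\<close> times the left-hand side; integrating over \<open>x\<close> first gives at most
  \<open>(2 h)\<^sup>n 2\<^sup>n\<close> times the mass of the normal distribution, up to the factor \<open>err\<close>.  Letting \<open>h\<close> tend to
  \<open>0\<close> replaces the change of variables formula for the nonlinear map \<open>\<Theta>\<close>.\<close>

theorem transport_volume_bound:
  assumes \<rho>: "0 < \<rho>" "\<rho> < 1" and [measurable]: "w \<in> borel_measurable borel"
    and w1: "\<And>x. x \<in> slab \<rho> \<Longrightarrow> 1 \<le> w x" and wM: "\<And>x. x \<in> slab \<rho> \<Longrightarrow> w x \<le> Wm"
    and wdet: "\<And>x. x \<in> slab \<rho> \<Longrightarrow> exp (\<Sum>j\<in>J. c j * ln (T1 (ip n x (u j)))) * w x \<le> dt n (dtransport x)"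
  shows "(\<integral>\<^sup>+x. ennreal (w x) * indicator (slab \<rho>) x \<partial>leb n) \<le> ennreal (2 ^ n)"
proof -
  let ?X = "\<integral>\<^sup>+x. ennreal (w x) * indicator (slab \<rho>) x \<partial>leb n"
  have le: "?X \<le> ennreal (err \<rho> h * 2 ^ n)" if h: "0 < h" "h < 1" for h
  proof -
    interpret sigma_finite_measure "leb n" by (rule sigma_finite_leb)
    interpret P: pair_sigma_finite "leb n" "leb n" ..
    define f where "f x y = (ennreal (w x) * indicator (slab \<rho>) x) *
        (indicator {p. \<forall>l\<in>{..<n}. \<bar>transport (fst p) l - snd p l\<bar> \<le> h} (x, y) :: ennreal)" for x y :: "nat \<Rightarrow> real"
    have pred: "Measurable.pred (leb n \<Otimes>\<^sub>M leb n) (\<lambda>p. \<forall>l\<in>{..<n}. \<bar>transport (fst p) l - snd p l\<bar> \<le> h)"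
      by measurable
    have [measurable]: "{p. \<forall>l\<in>{..<n}. \<bar>transport (fst p) l - snd p l\<bar> \<le> h} \<in> sets (leb n \<Otimes>\<^sub>M leb n)"
      using pred by (simp add: pred_def space_pair_measure)
    have meas: "case_prod f \<in> borel_measurable (leb n \<Otimes>\<^sub>M leb n)"
      unfolding f_def[abs_def] by measurable
    have inner: "(\<integral>\<^sup>+y. f x y \<partial>leb n) = ennreal ((2 * h) ^ n) * (ennreal (w x) * indicator (slab \<rho>) x)" for x
    proof -
      have eq: "f x y = (ennreal (w x) * indicator (slab \<rho>) x) *
          indicator {y. \<forall>l<n. transport x l - h \<le> y l \<and> y l \<le> transport x l + h} y" for y
        unfolding f_def by (rule arg_cong2[where f = "(*)"]) (auto simp: indicator_def abs_le_iff algebra_simps)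
      have "emeasure (leb n) {y. \<forall>l<n. transport x l - h \<le> y l \<and> y l \<le> transport x l + h}
          = ennreal (\<Prod>l<n. (transport x l + h) - (transport x l - h))"
        using h by (intro emeasure_leb_cbox) auto
      also have "\<dots> = ennreal ((2 * h) ^ n)" by simp
      finally show ?thesis unfolding eq by (subst nn_integral_cmult_indicator) (auto simp: mult.commute)
    qed
    have "ennreal ((2 * h) ^ n) * ?X = (\<integral>\<^sup>+x. (\<integral>\<^sup>+y. f x y \<partial>leb n) \<partial>leb n)"
      unfolding inner by (subst nn_integral_cmult) auto
    also have "\<dots> = (\<integral>\<^sup>+y. (\<integral>\<^sup>+x. f x y \<partial>leb n) \<partial>leb n)"
      by (rule P.Fubini'[symmetric, OF meas])
    also have "\<dots> \<le> (\<integral>\<^sup>+y. ennreal ((2 * h) ^ n * (err \<rho> h * 2 ^ n)) * ennreal (\<Prod>l<n. nd (y l)) \<partial>leb n)"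
    proof (rule nn_integral_mono)
      fix y
      have "(\<lambda>x. f x y) = (\<lambda>x. ennreal (w x) * indicator (cell \<rho> h y) x)"
        unfolding f_def cell_def by (auto simp: fun_eq_iff indicator_def)
      then show "(\<integral>\<^sup>+x. f x y \<partial>leb n) \<le> ennreal ((2 * h) ^ n * (err \<rho> h * 2 ^ n)) * ennreal (\<Prod>l<n. nd (y l))"
        using cell_integral_le[OF \<rho> h w1 wM wdet] by simp
    qed
    also have "\<dots> = ennreal ((2 * h) ^ n * (err \<rho> h * 2 ^ n))"
      by (subst nn_integral_cmult) (simp_all add: nn_integral_normal_product)
    also have "\<dots> = ennreal ((2 * h) ^ n) * ennreal (err \<rho> h * 2 ^ n)"
    proof -
      have "0 \<le> T \<rho>" using T_abs_le[of 0 \<rho>] \<rho> by simp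
      then show ?thesis using h by (intro ennreal_mult) (auto simp: err_def)
    qed
    finally show ?thesis using h by (subst (asm) ennreal_mult_le_mult_iff) auto
  qed
  have "((\<lambda>h. err \<rho> h * 2 ^ n) \<longlongrightarrow> err \<rho> 0 * 2 ^ n) (at_right 0)"
    unfolding err_def by (intro tendsto_intros) auto
  then have "((\<lambda>h. ennreal (err \<rho> h * 2 ^ n)) \<longlongrightarrow> ennreal (2 ^ n)) (at_right 0)"
    by (intro tendsto_ennrealI) (simp add: err_def)
  moreover have "eventually (\<lambda>h::real. ?X \<le> ennreal (err \<rho> h * 2 ^ n)) (at_right 0)"
    using le unfolding eventually_at_right_field by (intro exI[of _ 1]) auto
  ultimately show ?thesis by (rule tendsto_lowerbound) simp
qed

end

section \<open>Stability of the volume bound for an intersection of slabs\<close>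

definition cubeset :: "nat \<Rightarrow> real \<Rightarrow> (nat \<Rightarrow> real) set"
  where "cubeset n \<beta> = {x. \<forall>i<n. - \<beta> \<le> x i \<and> x i \<le> \<beta>}"

lemma cubeset_borel [measurable]: "cubeset n \<beta> \<in> sets borel"
  unfolding cubeset_def by (rule cbox_borel)

lemma emeasure_cubeset: "0 \<le> \<beta> \<Longrightarrow> emeasure (leb n) (cubeset n \<beta>) = ennreal ((2 * \<beta>) ^ n)"
  unfolding cubeset_def by (subst emeasure_leb_cbox) (auto simp: prod_constant)

text \<open>Some coordinate satisfies \<open>n v\<^sub>l\<^sup>2 \<ge> \<bar>v\<bar>\<^sup>2\<close>.  On the strip \<open>\<bar>\<langle>x, v\<rangle>\<bar> \<le> (\<beta>/4) \<bar>v\<^sub>l\<bar>\<close>, so replacing the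
  \<open>l\<close>-th coordinate by \<open>\<langle>x, v\<rangle> / v\<^sub>l\<close>, which preserves volume, maps the strip into a box with one side shortened to
  a quarter.\<close>

lemma emeasure_strip_le:
  assumes n: "0 < n" and \<beta>: "0 < \<beta>"
  shows "emeasure (leb n) {x \<in> cubeset n \<beta>. (ip n x v)\<^sup>2 < \<beta>\<^sup>2 / (16 * real n) * ip n v v} \<le> ennreal ((2 * \<beta>) ^ n / 4)"
proof (cases "ip n v v = 0")
  case True
  then have "{x \<in> cubeset n \<beta>. (ip n x v)\<^sup>2 < \<beta>\<^sup>2 / (16 * real n) * ip n v v} = {}" by auto
  then show ?thesis by (simp only: emeasure_empty zero_le)
next
  case False
  then have vv: "0 < ip n v v" using ip_self_nonneg[of n v] by linarith
  have "\<exists>l<n. ip n v v \<le> real n * (v l)\<^sup>2"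
  proof (rule ccontr)
    assume "\<not> (\<exists>l<n. ip n v v \<le> real n * (v l)\<^sup>2)"
    then have "real n * (v l)\<^sup>2 < ip n v v" if "l < n" for l using that by (auto simp: not_le)
    then have "(\<Sum>l<n. real n * (v l)\<^sup>2) < (\<Sum>l<n. ip n v v)" using n by (intro sum_strict_mono) auto
    also have "\<dots> = real n * ip n v v" by simp
    also have "\<dots> = (\<Sum>l<n. real n * (v l)\<^sup>2)" by (simp add: ip_def power2_eq_square sum_distrib_left)
    finally show False by simp
  qed
  then obtain l where l: "l < n" "ip n v v \<le> real n * (v l)\<^sup>2" by blast
  have vl: "v l \<noteq> 0" using l(2) vv by auto
  define A where "A = repl_row l (\<lambda>i. v i / v l)"
  have dA: "dt n A = 1" using l vl by (simp add: A_def dt_repl_row)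
  define b where "b i = (if i = l then \<beta> / 4 else \<beta>)" for i
  let ?B = "{y::nat \<Rightarrow> real. \<forall>i<n. - b i \<le> y i \<and> y i \<le> b i}"
  have lin_l: "lin n A x l = ip n x v / v l" for x
    using l by (simp add: lin_def A_def repl_row_def ip_def sum_divide_distrib mult.commute)
  have lin_i: "lin n A x i = x i" if "i < n" "i \<noteq> l" for x i
  proof -
    have "(\<Sum>j<n. A i j * x j) = (\<Sum>j<n. if i = j then x j else 0)"
      using that by (intro sum.cong) (auto simp: A_def repl_row_def)
    then show ?thesis using that by (simp add: lin_def ip_def)
  qed
  have sub: "{x \<in> cubeset n \<beta>. (ip n x v)\<^sup>2 < \<beta>\<^sup>2 / (16 * real n) * ip n v v} \<subseteq> {x. lin n A x \<in> ?B}"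
  proof
    fix x assume x: "x \<in> {x \<in> cubeset n \<beta>. (ip n x v)\<^sup>2 < \<beta>\<^sup>2 / (16 * real n) * ip n v v}"
    then have "(ip n x v)\<^sup>2 \<le> \<beta>\<^sup>2 / (16 * real n) * ip n v v" by simp
    also have "\<dots> \<le> \<beta>\<^sup>2 / (16 * real n) * (real n * (v l)\<^sup>2)" using l n by (intro mult_left_mono) auto
    also have "\<dots> = (\<beta> / 4 * v l)\<^sup>2" using n by (simp add: power2_eq_square)
    finally have "\<bar>ip n x v\<bar> \<le> \<bar>\<beta> / 4 * v l\<bar>" by (simp only: abs_le_square_iff)
    then have "\<bar>ip n x v / v l\<bar> \<le> \<beta> / 4" using vl \<beta> by (simp add: abs_mult pos_divide_le_eq)
    then have "- (\<beta> / 4) \<le> ip n x v / v l \<and> ip n x v / v l \<le> \<beta> / 4" by linarith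
    moreover have "b l = \<beta> / 4" by (simp add: b_def)
    ultimately have "- b l \<le> lin n A x l \<and> lin n A x l \<le> b l" by (simp only: lin_l)
    moreover have "- b i \<le> lin n A x i \<and> lin n A x i \<le> b i" if "i < n" "i \<noteq> l" for i
      using x that by (auto simp: lin_i b_def cubeset_def)
    ultimately have "\<forall>i<n. - b i \<le> lin n A x i \<and> lin n A x i \<le> b i" by blast
    then show "x \<in> {x. lin n A x \<in> ?B}" by simp
  qed
  have [measurable]: "{x. lin n A x \<in> ?B} \<in> sets borel"
    using measurable_sets[OF lin_measurable cbox_borel, of n A n "\<lambda>i. - b i" b] by (simp add: vimage_def)
  have "emeasure (leb n) {x \<in> cubeset n \<beta>. (ip n x v)\<^sup>2 < \<beta>\<^sup>2 / (16 * real n) * ip n v v}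
      \<le> emeasure (leb n) {x. lin n A x \<in> ?B}"
    using sub by (rule emeasure_mono) simp
  also have "\<dots> = emeasure (leb n) ?B" using emeasure_leb_lin[of ?B n A] dA by simp
  also have "\<dots> = ennreal (\<Prod>i<n. b i - - b i)" using \<beta> by (intro emeasure_leb_cbox) (auto simp: b_def)
  also have "(\<Prod>i<n. b i - - b i) = (2 * \<beta>) ^ n / 4"
  proof -
    have "(\<Prod>i<n. b i - - b i) = (\<beta> / 2) * (\<Prod>i\<in>{..<n}-{l}. b i - - b i)"
      using l by (subst prod.remove[of _ l]) (auto simp: b_def)
    also have "(\<Prod>i\<in>{..<n}-{l}. b i - - b i) = (\<Prod>i\<in>{..<n}-{l}. 2 * \<beta>)"
      by (intro prod.cong) (auto simp: b_def)
    also have "\<dots> = (2 * \<beta>) ^ (n - 1)" using l by simp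
    also have "(\<beta> / 2) * (2 * \<beta>) ^ (n - 1) = (2 * \<beta>) * (2 * \<beta>) ^ (n - 1) / 4" by simp
    also have "(2 * \<beta>) * (2 * \<beta>) ^ (n - 1) = (2 * \<beta>) ^ n" using n by (simp add: power_eq_if)
    finally show ?thesis .
  qed
  finally show ?thesis .
qed

text \<open>Since \<open>\<langle>x, u\<rangle>\<^sup>2 - \<langle>x, v\<rangle>\<^sup>2 = \<langle>x, u - v\<rangle> \<langle>x, u + v\<rangle>\<close>, the integrand is large outside two strips, which
  by \<open>emeasure_strip_le\<close> cover at most half of the cube; and
  \<open>\<bar>u - v\<bar>\<^sup>2 \<bar>u + v\<bar>\<^sup>2 = 4 (1 - \<langle>u, v\<rangle>\<^sup>2)\<close>.\<close>

lemma nn_integral_square_difference_ge: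
  assumes n: "0 < n" and \<beta>: "0 < \<beta>" and uv: "ip n u u = 1" "ip n v v = 1"
  shows "ennreal (2 * (\<beta>\<^sup>2 / (16 * real n))\<^sup>2 * (2 * \<beta>) ^ n * (1 - (ip n u v)\<^sup>2))
    \<le> (\<integral>\<^sup>+x. ennreal (((ip n x u)\<^sup>2 - (ip n x v)\<^sup>2)\<^sup>2) * indicator (cubeset n \<beta>) x \<partial>leb n)"
proof -
  let ?C = "cubeset n \<beta>"
  define c2 where "c2 = \<beta>\<^sup>2 / (16 * real n)"
  have c20: "0 \<le> c2" by (simp add: c2_def)
  define S where "S p = {x \<in> ?C. (ip n x p)\<^sup>2 < c2 * ip n p p}" for p
  have [measurable]: "S p \<in> sets borel" for p
  proof -
    have "{x \<in> space borel. x \<in> ?C \<and> (ip n x p)\<^sup>2 < c2 * ip n p p} \<in> sets borel" by measurable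
    then show ?thesis by (simp add: S_def)
  qed
  define R where "R = ?C - S (u - v) - S (u + v)"
  define V where "V = (2 * \<beta>) ^ n"
  have V0: "0 < V" using \<beta> by (simp add: V_def)
  have "ennreal V = emeasure (leb n) ?C" using \<beta> by (simp add: V_def emeasure_cubeset)
  also have "\<dots> \<le> emeasure (leb n) (R \<union> (S (u - v) \<union> S (u + v)))"
    by (rule emeasure_mono) (auto simp: R_def)
  also have "\<dots> \<le> emeasure (leb n) R + emeasure (leb n) (S (u - v) \<union> S (u + v))"
    by (rule emeasure_subadditive) (auto simp: R_def)
  also have "emeasure (leb n) (S (u - v) \<union> S (u + v)) \<le> emeasure (leb n) (S (u - v)) + emeasure (leb n) (S (u + v))"
    by (rule emeasure_subadditive) auto
  also have "emeasure (leb n) (S (u - v)) \<le> ennreal (V / 4)"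
    unfolding S_def c2_def V_def using n \<beta> by (rule emeasure_strip_le)
  also have "emeasure (leb n) (S (u + v)) \<le> ennreal (V / 4)"
    unfolding S_def c2_def V_def using n \<beta> by (rule emeasure_strip_le)
  finally have "ennreal V \<le> emeasure (leb n) R + (ennreal (V / 4) + ennreal (V / 4))"
    by (simp add: add_left_mono)
  moreover have "ennreal (V / 4) + ennreal (V / 4) = ennreal (V / 2)"
    using V0 by (simp add: ennreal_plus[symmetric] del: ennreal_plus)
  moreover have "ennreal V = ennreal (V / 2) + ennreal (V / 2)"
    using V0 by (simp add: ennreal_plus[symmetric] del: ennreal_plus)
  ultimately have "ennreal (V / 2) + ennreal (V / 2) \<le> ennreal (V / 2) + emeasure (leb n) R"
    by (simp add: add.commute)
  then have R: "ennreal (V / 2) \<le> emeasure (leb n) R"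
    by (subst (asm) ennreal_add_left_cancel_le) auto
  let ?q = "c2\<^sup>2 * (4 * (1 - (ip n u v)\<^sup>2))"
  have g1: "(ip n u v)\<^sup>2 \<le> 1" using ip_Cauchy_Schwarz[of n u v] uv by simp
  then have q0: "0 \<le> ?q" by simp
  have low: "?q \<le> ((ip n x u)\<^sup>2 - (ip n x v)\<^sup>2)\<^sup>2" if "x \<in> R" for x
  proof -
    have 1: "c2 * ip n (u - v) (u - v) \<le> (ip n x (u - v))\<^sup>2" "c2 * ip n (u + v) (u + v) \<le> (ip n x (u + v))\<^sup>2"
      using that by (auto simp: R_def S_def not_less)
    have "(c2 * ip n (u - v) (u - v)) * (c2 * ip n (u + v) (u + v)) \<le> (ip n x (u - v))\<^sup>2 * (ip n x (u + v))\<^sup>2"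
      using 1 c20 by (intro mult_mono) auto
    moreover have "(c2 * ip n (u - v) (u - v)) * (c2 * ip n (u + v) (u + v)) = ?q"
      by (simp add: ip_simps uv ip_commute[of n v u] power2_eq_square algebra_simps)
    moreover have "(ip n x (u - v))\<^sup>2 * (ip n x (u + v))\<^sup>2 = ((ip n x u)\<^sup>2 - (ip n x v)\<^sup>2)\<^sup>2"
      by (simp add: ip_simps power2_eq_square algebra_simps)
    ultimately show ?thesis by simp
  qed
  have eq: "2 * c2\<^sup>2 * V * (1 - (ip n u v)\<^sup>2) = ?q * (V / 2)" by (simp add: algebra_simps)
  have "ennreal (2 * c2\<^sup>2 * V * (1 - (ip n u v)\<^sup>2)) = ennreal ?q * ennreal (V / 2)"
    unfolding eq using q0 V0 by (intro ennreal_mult) auto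
  also have "\<dots> \<le> ennreal ?q * emeasure (leb n) R" using R by (rule mult_left_mono) simp
  also have "\<dots> = (\<integral>\<^sup>+x. ennreal ?q * indicator R x \<partial>leb n)"
    by (rule nn_integral_cmult_indicator[symmetric]) (simp add: R_def)
  also have "\<dots> \<le> (\<integral>\<^sup>+x. ennreal (((ip n x u)\<^sup>2 - (ip n x v)\<^sup>2)\<^sup>2) * indicator ?C x \<partial>leb n)"
  proof (rule nn_integral_mono)
    fix x
    show "ennreal ?q * indicator R x \<le> ennreal (((ip n x u)\<^sup>2 - (ip n x v)\<^sup>2)\<^sup>2) * indicator ?C x"
    proof (cases "x \<in> R")
      case True
      then have "x \<in> ?C" by (simp add: R_def)
      then show ?thesis using True ennreal_leI[OF low[OF True]] by (simp only: indicator_simps mult_1_right)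
    qed simp
  qed
  finally show ?thesis by (simp only: c2_def V_def)
qed

text \<open>The bound of \<open>nn_integral_square_difference_ge\<close> for the cube with \<open>\<beta> = 1 / (3 n)\<close>, which lies in the ball of
  radius \<open>1/3\<close>, without the factor \<open>1 - \<langle>u, v\<rangle>\<^sup>2\<close> and divided by the \<open>144\<close> in \<open>spread\<close>.\<close>

definition gap_const :: "nat \<Rightarrow> real"
  where "gap_const n = (1/72) * ((1 / (3 * real n))\<^sup>2 / (16 * real n))\<^sup>2 * (2 * (1 / (3 * real n))) ^ n"

context tight
begin

definition orth_defect :: real
  where "orth_defect = (\<Sum>j\<in>J. \<Sum>k\<in>J. c j * c k * ((ip n (u j) (u k))\<^sup>2 * (1 - (ip n (u j) (u k))\<^sup>2)))"

lemma ip_u_le_1: "j \<in> J \<Longrightarrow> k \<in> J \<Longrightarrow> (ip n (u j) (u k))\<^sup>2 \<le> 1"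
  using ip_Cauchy_Schwarz[of n "u j" "u k"] u_unit by simp

lemma orth_defect_nonneg: "0 \<le> orth_defect"
  unfolding orth_defect_def using c_nonneg ip_u_le_1
  by (intro sum_nonneg mult_nonneg_nonneg) auto

text \<open>A lower bound for the gain in \<open>dt_weighted_ge\<close> at points of the ball of radius \<open>1/3\<close>.  There \<open>T1 \<le> 3\<close>, so
  the denominator \<open>4 M\<^sup>2\<close> is \<open>36\<close>, and \<open>T1_diff_ge\<close> contributes another factor \<open>4\<close>.\<close>

definition spread :: "(nat \<Rightarrow> real) \<Rightarrow> real"
  where "spread x = (\<Sum>j\<in>J. \<Sum>k\<in>J. (c j * c k * (ip n (u j) (u k))\<^sup>2 / 144) * ((ip n x (u j))\<^sup>2 - (ip n x (u k))\<^sup>2)\<^sup>2)"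

lemma spread_nonneg: "0 \<le> spread x"
  unfolding spread_def using c_nonneg by (intro sum_nonneg mult_nonneg_nonneg) auto

lemma spread_measurable [measurable]: "spread \<in> borel_measurable borel"
  unfolding spread_def[abs_def] by measurable

lemma slab_scale:
  assumes "0 < \<rho>"
  shows "emeasure (leb n) (slab \<rho>) = ennreal (\<rho> ^ n) * emeasure (leb n) (slab 1)"
proof -
  define A where "A = (\<lambda>i j::nat. (1 / \<rho>) * (if i = j then 1 else (0::real)))"
  have dA: "dt n A = (1 / \<rho>) ^ n" by (simp only: A_def dt_smult dt_id mult_1_right)
  have ip: "ip n (lin n A x) v = ip n x v / \<rho>" for x v
  proof -
    have "lin n A x i = x i / \<rho>" if "i < n" for i
    proof -
      have "(\<Sum>j<n. A i j * x j) = (\<Sum>j<n. if i = j then x j / \<rho> else 0)"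
        by (intro sum.cong) (auto simp: A_def)
      then show ?thesis using that by (simp add: lin_def ip_def)
    qed
    then show ?thesis by (simp add: ip_def sum_divide_distrib)
  qed
  have "{x. lin n A x \<in> slab 1} = slab \<rho>"
    using assms by (auto simp: slab_def ip abs_divide pos_divide_le_eq)
  then have "emeasure (leb n) (slab 1) = ennreal ((1 / \<rho>) ^ n) * emeasure (leb n) (slab \<rho>)"
    using emeasure_leb_lin[of "slab 1" n A] assms unfolding dA by simp
  then have "ennreal (\<rho> ^ n) * emeasure (leb n) (slab 1) = ennreal (\<rho> ^ n * (1 / \<rho>) ^ n) * emeasure (leb n) (slab \<rho>)"
    using assms by (simp add: ennreal_mult mult.assoc)
  also have "\<rho> ^ n * (1 / \<rho>) ^ n = 1" using assms by (simp add: power_mult_distrib[symmetric])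
  finally show ?thesis by simp
qed

lemma nn_integral_spread_ge:
  assumes n: "0 < n"
  shows "ennreal (gap_const n * orth_defect) \<le> (\<integral>\<^sup>+x. ennreal (spread x) * indicator (cubeset n (1 / (3 * real n))) x \<partial>leb n)"
proof -
  let ?\<beta> = "1 / (3 * real n)"
  let ?g = "\<lambda>j k. (ip n (u j) (u k))\<^sup>2"
  let ?a = "\<lambda>j k. c j * c k * ?g j k / 144"
  let ?q = "\<lambda>j k x. ((ip n x (u j))\<^sup>2 - (ip n x (u k))\<^sup>2)\<^sup>2"
  let ?m = "2 * (?\<beta>\<^sup>2 / (16 * real n))\<^sup>2 * (2 * ?\<beta>) ^ n"
  have a0: "0 \<le> ?a j k" if "j \<in> J" "k \<in> J" for j k using c_nonneg that by simp
  have m0: "0 \<le> ?m * (1 - ?g j k)" if "j \<in> J" "k \<in> J" for j k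
    using ip_u_le_1[OF that] by (intro mult_nonneg_nonneg) auto
  have "gap_const n * orth_defect = (\<Sum>j\<in>J. \<Sum>k\<in>J. ?a j k * (?m * (1 - ?g j k)))"
    unfolding orth_defect_def gap_const_def sum_distrib_left by (intro sum.cong refl) simp
  then have "ennreal (gap_const n * orth_defect) = (\<Sum>j\<in>J. \<Sum>k\<in>J. ennreal (?a j k) * ennreal (?m * (1 - ?g j k)))"
    using a0 m0 by (simp only: sum_ennreal[symmetric] ennreal_mult[symmetric] sum_nonneg mult_nonneg_nonneg cong: sum.cong)
  also have "\<dots> \<le> (\<Sum>j\<in>J. \<Sum>k\<in>J. ennreal (?a j k) * (\<integral>\<^sup>+x. ennreal (?q j k x) * indicator (cubeset n ?\<beta>) x \<partial>leb n))"
    using n u_unit by (intro sum_mono mult_left_mono nn_integral_square_difference_ge) auto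
  also have "\<dots> = (\<integral>\<^sup>+x. (\<Sum>j\<in>J. \<Sum>k\<in>J. ennreal (?a j k) * (ennreal (?q j k x) * indicator (cubeset n ?\<beta>) x)) \<partial>leb n)"
    by (simp add: nn_integral_sum nn_integral_cmult)
  also have "\<dots> = (\<integral>\<^sup>+x. ennreal (spread x) * indicator (cubeset n ?\<beta>) x \<partial>leb n)"
  proof (rule nn_integral_cong)
    fix x
    have "ennreal (spread x) = (\<Sum>j\<in>J. \<Sum>k\<in>J. ennreal (?a j k) * ennreal (?q j k x))"
      unfolding spread_def using a0
      by (simp only: sum_ennreal[symmetric] ennreal_mult[symmetric] sum_nonneg mult_nonneg_nonneg zero_le_power2 cong: sum.cong)
    then show "(\<Sum>j\<in>J. \<Sum>k\<in>J. ennreal (?a j k) * (ennreal (?q j k x) * indicator (cubeset n ?\<beta>) x))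
        = ennreal (spread x) * indicator (cubeset n ?\<beta>) x"
      by (simp only: sum_distrib_right mult.assoc)
  qed
  finally show ?thesis .
qed

text \<open>Apply \<open>transport_volume_bound\<close> with the weight \<open>w = 1 + spread\<close> on a small cube and \<open>w = 1\<close>
  elsewhere.  The slabs are shrunk by \<open>\<rho> < 1\<close> because the transport is singular at their boundary.\<close>

lemma slab_volume_deficit_aux:
  assumes n: "0 < n" and \<rho>: "1/2 \<le> \<rho>" "\<rho> < 1"
  shows "ennreal (\<rho> ^ n) * emeasure (leb n) (slab 1) + ennreal (gap_const n * orth_defect) \<le> ennreal (2 ^ n)"
proof -
  let ?\<beta> = "1 / (3 * real n)"
  let ?C = "cubeset n ?\<beta>"
  \<comment> \<open>The Euclidean norm on the cube is at most \<open>\<surd>n / (3 n) \<le> 1/3\<close>.\<close>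
  have small: "\<bar>ip n x (u j)\<bar> \<le> 1/3" if x: "x \<in> ?C" and j: "j \<in> J" for x j
  proof -
    have "(ip n x (u j))\<^sup>2 \<le> ip n x x" using ip_Cauchy_Schwarz[of n x "u j"] u_unit[OF j] by simp
    also have "\<dots> \<le> (\<Sum>i<n. ?\<beta>\<^sup>2)" unfolding ip_def
    proof (rule sum_mono)
      fix i assume "i \<in> {..<n}"
      then have "\<bar>x i\<bar> \<le> ?\<beta>" using x by (simp add: cubeset_def abs_le_iff minus_le_iff)
      then have "\<bar>x i\<bar>\<^sup>2 \<le> ?\<beta>\<^sup>2" by (intro power_mono) auto
      then show "x i * x i \<le> ?\<beta>\<^sup>2" by (simp add: power2_eq_square)
    qed
    also have "\<dots> \<le> (1/3)\<^sup>2" using n by (simp add: power2_eq_square field_simps)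
    finally have "\<bar>ip n x (u j)\<bar> \<le> \<bar>1/3\<bar>" by (simp only: abs_le_square_iff)
    then show ?thesis by simp
  qed
  have C_sub: "?C \<subseteq> slab \<rho>" using small \<rho> by (force simp: slab_def)
  define w where "w x = 1 + spread x * indicator ?C x" for x
  have [measurable]: "w \<in> borel_measurable borel" unfolding w_def[abs_def] by measurable
  have w_le: "w x \<le> 1 + (\<Sum>j\<in>J. \<Sum>k\<in>J. (c j * c k * (ip n (u j) (u k))\<^sup>2 / 144) * 1)" if x: "x \<in> slab \<rho>" for x
  proof -
    have "spread x \<le> (\<Sum>j\<in>J. \<Sum>k\<in>J. (c j * c k * (ip n (u j) (u k))\<^sup>2 / 144) * 1)"
      unfolding spread_def
    proof (intro sum_mono mult_left_mono)
      fix j k assume jk: "j \<in> J" "k \<in> J"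
      have sq: "0 \<le> (ip n x (u i))\<^sup>2 \<and> (ip n x (u i))\<^sup>2 \<le> 1" if "i \<in> J" for i
      proof -
        have "\<bar>ip n x (u i)\<bar> \<le> \<rho>" using x that by (simp add: slab_def)
        then have "\<bar>ip n x (u i)\<bar> \<le> 1" using \<rho> by linarith
        then show ?thesis by (simp add: abs_square_le_1)
      qed
      have "\<bar>(ip n x (u j))\<^sup>2 - (ip n x (u k))\<^sup>2\<bar> \<le> 1" using sq[OF jk(1)] sq[OF jk(2)] by linarith
      then show "((ip n x (u j))\<^sup>2 - (ip n x (u k))\<^sup>2)\<^sup>2 \<le> 1" by (simp add: abs_square_le_1)
      show "0 \<le> c j * c k * (ip n (u j) (u k))\<^sup>2 / 144" using jk c_nonneg by simp
    qed
    then show ?thesis using spread_nonneg[of x] by (auto simp: w_def indicator_def)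
  qed
  have wdet: "exp (\<Sum>j\<in>J. c j * ln (T1 (ip n x (u j)))) * w x \<le> dt n (dtransport x)" if x: "x \<in> slab \<rho>" for x
  proof -
    let ?t = "\<lambda>j. T1 (ip n x (u j))"
    let ?D = "\<lambda>M. (\<Sum>j\<in>J. \<Sum>k\<in>J. c j * c k * (ip n (u j) (u k))\<^sup>2 * (?t j - ?t k)\<^sup>2) / (4 * M\<^sup>2)"
    have ge: "exp (\<Sum>j\<in>J. c j * ln (?t j)) * (1 + ?D M) \<le> dt n (dtransport x)"
      if "\<And>j. j \<in> J \<Longrightarrow> ?t j \<le> M" "1 \<le> M" for M
      unfolding dtransport_def using that T1_ge_1 by (intro dt_weighted_ge) auto
    show ?thesis
    proof (cases "x \<in> ?C")
      case True
      have "spread x \<le> ?D 3"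
        unfolding spread_def sum_divide_distrib
      proof (intro sum_mono)
        fix j k assume jk: "j \<in> J" "k \<in> J"
        have "((ip n x (u j))\<^sup>2 - (ip n x (u k))\<^sup>2)\<^sup>2 \<le> 4 * (?t j - ?t k)\<^sup>2"
          using small[OF True] jk by (intro T1_diff_ge) force+
        then have "(c j * c k * (ip n (u j) (u k))\<^sup>2 / 144) * ((ip n x (u j))\<^sup>2 - (ip n x (u k))\<^sup>2)\<^sup>2
            \<le> (c j * c k * (ip n (u j) (u k))\<^sup>2 / 144) * (4 * (?t j - ?t k)\<^sup>2)"
          using c_nonneg jk by (intro mult_left_mono) auto
        also have "\<dots> = c j * c k * (ip n (u j) (u k))\<^sup>2 * (?t j - ?t k)\<^sup>2 / (4 * 3\<^sup>2)" by simp
        finally show "(c j * c k * (ip n (u j) (u k))\<^sup>2 / 144) * ((ip n x (u j))\<^sup>2 - (ip n x (u k))\<^sup>2)\<^sup>2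
            \<le> c j * c k * (ip n (u j) (u k))\<^sup>2 * (?t j - ?t k)\<^sup>2 / (4 * 3\<^sup>2)" .
      qed
      then have "exp (\<Sum>j\<in>J. c j * ln (?t j)) * w x \<le> exp (\<Sum>j\<in>J. c j * ln (?t j)) * (1 + ?D 3)"
        using True by (intro mult_left_mono) (auto simp: w_def)
      also have "\<dots> \<le> dt n (dtransport x)" using small[OF True] T1_le_3 by (intro ge) auto
      finally show ?thesis .
    next
      case False
      have "0 \<le> ?D (T1 \<rho>)" using c_nonneg by (intro divide_nonneg_nonneg sum_nonneg mult_nonneg_nonneg) auto
      then have "exp (\<Sum>j\<in>J. c j * ln (?t j)) * w x \<le> exp (\<Sum>j\<in>J. c j * ln (?t j)) * (1 + ?D (T1 \<rho>))"
        using False by (intro mult_left_mono) (auto simp: w_def)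
      also have "\<dots> \<le> dt n (dtransport x)"
        using x \<rho> T1_le T1_ge_1 by (intro ge) (auto simp: slab_def)
      finally show ?thesis .
    qed
  qed
  have "ennreal (\<rho> ^ n) * emeasure (leb n) (slab 1) = (\<integral>\<^sup>+x. indicator (slab \<rho>) x \<partial>leb n)"
    using slab_scale[of \<rho>] \<rho> by simp
  then have "ennreal (\<rho> ^ n) * emeasure (leb n) (slab 1) + ennreal (gap_const n * orth_defect)
      \<le> (\<integral>\<^sup>+x. indicator (slab \<rho>) x \<partial>leb n) + (\<integral>\<^sup>+x. ennreal (spread x) * indicator ?C x \<partial>leb n)"
    using nn_integral_spread_ge[OF n] by (intro add_mono) auto
  also have "\<dots> = (\<integral>\<^sup>+x. indicator (slab \<rho>) x + ennreal (spread x) * indicator ?C x \<partial>leb n)"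
    by (rule nn_integral_add[symmetric]) auto
  also have "\<dots> = (\<integral>\<^sup>+x. ennreal (w x) * indicator (slab \<rho>) x \<partial>leb n)"
  proof (rule nn_integral_cong)
    fix x
    show "indicator (slab \<rho>) x + ennreal (spread x) * indicator ?C x = ennreal (w x) * indicator (slab \<rho>) x"
    proof (cases "x \<in> ?C")
      case True
      then have "x \<in> slab \<rho>" using C_sub by blast
      then show ?thesis using True spread_nonneg[of x] by (simp add: w_def)
    qed (simp add: w_def)
  qed
  also have "\<dots> \<le> ennreal (2 ^ n)"
  proof (rule transport_volume_bound)
    show "1 \<le> w x" if "x \<in> slab \<rho>" for x using spread_nonneg[of x] by (simp add: w_def)
  qed (use \<rho> w_le wdet in auto)
  finally show ?thesis .
qed

theorem slab_volume_deficit: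
  assumes n: "0 < n"
  shows "emeasure (leb n) (slab 1) < \<infinity>"
    and "measure (leb n) (slab 1) + gap_const n * orth_defect \<le> 2 ^ n"
proof -
  let ?X = "emeasure (leb n) (slab 1)"
  have "ennreal ((1/2) ^ n) * ?X \<le> ennreal (2 ^ n)"
  proof -
    have "ennreal ((1/2) ^ n) * ?X \<le> ennreal ((1/2) ^ n) * ?X + ennreal (gap_const n * orth_defect)"
      by (simp add: le_iff_add)
    also have "\<dots> \<le> ennreal (2 ^ n)" by (rule slab_volume_deficit_aux[OF n]) auto
    finally show ?thesis .
  qed
  then have "?X \<noteq> \<top>" by (auto simp: ennreal_mult_top top_unique split: if_splits)
  then show fin: "?X < \<infinity>" by (simp add: less_top)
  define x where "x = measure (leb n) (slab 1)"
  have X: "?X = ennreal x" using fin by (simp add: x_def emeasure_eq_ennreal_measure)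
  have x0: "0 \<le> x" by (simp add: x_def)
  have k0: "0 \<le> gap_const n * orth_defect" using orth_defect_nonneg by (simp add: gap_const_def)
  have le: "\<rho> ^ n * x + gap_const n * orth_defect \<le> 2 ^ n" if "1/2 \<le> \<rho>" "\<rho> < 1" for \<rho>
  proof -
    have "ennreal (\<rho> ^ n * x + gap_const n * orth_defect) \<le> ennreal (2 ^ n)"
      using slab_volume_deficit_aux[OF n that] that x0 k0 unfolding X
      by (simp add: ennreal_mult ennreal_plus)
    then show ?thesis by (subst (asm) ennreal_le_iff) auto
  qed
  have "((\<lambda>\<rho>. \<rho> ^ n * x + gap_const n * orth_defect) \<longlongrightarrow> 1 ^ n * x + gap_const n * orth_defect) (at_left 1)"
    by (intro tendsto_intros)
  moreover have "eventually (\<lambda>\<rho>::real. \<rho> ^ n * x + gap_const n * orth_defect \<le> 2 ^ n) (at_left 1)"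
    using le unfolding eventually_at_left_field by (intro exI[of _ "1/2"]) auto
  ultimately have "1 ^ n * x + gap_const n * orth_defect \<le> 2 ^ n" by (rule tendsto_upperbound) simp
  then show "measure (leb n) (slab 1) + gap_const n * orth_defect \<le> 2 ^ n" by (simp add: x_def)
qed

end

section \<open>An almost orthogonal system among the contact points\<close>

context tight
begin

lemma frame_unit: "j \<in> J \<Longrightarrow> (\<Sum>k\<in>J. c k * (ip n (u j) (u k))\<^sup>2) = 1"
  using ip_self_frame[of "u j"] u_unit by simp

text \<open>Greedy choice.  Write \<open>g(i, j) = \<langle>u\<^sub>i, u\<^sub>j\<rangle>\<^sup>2\<close> and let \<open>e i\<close> be the contribution of \<open>u\<^sub>i\<close> to the defect.  When
  \<open>k\<close> vectors are chosen and \<open>S i\<close> is the sum of \<open>g(i, j)\<close> over them, the weights \<open>w i = c\<^sub>i (1 - S i)\<^sup>+\<close>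
  have total at least \<open>n - k \<ge> 1\<close>, and \<open>(1 - S i)\<^sup>+ S i\<close> is at most the sum of \<open>g (1 - g)\<close> over the chosen
  vectors.  Hence some index has \<open>S i + e i\<close> at most the sum of the earlier \<open>e\<close> plus the defect, and
  this total at most doubles in each step.\<close>

lemma almost_orthogonal_system:
  assumes "k \<le> n"
  shows "\<exists>f. (\<forall>i<k. f i \<in> J) \<and> (\<forall>i<k. \<forall>l<i. (ip n (u (f i)) (u (f l)))\<^sup>2 \<le> 2 ^ n * orth_defect)"
proof -
  define g where "g i j = (ip n (u i) (u j))\<^sup>2" for i j
  have g_sym: "g i j = g j i" for i j by (simp add: g_def ip_commute)
  have g01: "0 \<le> g i j" "i \<in> J \<Longrightarrow> j \<in> J \<Longrightarrow> g i j \<le> 1" for i j using ip_u_le_1 by (auto simp: g_def)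
  define e where "e i = (\<Sum>j\<in>J. c j * (g i j * (1 - g i j)))" for i
  have e0: "0 \<le> e i" if "i \<in> J" for i
    unfolding e_def using that g01 c_nonneg by (intro sum_nonneg mult_nonneg_nonneg) auto
  have ce: "(\<Sum>i\<in>J. c i * e i) = orth_defect"
    unfolding e_def orth_defect_def g_def sum_distrib_left by (simp add: mult.assoc)
  define P where "P k f \<longleftrightarrow> (\<forall>i<k. f i \<in> J) \<and> (\<forall>i<k. \<forall>l<i. g (f i) (f l) \<le> 2 ^ n * orth_defect)
      \<and> (\<Sum>i<k. e (f i)) \<le> (2 ^ k - 1) * orth_defect" for k :: nat and f :: "nat \<Rightarrow> 'j"
  have "\<exists>f. P k f" if "k \<le> n" for k
    using that
  proof (induction k)
    case 0
    then show ?case by (auto simp: P_def)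
  next
    case (Suc k)
    then obtain f where f: "P k f" by auto
    have fJ: "f i \<in> J" if "i < k" for i using f that by (auto simp: P_def)
    define S where "S i = (\<Sum>l<k. g i (f l))" for i
    define \<phi> where "\<phi> i = S i + e i" for i
    define w where "w i = c i * max 0 (1 - S i)" for i
    have S0: "0 \<le> S i" for i unfolding S_def using g01 by (intro sum_nonneg) auto
    have w0: "0 \<le> w i" if "i \<in> J" for i using c_nonneg[OF that] by (simp add: w_def)
    have "real n - real k = (\<Sum>i\<in>J. c i) - (\<Sum>l<k. \<Sum>i\<in>J. c i * g i (f l))"
    proof -
      have "(\<Sum>l<k. \<Sum>i\<in>J. c i * g i (f l)) = (\<Sum>l<k. 1)"
      proof (rule sum.cong[OF refl])
        fix l assume "l \<in> {..<k}"
        then have "(\<Sum>i\<in>J. c i * g (f l) i) = 1" unfolding g_def using fJ by (intro frame_unit) auto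
        then show "(\<Sum>i\<in>J. c i * g i (f l)) = 1" by (simp add: g_sym[of _ "f l"])
      qed
      then show ?thesis by (simp add: sum_c)
    qed
    also have "\<dots> = (\<Sum>i\<in>J. c i * (1 - S i))"
      unfolding S_def by (subst sum.swap) (simp add: sum_subtractf sum_distrib_left right_diff_distrib)
    also have "\<dots> \<le> (\<Sum>i\<in>J. w i)"
      unfolding w_def using c_nonneg by (intro sum_mono mult_left_mono) auto
    finally have W: "1 \<le> (\<Sum>i\<in>J. w i)" using Suc.prems by simp
    have "(\<Sum>i\<in>J. w i * S i) \<le> (\<Sum>i\<in>J. \<Sum>l<k. c i * (g (f l) i * (1 - g (f l) i)))"
    proof (rule sum_mono)
      fix i assume i: "i \<in> J"
      have "max 0 (1 - S i) * S i = (\<Sum>l<k. max 0 (1 - S i) * g i (f l))"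
        unfolding S_def by (simp only: sum_distrib_left)
      also have "\<dots> \<le> (\<Sum>l<k. (1 - g i (f l)) * g i (f l))"
      proof (intro sum_mono mult_right_mono)
        fix l assume l: "l \<in> {..<k}"
        have "g i (f l) \<le> S i" unfolding S_def using l g01 by (intro member_le_sum) auto
        then show "max 0 (1 - S i) \<le> 1 - g i (f l)" using g01(2)[OF i fJ[of l]] l by auto
      qed (rule g01)
      finally have "c i * (max 0 (1 - S i) * S i) \<le> c i * (\<Sum>l<k. (1 - g i (f l)) * g i (f l))"
        using c_nonneg[OF i] by (rule mult_left_mono)
      then show "w i * S i \<le> (\<Sum>l<k. c i * (g (f l) i * (1 - g (f l) i)))"
        by (simp add: w_def sum_distrib_left mult.assoc g_sym[of i] mult.commute[of "1 - _"])
    qed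
    also have "\<dots> = (\<Sum>l<k. e (f l))" unfolding e_def by (rule sum.swap)
    also have "\<dots> \<le> (2 ^ k - 1) * orth_defect" using f by (simp add: P_def)
    finally have wS: "(\<Sum>i\<in>J. w i * S i) \<le> (2 ^ k - 1) * orth_defect" .
    have "(\<Sum>i\<in>J. w i * e i) \<le> (\<Sum>i\<in>J. c i * e i)"
    proof (intro sum_mono mult_right_mono)
      fix i assume i: "i \<in> J"
      show "w i \<le> c i" using mult_left_mono[of "max 0 (1 - S i)" 1 "c i"] c_nonneg[OF i] S0[of i] by (simp add: w_def)
    qed (rule e0)
    then have w\<phi>: "(\<Sum>i\<in>J. w i * \<phi> i) \<le> 2 ^ k * orth_defect"
      using wS ce by (simp add: \<phi>_def distrib_left sum.distrib algebra_simps)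
    have "J \<noteq> {}" using W by auto
    then obtain i0 where i0: "i0 \<in> J" and min: "\<And>i. i \<in> J \<Longrightarrow> \<phi> i0 \<le> \<phi> i"
      using arg_min_if_finite[of J \<phi>] finJ by (meson not_le)
    have \<phi>0: "0 \<le> \<phi> i0" using S0 e0[OF i0] by (simp add: \<phi>_def)
    have "\<phi> i0 * 1 \<le> \<phi> i0 * (\<Sum>i\<in>J. w i)" using W \<phi>0 by (rule mult_left_mono)
    also have "\<dots> = (\<Sum>i\<in>J. w i * \<phi> i0)" by (simp add: sum_distrib_left mult.commute)
    also have "\<dots> \<le> (\<Sum>i\<in>J. w i * \<phi> i)" using min w0 by (intro sum_mono mult_left_mono) auto
    finally have \<phi>le: "\<phi> i0 \<le> 2 ^ k * orth_defect" using w\<phi> by simp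
    have pw: "2 ^ k * orth_defect \<le> 2 ^ n * orth_defect"
      using Suc.prems orth_defect_nonneg by (intro mult_right_mono power_increasing) auto
    have new: "g i0 (f l) \<le> 2 ^ n * orth_defect" if "l < k" for l
    proof -
      have "g i0 (f l) \<le> S i0" unfolding S_def using that g01 by (intro member_le_sum) auto
      then show ?thesis using \<phi>le pw e0[OF i0] by (simp add: \<phi>_def)
    qed
    have enew: "e i0 \<le> 2 ^ k * orth_defect" using \<phi>le S0[of i0] by (simp add: \<phi>_def)
    have "P (Suc k) (f(k := i0))"
      unfolding P_def
    proof (intro conjI allI impI)
      fix i assume "i < Suc k"
      then show "(f(k := i0)) i \<in> J" using fJ i0 by (auto simp: less_Suc_eq)
    next
      fix i l assume "i < Suc k" "l < i"
      then show "g ((f(k := i0)) i) ((f(k := i0)) l) \<le> 2 ^ n * orth_defect"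
        using f new by (auto simp: P_def less_Suc_eq)
    next
      have "(\<Sum>i<Suc k. e ((f(k := i0)) i)) = (\<Sum>i<k. e (f i)) + e i0" by simp
      also have "\<dots> \<le> (2 ^ k - 1) * orth_defect + 2 ^ k * orth_defect"
        using f enew by (intro add_mono) (auto simp: P_def)
      also have "\<dots> = (2 ^ Suc k - 1) * orth_defect" by (simp add: algebra_simps)
      finally show "(\<Sum>i<Suc k. e ((f(k := i0)) i)) \<le> (2 ^ Suc k - 1) * orth_defect" .
    qed
    then show ?case by blast
  qed
  then obtain f where "P k f" using assms by blast
  then show ?thesis by (auto simp: P_def g_def)
qed

end

text \<open>Every permutation other than the identity contributes at least two off-diagonal entries.\<close>

lemma dt_almost_identity:
  assumes diag: "\<And>i. i < n \<Longrightarrow> A i i = 1"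
    and off: "\<And>i j. i < n \<Longrightarrow> j < n \<Longrightarrow> i \<noteq> j \<Longrightarrow> \<bar>A i j\<bar> \<le> s" and s: "s \<le> 1"
  shows "1 - fact n * s\<^sup>2 \<le> dt n A"
proof -
  have le1: "\<bar>A i j\<bar> \<le> 1" if "i < n" "j < n" for i j
    using diag off[OF that] s that by (cases "i = j") auto
  have small: "\<bar>\<Prod>i<n. A i (p i)\<bar> \<le> s\<^sup>2" if p: "p permutes {..<n}" "p \<noteq> id" for p
  proof -
    obtain i where pi: "p i \<noteq> i" using p(2) by (auto simp: fun_eq_iff)
    have i: "i < n" using p(1) pi by (meson lessThan_iff permutes_not_in)
    have pin: "p j < n" if "j < n" for j using permutes_in_image[OF p(1), of j] that by simp
    have ppi: "p (p i) \<noteq> p i" using pi permutes_inj[OF p(1)] by (auto dest: injD)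
    have s0: "0 \<le> s" using off[of i "p i"] i pin[OF i] pi by (metis abs_ge_zero order_trans)
    have "\<bar>\<Prod>i<n. A i (p i)\<bar> = (\<Prod>j<n. \<bar>A j (p j)\<bar>)" by (rule abs_prod)
    also have "\<dots> = \<bar>A i (p i)\<bar> * (\<bar>A (p i) (p (p i))\<bar> * (\<Prod>j\<in>{..<n} - {i} - {p i}. \<bar>A j (p j)\<bar>))"
      using i pi pin[OF i] by (subst prod.remove[of _ i], simp, simp, subst prod.remove[of _ "p i"]) auto
    also have "\<dots> \<le> s * (s * 1)"
      using i pi pin s0 ppi le1
      by (intro mult_mono off prod_le_1 mult_nonneg_nonneg prod_nonneg) auto
    finally show ?thesis by (simp add: power2_eq_square)
  qed
  let ?P = "{p. p permutes {..<n}}"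
  have fin: "finite ?P" by (simp add: finite_permutations)
  have "dt n A = (\<Sum>p\<in>?P. of_int (sign p) * (\<Prod>i<n. A i (p i)))" by (rule dt_Leibniz)
  also have "\<dots> = 1 + (\<Sum>p\<in>?P - {id}. of_int (sign p) * (\<Prod>i<n. A i (p i)))"
    using fin diag by (subst sum.remove[of _ id]) (auto simp: permutes_id sign_id)
  finally have eq: "dt n A - 1 = (\<Sum>p\<in>?P - {id}. of_int (sign p) * (\<Prod>i<n. A i (p i)))" by simp
  have "\<bar>dt n A - 1\<bar> \<le> (\<Sum>p\<in>?P - {id}. \<bar>of_int (sign p) * (\<Prod>i<n. A i (p i))\<bar>)"
    unfolding eq by (rule sum_abs)
  also have "\<dots> \<le> (\<Sum>p\<in>?P - {id}. s\<^sup>2)"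
  proof (rule sum_mono)
    fix p assume "p \<in> ?P - {id}"
    then have "\<bar>\<Prod>i<n. A i (p i)\<bar> \<le> s\<^sup>2" using small by auto
    moreover have "\<bar>of_int (sign p) :: real\<bar> = 1" by (simp add: sign_def)
    ultimately show "\<bar>of_int (sign p) * (\<Prod>i<n. A i (p i))\<bar> \<le> s\<^sup>2" by (simp only: abs_mult mult_1)
  qed
  also have "\<dots> = real (card (?P - {id})) * s\<^sup>2" by simp
  also have "\<dots> \<le> fact n * s\<^sup>2"
  proof (rule mult_right_mono)
    have "card (?P - {id}) \<le> card ?P" using fin by (intro card_mono) auto
    also have "card ?P = fact n" using card_permutations[of "{..<n}" n] by simp
    finally show "real (card (?P - {id})) \<le> fact n" by (metis of_nat_fact of_nat_le_iff)
  qed simp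
  finally show ?thesis by linarith
qed

section \<open>Missing a corner of the cube\<close>

text \<open>In the coordinates \<open>y = W x\<close>, the body lies in the cube, and a functional \<open>\<xi>\<close> separates it from the point
  \<open>y0 / \<mu>\<close>.  The maximum of \<open>\<xi>\<close> over the cube is \<open>N = \<Sum>\<^sub>i \<bar>\<xi>\<^sub>i\<bar>\<close>, so \<open>\<xi> < N / \<mu> = N (1 - \<tau>)\<close>
  on the body.  At the corner where the maximum is attained, the small cube of side \<open>\<tau> = 1 - 1/\<mu>\<close> satisfies
  \<open>\<xi> \<ge> N (1 - \<tau>)\<close> and is therefore missed.\<close>

lemma corner_volume_bound:
  assumes K: "compact K" "convex K" "K \<subseteq> Rn n" "0 \<in> K"
    and W: "dt n W \<noteq> 0" and sub: "\<And>x i. x \<in> K \<Longrightarrow> i < n \<Longrightarrow> \<bar>ip n (W i) x\<bar> \<le> 1"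
    and y0: "y0 \<in> cubeset n 1" and q: "q \<in> Rn n" "lin n W q = (\<lambda>i. if i < n then y0 i else 0)"
    and \<mu>: "1 < \<mu>" and qK: "(1 / \<mu>) *\<^sub>R q \<notin> K"
  shows "measure (leb n) K \<le> (2 ^ n - (1 - 1 / \<mu>) ^ n) / \<bar>dt n W\<bar>"
proof -
  define \<tau> where "\<tau> = 1 - 1 / \<mu>"
  have \<tau>: "0 < \<tau>" "\<tau> < 1" using \<mu> by (auto simp: \<tau>_def field_simps)
  obtain v \<delta> where v: "v \<in> Rn n" "0 < \<delta>" "\<And>x. x \<in> K \<Longrightarrow> ip n x v \<le> ip n ((1 / \<mu>) *\<^sub>R q) v - \<delta>"
    using separate_Rn[OF K(1-3), of "(1 / \<mu>) *\<^sub>R q"] q qK K(4) by blast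
  obtain B where B: "\<And>i j. i < n \<Longrightarrow> j < n \<Longrightarrow> mm n W B i j = (if i = j then 1 else 0)"
      "\<And>i j. i < n \<Longrightarrow> j < n \<Longrightarrow> mm n B W i j = (if i = j then 1 else 0)"
    using dt_inverse[OF W] by blast
  define \<xi> where "\<xi> = lin n (\<lambda>i j. B j i) v"
  have ipl: "ip n x v = ip n (lin n W x) \<xi>" if "x \<in> Rn n" for x
  proof -
    have "lin n B (lin n W x) = x" unfolding lin_mm[symmetric] using B(2) that by (intro lin_id) auto
    then have "ip n x v = ip n (lin n B (lin n W x)) v" by simp
    also have "\<dots> = ip n (lin n W x) \<xi>" unfolding \<xi>_def by (rule ip_lin_left)
    finally show ?thesis .
  qed
  define N where "N = (\<Sum>i<n. \<bar>\<xi> i\<bar>)"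
  have qN: "ip n q v \<le> N"
  proof -
    have "ip n q v = (\<Sum>i<n. y0 i * \<xi> i)" using ipl[OF q(1)] unfolding q(2) by (simp add: ip_def)
    also have "\<dots> \<le> (\<Sum>i<n. \<bar>\<xi> i\<bar>)"
    proof (rule sum_mono)
      fix i assume "i \<in> {..<n}"
      then have "\<bar>y0 i\<bar> \<le> 1" using y0 by (auto simp: cubeset_def abs_le_iff minus_le_iff)
      then have "\<bar>y0 i\<bar> * \<bar>\<xi> i\<bar> \<le> 1 * \<bar>\<xi> i\<bar>" by (intro mult_right_mono) auto
      then show "y0 i * \<xi> i \<le> \<bar>\<xi> i\<bar>" using abs_ge_self[of "y0 i * \<xi> i"] by (simp add: abs_mult)
    qed
    finally show ?thesis by (simp add: N_def)
  qed
  have far: "ip n (lin n W x) \<xi> < N * (1 - \<tau>)" if "x \<in> K" for x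
  proof -
    have "ip n (lin n W x) \<xi> < ip n q v / \<mu>"
    proof -
      have "ip n ((1 / \<mu>) *\<^sub>R q) v = ip n q v / \<mu>" by (simp add: ip_scaleR_left)
      moreover have "x \<in> Rn n" using that K(3) by blast
      ultimately show ?thesis using v(2) v(3)[OF that] ipl[of x] by linarith
    qed
    also have "\<dots> \<le> N / \<mu>" using qN \<mu> by (intro divide_right_mono) auto
    finally show ?thesis by (simp add: \<tau>_def)
  qed
  let ?C = "cubeset n 1"
  define a where "a i = (if 0 \<le> \<xi> i then 1 - \<tau> else -1)" for i
  define b where "b i = (if 0 \<le> \<xi> i then 1 else \<tau> - 1)" for i
  define R where "R = {y::nat \<Rightarrow> real. \<forall>i<n. a i \<le> y i \<and> y i \<le> b i}"
  have ab: "-1 \<le> a i" "b i \<le> 1" for i using \<tau> by (simp_all add: a_def b_def)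
  have R_C: "R \<subseteq> ?C"
  proof
    fix y assume "y \<in> R"
    then have "a i \<le> y i \<and> y i \<le> b i" if "i < n" for i using that by (simp add: R_def)
    then have "-1 \<le> y i \<and> y i \<le> 1" if "i < n" for i using ab[of i] that by (meson order_trans)
    then show "y \<in> ?C" by (simp add: cubeset_def)
  qed
  have R_borel [measurable]: "R \<in> sets borel" unfolding R_def by (rule cbox_borel)
  have emR: "emeasure (leb n) R = ennreal (\<tau> ^ n)"
  proof -
    have "emeasure (leb n) R = ennreal (\<Prod>i<n. b i - a i)"
      unfolding R_def using \<tau> by (intro emeasure_leb_cbox) (auto simp: a_def b_def)
    also have "(\<Prod>i<n. b i - a i) = (\<Prod>i<n. \<tau>)" by (intro prod.cong) (auto simp: a_def b_def)
    finally show ?thesis by simp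
  qed
  have notR: "lin n W x \<in> ?C - R" if x: "x \<in> K" for x
  proof -
    have "lin n W x \<notin> R"
    proof
      assume y: "lin n W x \<in> R"
      have "N * (1 - \<tau>) = (\<Sum>i<n. \<bar>\<xi> i\<bar> * (1 - \<tau>))" by (simp add: N_def sum_distrib_right)
      also have "\<dots> \<le> (\<Sum>i<n. lin n W x i * \<xi> i)"
      proof (rule sum_mono)
        fix i assume "i \<in> {..<n}"
        then have yi: "a i \<le> lin n W x i" "lin n W x i \<le> b i" using y by (auto simp: R_def)
        show "\<bar>\<xi> i\<bar> * (1 - \<tau>) \<le> lin n W x i * \<xi> i"
        proof (cases "0 \<le> \<xi> i")
          case True
          then show ?thesis using yi mult_right_mono[of "1 - \<tau>" "lin n W x i" "\<xi> i"] by (simp add: a_def mult.commute)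
        next
          case False
          then show ?thesis using yi mult_right_mono_neg[of "lin n W x i" "\<tau> - 1" "\<xi> i"]
            by (simp add: b_def algebra_simps)
        qed
      qed
      also have "\<dots> = ip n (lin n W x) \<xi>" by (simp add: ip_def)
      finally show False using far[OF x] by simp
    qed
    moreover have "lin n W x \<in> ?C"
      using sub[OF x] by (auto simp: cubeset_def lin_def abs_le_iff minus_le_iff)
    ultimately show ?thesis by blast
  qed
  have C_fin: "emeasure (leb n) ?C = ennreal (2 ^ n)" using emeasure_cubeset[of 1 n] by simp
  have "emeasure (leb n) (?C - R) = emeasure (leb n) ?C - emeasure (leb n) R"
    using R_C by (intro emeasure_Diff) (auto simp: emR)
  also have "\<dots> = ennreal (2 ^ n - \<tau> ^ n)" unfolding C_fin emR using \<tau> by (intro ennreal_minus) auto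
  finally have emD: "emeasure (leb n) (?C - R) = ennreal (2 ^ n - \<tau> ^ n)" .
  have nn: "0 \<le> 2 ^ n - \<tau> ^ n" using power_mono[of \<tau> 2 n] \<tau> by simp
  have mD: "measure (leb n) (?C - R) = 2 ^ n - \<tau> ^ n" using emD nn by (simp add: measure_def)
  have [measurable]: "?C - R \<in> sets borel" by measurable
  have fin: "emeasure (leb n) {x. lin n W x \<in> ?C - R} \<noteq> \<infinity>"
  proof
    assume "emeasure (leb n) {x. lin n W x \<in> ?C - R} = \<infinity>"
    then have "ennreal (2 ^ n - \<tau> ^ n) = ennreal \<bar>dt n W\<bar> * \<infinity>"
      using emeasure_leb_lin[of "?C - R" n W] W emD by simp
    then show False using W by (simp add: ennreal_mult_top)
  qed
  have K_borel: "K \<in> sets borel" using K(1) by (intro borel_closed compact_imp_closed)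
  have pre: "{x. lin n W x \<in> ?C - R} \<in> sets borel"
    using measurable_sets[OF lin_measurable \<open>?C - R \<in> sets borel\<close>, of n W] by (simp add: vimage_def)
  have "measure (leb n) K \<le> measure (leb n) {x. lin n W x \<in> ?C - R}"
    using notR fin pre K_borel by (intro measure_mono_fmeasurable fmeasurableI) (auto simp: less_top)
  also have "\<dots> = (2 ^ n - \<tau> ^ n) / \<bar>dt n W\<bar>"
    using measure_leb_lin[OF _ W, of "?C - R"] mD by simp
  finally show ?thesis by (simp add: \<tau>_def)
qed

section \<open>Surface area\<close>

definition trunc :: "nat \<Rightarrow> (nat \<Rightarrow> real) \<Rightarrow> (nat \<Rightarrow> real)"
  where "trunc n x = (\<lambda>i. if i < n then x i else 0)"

text \<open>The Minkowski gauge, computed on the first \<open>n\<close> coordinates so that it is defined on the whole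
  space of \<open>leb n\<close>.\<close>

definition gauge_of :: "nat \<Rightarrow> (nat \<Rightarrow> real) set \<Rightarrow> (nat \<Rightarrow> real) \<Rightarrow> real"
  where "gauge_of n L x = Inf {s. 0 < s \<and> (1 / s) *\<^sub>R trunc n x \<in> L}"

definition parallel_body :: "nat \<Rightarrow> (nat \<Rightarrow> real) set \<Rightarrow> real \<Rightarrow> (nat \<Rightarrow> real) set"
  where "parallel_body n K t = {x + t *\<^sub>R u | x u. x \<in> K \<and> u \<in> ball1 n}"

lemma trunc_Rn [simp]: "trunc n x \<in> Rn n"
  by (simp add: trunc_def mem_Rn)

lemma trunc_id: "x \<in> Rn n \<Longrightarrow> trunc n x = x"
  by (auto simp: trunc_def mem_Rn fun_eq_iff)

lemma lin_scale: "lin n (\<lambda>i j. c * (if i = j then 1 else 0)) x = c *\<^sub>R trunc n x"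
proof
  fix i
  have "(\<Sum>j<n. (c * (if i = j then 1 else 0)) * x j) = (\<Sum>j<n. if i = j then c * x j else 0)"
    by (intro sum.cong) auto
  then show "lin n (\<lambda>i j. c * (if i = j then 1 else 0)) x i = (c *\<^sub>R trunc n x) i"
    by (simp add: lin_def ip_def trunc_def)
qed

lemma emeasure_leb_scale:
  assumes "0 < s" "S \<in> sets borel"
  shows "emeasure (leb n) {x. (1 / s) *\<^sub>R trunc n x \<in> S} = ennreal (s ^ n) * emeasure (leb n) S"
proof -
  let ?A = "\<lambda>i j. (1 / s) * (if i = j then 1 else (0::real))"
  have dA: "dt n ?A = (1 / s) ^ n" by (simp only: dt_smult dt_id mult_1_right)
  then have "emeasure (leb n) S = ennreal ((1 / s) ^ n) * emeasure (leb n) {x. (1 / s) *\<^sub>R trunc n x \<in> S}"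
    using emeasure_leb_lin[of S n ?A] assms unfolding dA lin_scale by simp
  then have "ennreal (s ^ n) * emeasure (leb n) S
      = ennreal (s ^ n * (1 / s) ^ n) * emeasure (leb n) {x. (1 / s) *\<^sub>R trunc n x \<in> S}"
    using assms by (simp add: ennreal_mult mult.assoc)
  also have "s ^ n * (1 / s) ^ n = 1" using assms by (simp add: power_mult_distrib[symmetric])
  finally show ?thesis by (simp only: ennreal_1 mult_1_left)
qed

text \<open>Write \<open>exp (- g x)\<close> as the integral of \<open>exp (- s)\<close> over \<open>s \<ge> g x\<close> and exchange the integrals; what
  remains is the Gamma integral of \<open>s\<^sup>n exp (- s)\<close>.\<close>

lemma nn_integral_exp_gauge:
  assumes [measurable]: "g \<in> borel_measurable borel" and g0: "\<And>x. 0 \<le> g x"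
    and hom: "\<And>s. 0 < s \<Longrightarrow> emeasure (leb n) {x. g x \<le> s} = ennreal (s ^ n) * v"
  shows "(\<integral>\<^sup>+x. ennreal (exp (- g x)) \<partial>leb n) = ennreal (fact n) * v"
proof -
  interpret sigma_finite_measure "leb n" by (rule sigma_finite_leb)
  interpret P: pair_sigma_finite "leb n" "lborel :: real measure" ..
  define f where "f x s = (ennreal (exp (- s)) * indicator {0..} s) *
      (indicator {p. g (fst p) \<le> snd p} (x, s) :: ennreal)" for x :: "nat \<Rightarrow> real" and s :: real
  have "Measurable.pred (leb n \<Otimes>\<^sub>M lborel) (\<lambda>p. g (fst p) \<le> snd p)" by measurable
  then have [measurable]: "{p. g (fst p) \<le> snd p} \<in> sets (leb n \<Otimes>\<^sub>M (lborel :: real measure))"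
    by (simp add: pred_def space_pair_measure)
  have meas: "case_prod f \<in> borel_measurable (leb n \<Otimes>\<^sub>M lborel)"
    unfolding f_def[abs_def] by measurable
  have inner: "(\<integral>\<^sup>+s. f x s \<partial>lborel) = ennreal (exp (- g x))" for x
  proof -
    have "f x s = ennreal (exp (- s)) * indicator {g x..} s" for s
      unfolding f_def using g0[of x] by (auto simp: indicator_def)
    then have "(\<integral>\<^sup>+s. f x s \<partial>lborel) = (\<integral>\<^sup>+s. ennreal (exp (- s)) * indicator {g x..} s \<partial>lborel)"
      by simp
    also have "\<dots> = ennreal (0 - (- exp (- g x)))"
    proof (rule nn_integral_FTC_atLeast)
      show "((\<lambda>s. - exp (- s)) has_real_derivative exp (- s)) (at s)" for s :: real
        by (auto intro!: derivative_eq_intros)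
      have "((\<lambda>s::real. exp (- s)) \<longlongrightarrow> 0) at_top"
        by (rule filterlim_compose[OF exp_at_bot filterlim_uminus_at_bot_at_top])
      then show "((\<lambda>s::real. - exp (- s)) \<longlongrightarrow> 0) at_top" using tendsto_minus by fastforce
    qed auto
    finally show ?thesis by simp
  qed
  have "(\<integral>\<^sup>+x. ennreal (exp (- g x)) \<partial>leb n) = (\<integral>\<^sup>+x. (\<integral>\<^sup>+s. f x s \<partial>lborel) \<partial>leb n)"
    unfolding inner ..
  also have "\<dots> = (\<integral>\<^sup>+s. (\<integral>\<^sup>+x. f x s \<partial>leb n) \<partial>lborel)"
    by (rule P.Fubini'[symmetric, OF meas])
  also have "\<dots> = (\<integral>\<^sup>+s. (ennreal (s ^ n * exp (- s)) * indicator {0..} s) * v \<partial>lborel)"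
  proof (rule nn_integral_cong_AE)
    show "AE s in lborel. (\<integral>\<^sup>+x. f x s \<partial>leb n) = (ennreal (s ^ n * exp (- s)) * indicator {0..} s) * v"
      using AE_lborel_singleton[of 0]
    proof eventually_elim
      fix s :: real assume s: "s \<noteq> 0"
      have f: "f x s = (ennreal (exp (- s)) * indicator {0..} s) * indicator {x. g x \<le> s} x" for x
        unfolding f_def by (auto simp: indicator_def)
      have "{x \<in> space borel. g x \<le> s} \<in> sets borel" by measurable
      then have [measurable]: "{x. g x \<le> s} \<in> sets borel" by simp
      have "(\<integral>\<^sup>+x. f x s \<partial>leb n) = (ennreal (exp (- s)) * indicator {0..} s) * emeasure (leb n) {x. g x \<le> s}"
        unfolding f by (rule nn_integral_cmult_indicator) simp
      also have "\<dots> = (ennreal (s ^ n * exp (- s)) * indicator {0..} s) * v"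
      proof (cases "0 < s")
        case True
        then show ?thesis by (simp add: hom ennreal_mult mult_ac)
      next
        case False
        then show ?thesis using s by simp
      qed
      finally show "(\<integral>\<^sup>+x. f x s \<partial>leb n) = (ennreal (s ^ n * exp (- s)) * indicator {0..} s) * v" .
    qed
  qed
  also have "\<dots> = ennreal (fact n) * v"
    by (subst nn_integral_multc) (simp_all add: nn_intergal_power_times_exp_Ici)
  finally show ?thesis .
qed

locale body =
  fixes n :: nat and L :: "(nat \<Rightarrow> real) set" and r :: real
  assumes comp: "compact L" and conv: "convex L" and LRn: "L \<subseteq> Rn n" and r: "0 < r"
    and ball: "\<And>x. x \<in> Rn n \<Longrightarrow> ip n x x \<le> r\<^sup>2 \<Longrightarrow> x \<in> L"
begin

lemma zero_L: "0 \<in> L" by (rule ball) auto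

lemma L_borel [measurable]: "L \<in> sets borel" by (intro borel_closed compact_imp_closed comp)

lemma shrink: "x \<in> L \<Longrightarrow> 0 \<le> a \<Longrightarrow> a \<le> 1 \<Longrightarrow> a *\<^sub>R x \<in> L"
  using convexD_alt[OF conv zero_L, of x a] by simp

definition gs :: "(nat \<Rightarrow> real) \<Rightarrow> real set" where "gs x = {s. 0 < s \<and> (1 / s) *\<^sub>R trunc n x \<in> L}"

lemma gauge_gs: "gauge_of n L x = Inf (gs x)" by (simp add: gauge_of_def gs_def)

lemma gs_bdd: "bdd_below (gs x)" by (auto simp: gs_def intro!: bdd_belowI[of _ 0])

lemma gs_nonempty: "gs x \<noteq> {}"
proof -
  define q where "q = sqrt (ip n (trunc n x) (trunc n x))"
  have q: "0 \<le> q" "q\<^sup>2 = ip n (trunc n x) (trunc n x)" by (auto simp: q_def)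
  define s where "s = q / r + 1"
  have s: "0 < s" using q r by (simp add: s_def add_nonneg_pos)
  have "q \<le> s * r" using r by (simp add: s_def field_simps)
  then have "q\<^sup>2 \<le> (s * r)\<^sup>2" using q by (intro power_mono) auto
  then have "ip n ((1 / s) *\<^sub>R trunc n x) ((1 / s) *\<^sub>R trunc n x) \<le> r\<^sup>2"
    using s by (simp add: ip_scaleR_left ip_scaleR_right q(2)[symmetric] power2_eq_square field_simps)
  then have "(1 / s) *\<^sub>R trunc n x \<in> L" by (intro ball) auto
  then have "s \<in> gs x" using s by (simp add: gs_def)
  then show ?thesis by blast
qed

lemma gauge_nonneg: "0 \<le> gauge_of n L x"
  unfolding gauge_gs by (rule cInf_greatest[OF gs_nonempty]) (simp add: gs_def)

lemma gauge_le: "0 < s \<Longrightarrow> (1 / s) *\<^sub>R trunc n x \<in> L \<Longrightarrow> gauge_of n L x \<le> s"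
  unfolding gauge_gs by (rule cInf_lower[OF _ gs_bdd]) (simp add: gs_def)

lemma gauge_less: "gauge_of n L x < s \<Longrightarrow> (1 / s) *\<^sub>R trunc n x \<in> L"
proof -
  assume "gauge_of n L x < s"
  then obtain s' where s': "s' \<in> gs x" "s' < s"
    unfolding gauge_gs using cInf_less_iff[OF gs_nonempty gs_bdd] by blast
  then have pos: "0 < s'" and L: "(1 / s') *\<^sub>R trunc n x \<in> L" by (auto simp only: gs_def mem_Collect_eq)
  have "(s' / s) *\<^sub>R ((1 / s') *\<^sub>R trunc n x) \<in> L" using pos s'(2) by (intro shrink L) simp_all
  moreover have "s' / s * (1 / s') = 1 / s" using pos by simp
  ultimately show ?thesis by (simp only: scaleR_scaleR)
qed

lemma gauge_le_iff:
  assumes s: "0 < s"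
  shows "gauge_of n L x \<le> s \<longleftrightarrow> (1 / s) *\<^sub>R trunc n x \<in> L"
proof
  assume le: "gauge_of n L x \<le> s"
  define f where "f k = (1 / (s + inverse (real (Suc k)))) *\<^sub>R trunc n x" for k :: nat
  have "f k \<in> L" for k
  proof -
    have "0 < inverse (real (Suc k))" by simp
    then have "gauge_of n L x < s + inverse (real (Suc k))" using le by linarith
    then show ?thesis unfolding f_def by (rule gauge_less)
  qed
  moreover have "f \<longlonglongrightarrow> (1 / s) *\<^sub>R trunc n x"
  proof -
    have lim: "(\<lambda>k. 1 / (s + inverse (real (Suc k)))) \<longlonglongrightarrow> 1 / (s + 0)"
      using s by (intro tendsto_intros LIMSEQ_inverse_real_of_nat) auto
    have cont: "continuous_on UNIV (\<lambda>c::real. c *\<^sub>R trunc n x)"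
    proof (rule continuous_on_coordinatewise_then_product)
      show "continuous_on UNIV (\<lambda>c::real. (c *\<^sub>R trunc n x) i)" for i
        unfolding scaleR_fun_def by (intro continuous_intros)
    qed
    have "(\<lambda>k. (1 / (s + inverse (real (Suc k)))) *\<^sub>R trunc n x) \<longlonglongrightarrow> (1 / (s + 0)) *\<^sub>R trunc n x"
      by (rule continuous_on_tendsto_compose[OF cont lim]) auto
    then show ?thesis unfolding f_def by simp
  qed
  ultimately show "(1 / s) *\<^sub>R trunc n x \<in> L"
    using closed_sequentially[OF compact_imp_closed[OF comp]] by blast
qed (rule gauge_le[OF s])

lemma trunc_scale_measurable [measurable]: "(\<lambda>x. c *\<^sub>R trunc n x) \<in> borel \<rightarrow>\<^sub>M borel"
  unfolding lin_scale[symmetric] by (rule lin_measurable)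

lemma gauge_measurable [measurable]: "gauge_of n L \<in> borel_measurable borel"
proof (rule borel_measurableI_le)
  fix a :: real
  have pos: "{x \<in> space borel. gauge_of n L x \<le> s} \<in> sets borel" if s: "0 < s" for s
  proof -
    have "(\<lambda>x. (1 / s) *\<^sub>R trunc n x) -` L \<inter> space borel \<in> sets borel" by (rule measurable_sets) measurable
    also have "(\<lambda>x. (1 / s) *\<^sub>R trunc n x) -` L \<inter> space borel = {x \<in> space borel. gauge_of n L x \<le> s}"
      by (auto simp: gauge_le_iff[OF s])
    finally show ?thesis .
  qed
  consider "a < 0" | "a = 0" | "0 < a" by linarith
  then show "{x \<in> space borel. gauge_of n L x \<le> a} \<in> sets borel"
  proof cases
    case 1
    then have "{x \<in> space borel. gauge_of n L x \<le> a} = {}" using gauge_nonneg by (auto simp: not_le intro: less_le_trans)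
    then show ?thesis by simp
  next
    case 2
    have "{x \<in> space borel. gauge_of n L x \<le> a} = (\<Inter>k. {x \<in> space borel. gauge_of n L x \<le> inverse (real (Suc k))})"
    proof (intro equalityI subsetI)
      fix x assume x: "x \<in> (\<Inter>k. {x \<in> space borel. gauge_of n L x \<le> inverse (real (Suc k))})"
      have "gauge_of n L x \<le> 0"
        by (rule LIMSEQ_le_const[OF LIMSEQ_inverse_real_of_nat]) (use x in auto)
      then show "x \<in> {x \<in> space borel. gauge_of n L x \<le> a}" using 2 by simp
    qed (auto simp: 2 intro: order_trans)
    also have "\<dots> \<in> sets borel"
    proof (rule sets.countable_INT)
      have "{x \<in> space borel. gauge_of n L x \<le> inverse (real (Suc k))} \<in> sets borel" for k by (rule pos) simp
      then show "range (\<lambda>k. {x \<in> space borel. gauge_of n L x \<le> inverse (real (Suc k))}) \<subseteq> sets borel" by blast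
    qed simp
    finally show ?thesis .
  qed (rule pos)
qed

lemma emeasure_gauge: "0 < s \<Longrightarrow> emeasure (leb n) {x. gauge_of n L x \<le> s} = ennreal (s ^ n) * emeasure (leb n) L"
  by (simp add: gauge_le_iff emeasure_leb_scale)

lemma emeasure_L_finite: "emeasure (leb n) L < \<infinity>"
proof -
  have "\<exists>R. \<forall>x\<in>L. ip n x x \<le> R"
  proof -
    have "continuous_on L (\<lambda>x. ip n x x)" by (intro continuous_ip continuous_on_id)
    then obtain y where "\<And>x. x \<in> L \<Longrightarrow> ip n x x \<le> ip n y y"
      using continuous_attains_sup[OF comp] zero_L by blast
    then show ?thesis by blast
  qed
  then obtain R where R: "\<And>x. x \<in> L \<Longrightarrow> ip n x x \<le> R" by blast
  have "L \<subseteq> {x. \<forall>i<n. - (R + 1) \<le> x i \<and> x i \<le> R + 1}"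
  proof (intro subsetI CollectI allI impI)
    fix x i assume x: "x \<in> L" "i < n"
    have R0: "0 \<le> R" using R[OF x(1)] ip_self_nonneg[of n x] by linarith
    have "(x i)\<^sup>2 \<le> (R + 1)\<^sup>2"
      using abs_coord_le[OF x(2), of x] R[OF x(1)] R0 by (simp add: power2_eq_square algebra_simps) (smt (verit) mult_nonneg_nonneg)
    then have "\<bar>x i\<bar> \<le> R + 1" using R0 abs_le_square_iff[of "x i" "R + 1"] by simp
    then show "- (R + 1) \<le> x i \<and> x i \<le> R + 1" by linarith
  qed
  then have "emeasure (leb n) L \<le> emeasure (leb n) {x. \<forall>i<n. - (R + 1) \<le> x i \<and> x i \<le> R + 1}"
    by (rule emeasure_mono) simp
  also have "\<dots> < \<infinity>"
  proof -
    have "0 \<le> R" using R[OF zero_L] by simp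
    then show ?thesis by (subst emeasure_leb_cbox) auto
  qed
  finally show ?thesis .
qed

lemma nn_integral_exp_gauge_L:
  assumes "0 < a"
  shows "(\<integral>\<^sup>+x. ennreal (exp (- (a * gauge_of n L x))) \<partial>leb n) = ennreal (fact n) * (ennreal ((1 / a) ^ n) * emeasure (leb n) L)"
proof (rule nn_integral_exp_gauge)
  fix s :: real assume s: "0 < s"
  have "{x. a * gauge_of n L x \<le> s} = {x. gauge_of n L x \<le> s / a}" using assms by (auto simp: field_simps)
  then have "emeasure (leb n) {x. a * gauge_of n L x \<le> s} = ennreal ((s / a) ^ n) * emeasure (leb n) L"
    using s assms by (simp add: emeasure_gauge)
  also have "(s / a) ^ n = s ^ n * (1 / a) ^ n" by (simp add: power_divide)
  finally show "emeasure (leb n) {x. a * gauge_of n L x \<le> s} = ennreal (s ^ n) * (ennreal ((1 / a) ^ n) * emeasure (leb n) L)"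
    using s assms by (simp add: ennreal_mult mult.assoc)
qed (use assms gauge_nonneg in auto)

lemma integrable_exp_gauge: "0 < a \<Longrightarrow> integrable (leb n) (\<lambda>x. exp (- (a * gauge_of n L x)))"
proof (rule integrableI_nonneg)
  assume a: "0 < a"
  show "(\<integral>\<^sup>+x. ennreal (exp (- (a * gauge_of n L x))) \<partial>leb n) < \<infinity>"
    unfolding nn_integral_exp_gauge_L[OF a] using emeasure_L_finite by (auto simp: ennreal_mult_less_top)
qed auto

lemma integral_exp_gauge: "(\<integral>x. exp (- gauge_of n L x) \<partial>leb n) = fact n * measure (leb n) L"
proof -
  have "(\<integral>x. exp (- gauge_of n L x) \<partial>leb n) = enn2real (\<integral>\<^sup>+x. ennreal (exp (- gauge_of n L x)) \<partial>leb n)"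
    by (rule integral_eq_nn_integral) auto
  also have "\<dots> = fact n * measure (leb n) L"
    using nn_integral_exp_gauge_L[of 1] by (simp add: enn2real_mult measure_def)
  finally show ?thesis .
qed

lemma compact_parallel: "compact (parallel_body n L t)"
proof -
  have "closed (ball1 n)" 
  proof -
    have "ball1 n = Rn n \<inter> {x. ip n x x \<le> 1}" by (auto simp: ball1_def)
    also have "closed \<dots>"
      by (intro closed_Int closed_Rn closed_Collect_le continuous_ip continuous_on_const continuous_on_id)
    finally show ?thesis .
  qed
  moreover have "\<bar>x i\<bar> \<le> (if i < n then 1 else 0)" if "x \<in> ball1 n" for x i
  proof (cases "i < n")
    case True
    then have "(x i)\<^sup>2 \<le> 1" using abs_coord_le[of i n x] that by (auto simp: ball1_def)
    then show ?thesis using True by (simp add: abs_square_le_1)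
  qed (use that in \<open>auto simp: ball1_def mem_Rn\<close>)
  ultimately have B: "compact (ball1 n)" by (rule compact_box_subset)
  let ?f = "\<lambda>z::(nat \<Rightarrow> real) \<times> (nat \<Rightarrow> real). fst z + t *\<^sub>R snd z"
  have "continuous_on (L \<times> ball1 n) ?f"
  proof (rule continuous_on_coordinatewise_then_product)
    fix i
    have 1: "continuous_on (L \<times> ball1 n) (\<lambda>z. fst z i)"
      by (rule continuous_on_product_then_coordinatewise, rule continuous_on_fst, rule continuous_on_id)
    have 2: "continuous_on (L \<times> ball1 n) (\<lambda>z. snd z i)"
      by (rule continuous_on_product_then_coordinatewise, rule continuous_on_snd, rule continuous_on_id)
    have "continuous_on (L \<times> ball1 n) (\<lambda>z. fst z i + t * snd z i)"
      by (intro continuous_on_add continuous_on_mult continuous_on_const 1 2)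
    then show "continuous_on (L \<times> ball1 n) (\<lambda>z. (fst z + t *\<^sub>R snd z) i)"
      by (simp only: plus_fun_apply scaleR_fun_apply real_scaleR_def)
  qed
  then have "compact (?f ` (L \<times> ball1 n))" by (rule compact_continuous_image) (intro compact_Times comp B)
  also have "?f ` (L \<times> ball1 n) = parallel_body n L t"
    by (force simp: parallel_body_def image_iff)
  finally show ?thesis .
qed

lemma ball1_convex_combination:
  assumes "u \<in> ball1 n" "v \<in> ball1 n" "0 \<le> a" "a \<le> 1"
  shows "(1 - a) *\<^sub>R u + a *\<^sub>R v \<in> ball1 n"
proof -
  have uv: "ip n u v \<le> 1"
  proof -
    have "0 \<le> ip n (u - v) (u - v)" by simp
    then have "2 * ip n u v \<le> ip n u u + ip n v v" by (simp add: ip_simps ip_commute[of n v u])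
    then show ?thesis using assms by (simp add: ball1_def)
  qed
  have "ip n ((1 - a) *\<^sub>R u + a *\<^sub>R v) ((1 - a) *\<^sub>R u + a *\<^sub>R v)
      = (1 - a)\<^sup>2 * ip n u u + 2 * (1 - a) * a * ip n u v + a\<^sup>2 * ip n v v"
    by (simp add: ip_simps ip_commute[of n v u] power2_eq_square algebra_simps)
  also have "\<dots> \<le> (1 - a)\<^sup>2 * 1 + 2 * (1 - a) * a * 1 + a\<^sup>2 * 1"
    using assms uv by (intro add_mono mult_left_mono) (auto simp: ball1_def)
  also have "\<dots> = 1" by (simp add: power2_eq_square algebra_simps)
  finally show ?thesis using assms by (auto simp: ball1_def)
qed

text \<open>Parallel bodies form a concave family in \<open>t\<close>.\<close>

lemma parallel_interpolate:
  assumes "x \<in> parallel_body n L s" "y \<in> parallel_body n L t" "0 \<le> a" "a \<le> 1" "0 \<le> s" "0 \<le> t"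
  shows "(1 - a) *\<^sub>R x + a *\<^sub>R y \<in> parallel_body n L ((1 - a) * s + a * t)"
proof -
  obtain x' u y' v where x: "x = x' + s *\<^sub>R u" "x' \<in> L" "u \<in> ball1 n" and y: "y = y' + t *\<^sub>R v" "y' \<in> L" "v \<in> ball1 n"
    using assms unfolding parallel_body_def by blast
  define m where "m = (1 - a) * s + a * t"
  have m0: "0 \<le> m" using assms by (simp add: m_def)
  have L: "(1 - a) *\<^sub>R x' + a *\<^sub>R y' \<in> L" using x y assms conv by (intro convexD) auto
  have eq: "(1 - a) *\<^sub>R x + a *\<^sub>R y = ((1 - a) *\<^sub>R x' + a *\<^sub>R y') + (((1 - a) * s) *\<^sub>R u + (a * t) *\<^sub>R v)"
    by (simp add: x y fun_eq_iff algebra_simps)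
  show ?thesis
  proof (cases "m = 0")
    case True
    have z: "(1 - a) * s = 0" "a * t = 0"
      using True assms mult_nonneg_nonneg[of "1 - a" s] mult_nonneg_nonneg[of a t] by (auto simp: m_def add_nonneg_eq_0_iff)
    then have "(1 - a) *\<^sub>R x + a *\<^sub>R y = ((1 - a) *\<^sub>R x' + a *\<^sub>R y') + m *\<^sub>R u" unfolding eq True z by simp
    then show ?thesis unfolding parallel_body_def m_def[symmetric] using L x(3) by blast
  next
    case False
    then have m: "0 < m" using m0 by simp
    define b where "b = a * t / m"
    have as: "(1 - a) * s = m - a * t" by (simp add: m_def)
    have "0 \<le> (1 - a) * s" using assms by simp
    then have "a * t \<le> m" unfolding as by simp
    then have b: "0 \<le> b" "b \<le> 1" using assms m by (simp_all add: b_def)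
    have b3: "1 - b = (1 - a) * s / m" unfolding as b_def using m by (simp add: diff_divide_distrib)
    have "((1 - a) * s) *\<^sub>R u + (a * t) *\<^sub>R v = m *\<^sub>R ((1 - b) *\<^sub>R u + b *\<^sub>R v)"
      unfolding b3 unfolding b_def using m by (simp add: fun_eq_iff distrib_left)
    then have "(1 - a) *\<^sub>R x + a *\<^sub>R y = ((1 - a) *\<^sub>R x' + a *\<^sub>R y') + m *\<^sub>R ((1 - b) *\<^sub>R u + b *\<^sub>R v)"
      unfolding eq by simp
    then show ?thesis unfolding parallel_body_def m_def[symmetric]
      using L ball1_convex_combination[OF x(3) y(3) b(1,2)] by blast
  qed
qed

lemma parallel_0: "parallel_body n L 0 = L"
  by (force simp: parallel_body_def ball1_def)

lemma parallel_mono: "0 \<le> s \<Longrightarrow> s \<le> t \<Longrightarrow> parallel_body n L s \<subseteq> parallel_body n L t"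
proof
  fix x assume s: "0 \<le> s" "s \<le> t" and "x \<in> parallel_body n L s"
  then obtain y u where x: "x = y + s *\<^sub>R u" "y \<in> L" "u \<in> ball1 n" unfolding parallel_body_def by blast
  show "x \<in> parallel_body n L t"
  proof (cases "t = 0")
    case True
    then show ?thesis using s x unfolding parallel_body_def by auto
  next
    case False
    then have t: "0 < t" using s by simp
    have "(s / t) *\<^sub>R u \<in> ball1 n"
      using ball1_convex_combination[of 0 u "s / t"] x(3) s t by (auto simp: ball1_def)
    moreover have "x = y + t *\<^sub>R ((s / t) *\<^sub>R u)" using x t by simp
    ultimately show ?thesis unfolding parallel_body_def using x by blast
  qed
qed

lemma parallel_body: "0 \<le> t \<Longrightarrow> body n (parallel_body n L t) r"
proof
  assume t: "0 \<le> t"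
  show "compact (parallel_body n L t)" by (rule compact_parallel)
  show "convex (parallel_body n L t)"
  proof (rule convexI)
    fix x y a b assume xy: "x \<in> parallel_body n L t" "y \<in> parallel_body n L t" and ab: "(0::real) \<le> a" "0 \<le> b" "a + b = 1"
    have a: "a = 1 - b" using ab by simp
    show "a *\<^sub>R x + b *\<^sub>R y \<in> parallel_body n L t"
      using parallel_interpolate[OF xy, of b] ab t unfolding a by (simp add: algebra_simps)
  qed
  show "parallel_body n L t \<subseteq> Rn n" using LRn by (auto simp: parallel_body_def ball1_def)
  show "0 < r" by (rule r)
  fix x assume "x \<in> Rn n" "ip n x x \<le> r\<^sup>2"
  then have "x \<in> L" by (rule ball)
  then show "x \<in> parallel_body n L t" using parallel_mono[of 0 t] t parallel_0 by auto
qed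

text \<open>Since \<open>r B \<subseteq> L\<close>, the parallel body \<open>L + t B\<close> lies in \<open>(1 + t / r) L\<close>.\<close>

lemma parallel_outer: "0 \<le> t \<Longrightarrow> y \<in> parallel_body n L t \<Longrightarrow> (1 / (1 + t / r)) *\<^sub>R y \<in> L"
proof -
  assume t: "0 \<le> t" and "y \<in> parallel_body n L t"
  then obtain x u where y: "y = x + t *\<^sub>R u" "x \<in> L" "u \<in> ball1 n" unfolding parallel_body_def by blast
  define a where "a = (t / r) / (1 + t / r)"
  have q: "0 < 1 + t / r" using t r by (simp add: add_pos_nonneg)
  have a3: "1 - a = 1 / (1 + t / r)"
  proof -
    have "1 - a = ((1 + t / r) - t / r) / (1 + t / r)" unfolding a_def diff_divide_distrib using q by simp
    then show ?thesis by simp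
  qed
  have "0 \<le> 1 / (1 + t / r)" using q by simp
  then have a: "0 \<le> a" "a \<le> 1" using t r q a3 by (simp add: a_def, linarith)
  have "ip n (r *\<^sub>R u) (r *\<^sub>R u) = r\<^sup>2 * ip n u u" by (simp add: ip_scaleR_left ip_scaleR_right power2_eq_square)
  also have "\<dots> \<le> r\<^sup>2 * 1" using y(3) by (intro mult_left_mono) (auto simp: ball1_def)
  finally have ru: "r *\<^sub>R u \<in> L" using y(3) by (intro ball) (auto simp: ball1_def)
  have "(1 - a) *\<^sub>R x + a *\<^sub>R (r *\<^sub>R u) \<in> L" by (rule convexD[OF conv y(2) ru]) (use a in simp_all)
  moreover have ar: "a * r = (1 - a) * t" unfolding a3 unfolding a_def using r by simp
  have "(1 - a) *\<^sub>R x + a *\<^sub>R (r *\<^sub>R u) = (1 - a) *\<^sub>R y"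
    by (simp only: y(1) scaleR_right_distrib scaleR_scaleR ar)
  ultimately show ?thesis unfolding a3 by simp
qed

text \<open>Volume is differentiated through this gauge, which for fixed \<open>x\<close> decreases in \<open>t\<close> and lies below its
  chords from \<open>t = 0\<close>.\<close>

definition p :: "real \<Rightarrow> (nat \<Rightarrow> real) \<Rightarrow> real" where "p t = gauge_of n (parallel_body n L t)"

lemma p_nonneg: "0 \<le> t \<Longrightarrow> 0 \<le> p t x"
  unfolding p_def by (rule body.gauge_nonneg[OF parallel_body])

lemma p_mono: "0 < t \<Longrightarrow> p t x \<le> p 0 x"
proof -
  assume t: "0 < t"
  interpret P0: body n "parallel_body n L 0" r by (rule parallel_body) simp
  interpret Pt: body n "parallel_body n L t" r using t by (intro parallel_body) simp
  show ?thesis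
  proof (rule field_le_epsilon)
    fix e :: real assume e: "0 < e"
    have "(1 / (p 0 x + e)) *\<^sub>R trunc n x \<in> parallel_body n L 0" unfolding p_def using e by (intro P0.gauge_less) simp
    then have "(1 / (p 0 x + e)) *\<^sub>R trunc n x \<in> parallel_body n L t" using parallel_mono[of 0 t] t by auto
    then show "p t x \<le> p 0 x + e" unfolding p_def using e P0.gauge_nonneg[of x]
      by (intro Pt.gauge_le) (auto simp: p_def add_nonneg_pos)
  qed
qed

text \<open>The point \<open>x\<close> lies in \<open>A L\<close> and in \<open>B (L + t U)\<close>, \<open>U\<close> the unit ball, for \<open>A\<close> and \<open>B\<close> slightly above the two gauges.  Writing
  \<open>x / C\<close> with \<open>C = (1 - a) A + a B\<close> as a convex combination of \<open>x / A\<close> and \<open>x / B\<close>, the second point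
  gets the weight \<open>m = a B / C \<le> a\<close>, and \<open>parallel_interpolate\<close> applies.\<close>

lemma p_interpolate:
  assumes t: "0 < t" and a: "0 \<le> a" "a \<le> 1"
  shows "p (a * t) x \<le> (1 - a) * p 0 x + a * p t x"
proof (rule field_le_epsilon)
  fix e :: real assume e: "0 < e"
  interpret P0: body n "parallel_body n L 0" r by (rule parallel_body) simp
  interpret Pt: body n "parallel_body n L t" r using t by (intro parallel_body) simp
  interpret Pa: body n "parallel_body n L (a * t)" r using t a by (intro parallel_body) simp
  define A where "A = p 0 x + e"
  define B where "B = p t x + e"
  have AB: "0 < A" "0 < B" "B \<le> A" using e p_nonneg[of 0 x] p_nonneg[of t x] t p_mono[OF t, of x] by (auto simp: A_def B_def)
  have inA: "(1 / A) *\<^sub>R trunc n x \<in> parallel_body n L 0"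
    unfolding A_def p_def using e by (intro P0.gauge_less) simp
  have inB: "(1 / B) *\<^sub>R trunc n x \<in> parallel_body n L t"
    unfolding B_def p_def using e by (intro Pt.gauge_less) simp
  define C where "C = (1 - a) * A + a * B"
  have C: "0 < C"
  proof -
    have "B \<le> C" unfolding C_def using AB a mult_left_mono[of B A "1 - a"] by (simp add: algebra_simps)
    then show ?thesis using AB by simp
  qed
  define m where "m = a * B / C"
  have BC: "B \<le> C" unfolding C_def using AB a mult_left_mono[of B A "1 - a"] by (simp add: algebra_simps)
  have m: "0 \<le> m" "m \<le> 1" "1 - m = (1 - a) * A / C" "m \<le> a"
  proof -
    show "0 \<le> m" using a AB C by (simp add: m_def)
    show m3: "1 - m = (1 - a) * A / C" using C by (simp add: m_def C_def field_simps)
    have "0 \<le> (1 - a) * A / C" using a AB C by simp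
    then show "m \<le> 1" using m3 by linarith
    have "a * B \<le> a * C" using BC a by (intro mult_left_mono) auto
    then show "m \<le> a" using C by (simp add: m_def pos_divide_le_eq)
  qed
  have "(1 - m) *\<^sub>R ((1 / A) *\<^sub>R trunc n x) + m *\<^sub>R ((1 / B) *\<^sub>R trunc n x) \<in> parallel_body n L ((1 - m) * 0 + m * t)"
    using inA inB m t by (intro parallel_interpolate) auto
  moreover have "(1 - m) *\<^sub>R ((1 / A) *\<^sub>R trunc n x) + m *\<^sub>R ((1 / B) *\<^sub>R trunc n x) = (1 / C) *\<^sub>R trunc n x"
  proof -
    have "(1 - m) / A + m / B = 1 / C" unfolding m(3) unfolding m_def using AB C by (simp add: add_divide_distrib[symmetric])
    then have "((1 - m) / A + m / B) *\<^sub>R trunc n x = (1 / C) *\<^sub>R trunc n x" by simp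
    then show ?thesis by (simp add: scaleR_add_left)
  qed
  moreover have "(1 - m) * 0 + m * t \<le> a * t" using m(4) t by simp
  ultimately have "(1 / C) *\<^sub>R trunc n x \<in> parallel_body n L (a * t)"
    using parallel_mono[of "(1 - m) * 0 + m * t" "a * t"] m(1) t by auto
  then have "p (a * t) x \<le> C" unfolding p_def using C by (intro Pa.gauge_le)
  then show "p (a * t) x \<le> (1 - a) * p 0 x + a * p t x + e" by (simp add: C_def A_def B_def algebra_simps)
qed

lemma p_lower: "0 < t \<Longrightarrow> p 0 x \<le> (1 + t / r) * p t x"
proof -
  assume t: "0 < t"
  interpret P0: body n "parallel_body n L 0" r by (rule parallel_body) simp
  interpret Pt: body n "parallel_body n L t" r using t by (intro parallel_body) simp
  have q: "0 < 1 + t / r" using t r by (simp add: add_pos_pos)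
  have le: "p 0 x \<le> (1 + t / r) * (p t x + e)" if e: "0 < e" for e
  proof -
    have pos: "0 < p t x + e" using e p_nonneg[of t x] t by simp
    have "(1 / (p t x + e)) *\<^sub>R trunc n x \<in> parallel_body n L t" unfolding p_def using e by (intro Pt.gauge_less) simp
    then have "(1 / (1 + t / r)) *\<^sub>R ((1 / (p t x + e)) *\<^sub>R trunc n x) \<in> L" using t by (intro parallel_outer) auto
    then have "(1 / ((1 + t / r) * (p t x + e))) *\<^sub>R trunc n x \<in> parallel_body n L 0" by (simp add: parallel_0)
    then show ?thesis unfolding p_def[of 0] using q pos by (intro P0.gauge_le) auto
  qed
  show ?thesis
  proof (rule field_le_epsilon)
    fix e :: real assume e: "0 < e"
    then have "p 0 x \<le> (1 + t / r) * (p t x + e / (1 + t / r))" using q by (intro le) auto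
    also have "\<dots> = (1 + t / r) * p t x + e" using q by (simp add: distrib_left)
    finally show "p 0 x \<le> (1 + t / r) * p t x + e" .
  qed
qed

definition slope :: "(nat \<Rightarrow> real) \<Rightarrow> real \<Rightarrow> real" where "slope x t = (p 0 x - p t x) / t"

lemma slope_antimono: "0 < s \<Longrightarrow> s \<le> t \<Longrightarrow> slope x t \<le> slope x s"
proof -
  assume st: "0 < s" "s \<le> t"
  have "p (s / t * t) x \<le> (1 - s / t) * p 0 x + s / t * p t x"
    using st by (intro p_interpolate) auto
  then have "s / t * (p 0 x - p t x) \<le> p 0 x - p s x" using st by (simp add: algebra_simps)
  then have "s / t * (p 0 x - p t x) / s \<le> (p 0 x - p s x) / s" using st by (intro divide_right_mono) auto
  then show ?thesis using st by (simp add: slope_def)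
qed

lemma slope_bounds: "0 < t \<Longrightarrow> 0 \<le> slope x t" "0 < t \<Longrightarrow> slope x t \<le> p 0 x / r"
proof -
  assume t: "0 < t"
  show "0 \<le> slope x t" unfolding slope_def using p_mono[OF t, of x] t by simp
  have "p 0 x - p t x \<le> t / r * p t x" using p_lower[OF t, of x] by (simp add: algebra_simps)
  also have "\<dots> \<le> t / r * p 0 x" using p_mono[OF t, of x] t r by (intro mult_left_mono) auto
  finally have "(p 0 x - p t x) / t \<le> (t / r * p 0 x) / t" using t by (intro divide_right_mono) auto
  then show "slope x t \<le> p 0 x / r" using t by (simp add: slope_def)
qed

lemma slope_limit: "\<exists>l. (slope x \<longlongrightarrow> l) (at_right 0)"
proof -
  define l where "l = (SUP t\<in>{0<..}. slope x t)"
  have bdd: "bdd_above (slope x ` {0<..})" using slope_bounds(2) by (auto simp: bdd_above_def)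
  have "(slope x \<longlongrightarrow> l) (at_right 0)"
  proof (rule order_tendstoI)
    fix a assume "a < l"
    then obtain t where t: "0 < t" "a < slope x t"
      unfolding l_def using less_cSUP_iff[OF _ bdd] by auto
    then have "\<forall>s>0. s < t \<longrightarrow> a < slope x s" using slope_antimono less_le_trans by (meson less_imp_le)
    then show "eventually (\<lambda>s. a < slope x s) (at_right 0)"
      unfolding eventually_at_right_field using t(1) by blast
  next
    fix a assume a: "l < a"
    have "slope x s \<le> l" if "0 < s" for s unfolding l_def using that bdd by (intro cSUP_upper) auto
    then have "\<forall>s>0. s < 1 \<longrightarrow> slope x s < a" using a by (meson le_less_trans)
    then show "eventually (\<lambda>s. slope x s < a) (at_right 0)"
      unfolding eventually_at_right_field by (intro exI[of _ 1]) auto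
  qed
  then show ?thesis by blast
qed

text \<open>The integrand whose integral is \<open>n!\<close> times the difference quotient of the volume.\<close>

definition q :: "real \<Rightarrow> (nat \<Rightarrow> real) \<Rightarrow> real" where "q t x = (exp (- p t x) - exp (- p 0 x)) / t"

lemma q_bounds: "0 < t \<Longrightarrow> exp (- p 0 x) * slope x t \<le> q t x" "0 < t \<Longrightarrow> q t x \<le> exp (- p t x) * slope x t"
proof -
  assume t: "0 < t"
  have "exp (- p 0 x) * (p 0 x - p t x) \<le> exp (- p t x) - exp (- p 0 x)"
  proof -
    have "exp (- p 0 x) * (1 + (p 0 x - p t x)) \<le> exp (- p 0 x) * exp (p 0 x - p t x)"
      by (intro mult_left_mono exp_ge_add_one_self) auto
    also have "\<dots> = exp (- p t x)" by (simp add: exp_add[symmetric])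
    finally show ?thesis by (simp add: algebra_simps)
  qed
  then have "exp (- p 0 x) * (p 0 x - p t x) / t \<le> (exp (- p t x) - exp (- p 0 x)) / t" using t by (intro divide_right_mono) auto
  then show "exp (- p 0 x) * slope x t \<le> q t x" by (simp add: slope_def q_def)
  have "exp (- p t x) - exp (- p 0 x) \<le> exp (- p t x) * (p 0 x - p t x)"
  proof -
    have "exp (- p t x) * (1 + (p t x - p 0 x)) \<le> exp (- p t x) * exp (p t x - p 0 x)"
      by (intro mult_left_mono exp_ge_add_one_self) auto
    also have "\<dots> = exp (- p 0 x)" by (simp add: exp_add[symmetric])
    finally show ?thesis by (simp add: algebra_simps)
  qed
  then have "(exp (- p t x) - exp (- p 0 x)) / t \<le> exp (- p t x) * (p 0 x - p t x) / t" using t by (intro divide_right_mono) auto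
  then show "q t x \<le> exp (- p t x) * slope x t" by (simp add: slope_def q_def)
qed

lemma q_limit: "\<exists>l. ((\<lambda>t. q t x) \<longlongrightarrow> l) (at_right 0)"
proof -
  obtain l where l: "(slope x \<longlongrightarrow> l) (at_right 0)" using slope_limit by blast
  have "((\<lambda>t. p 0 x - t * slope x t) \<longlongrightarrow> p 0 x - 0 * l) (at_right 0)"
    by (intro tendsto_intros l)
  moreover have "eventually (\<lambda>t. p 0 x - t * slope x t = p t x) (at_right 0)"
    unfolding eventually_at_right_field by (intro exI[of _ 1]) (auto simp: slope_def)
  ultimately have pt: "((\<lambda>t. p t x) \<longlongrightarrow> p 0 x) (at_right 0)" using tendsto_cong by fastforce
  have lo: "((\<lambda>t. exp (- p 0 x) * slope x t) \<longlongrightarrow> exp (- p 0 x) * l) (at_right 0)" by (intro tendsto_intros l)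
  have hi: "((\<lambda>t. exp (- p t x) * slope x t) \<longlongrightarrow> exp (- p 0 x) * l) (at_right 0)" by (intro tendsto_intros l pt)
  have "((\<lambda>t. q t x) \<longlongrightarrow> exp (- p 0 x) * l) (at_right 0)"
  proof (rule tendsto_sandwich[OF _ _ lo hi])
    show "eventually (\<lambda>t. exp (- p 0 x) * slope x t \<le> q t x) (at_right 0)"
      unfolding eventually_at_right_field using q_bounds by (intro exI[of _ 1]) auto
    show "eventually (\<lambda>t. q t x \<le> exp (- p t x) * slope x t) (at_right 0)"
      unfolding eventually_at_right_field using q_bounds by (intro exI[of _ 1]) auto
  qed
  then show ?thesis by blast
qed

text \<open>For \<open>t \<le> r\<close> the gauge of the parallel body is at least half of that of \<open>L\<close>; the linear factor from the
  slope is absorbed by half of the exponential.\<close>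

lemma q_dominated: "0 < t \<Longrightarrow> t \<le> r \<Longrightarrow> \<bar>q t x\<bar> \<le> 4 / r * exp (- (1/4 * p 0 x))"
proof -
  assume t: "0 < t" "t \<le> r"
  have p0: "0 \<le> p 0 x" by (rule p_nonneg) simp
  have q0: "0 \<le> q t x" using q_bounds(1)[OF t(1), of x] slope_bounds(1)[OF t(1), of x] by (meson exp_ge_zero mult_nonneg_nonneg order_trans)
  have "p 0 x \<le> (1 + t / r) * p t x" using t(1) by (rule p_lower)
  also have "\<dots> \<le> 2 * p t x" using t r p_nonneg[of t x] by (intro mult_right_mono) auto
  finally have half: "- p t x \<le> - (1/2 * p 0 x)" by simp
  have "q t x \<le> exp (- p t x) * slope x t" using q_bounds(2)[OF t(1)] .
  also have "\<dots> \<le> exp (- (1/2 * p 0 x)) * (p 0 x / r)"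
    using half slope_bounds[OF t(1), of x] by (intro mult_mono) auto
  also have "\<dots> \<le> exp (- (1/2 * p 0 x)) * (4 * exp (1/4 * p 0 x) / r)"
  proof (intro mult_left_mono divide_right_mono)
    show "p 0 x \<le> 4 * exp (1/4 * p 0 x)" using exp_ge_add_one_self[of "1/4 * p 0 x"] by linarith
  qed (use r in auto)
  also have "\<dots> = 4 / r * (exp (- (1/2 * p 0 x)) * exp (1/4 * p 0 x))" by simp
  also have "exp (- (1/2 * p 0 x)) * exp (1/4 * p 0 x) = exp (- (1/4 * p 0 x))" by (simp add: exp_add[symmetric])
  finally show ?thesis using q0 by simp
qed

lemma p_measurable [measurable]: "0 \<le> t \<Longrightarrow> p t \<in> borel_measurable borel"
  unfolding p_def by (rule body.gauge_measurable[OF parallel_body])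

text \<open>By \<open>nn_integral_exp_gauge\<close> the difference quotient is the integral of \<open>q t\<close> divided by \<open>n!\<close>.  The
  functions \<open>q t\<close> converge pointwise because the slopes of \<open>p\<close> at \<open>0\<close> are monotone and bounded, and
  \<open>q_dominated\<close> gives an integrable majorant.\<close>

lemma surface_limit_exists:
  "\<exists>S. ((\<lambda>t. (measure (leb n) (parallel_body n L t) - measure (leb n) L) / t) \<longlongrightarrow> S) (at_right 0)"
proof -
  obtain l where l: "\<And>x. ((\<lambda>t. q t x) \<longlongrightarrow> l x) (at_right 0)" using q_limit by metis
  have q_meas: "q t \<in> borel_measurable borel" if "0 < t" for t
  proof -
    have [measurable]: "p t \<in> borel_measurable borel" "p 0 \<in> borel_measurable borel" using that by auto
    show ?thesis unfolding q_def[abs_def] by measurable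
  qed
  have seq: "(\<lambda>k. q (X k) x) \<longlonglongrightarrow> l x" if "\<And>k. X k \<in> {0<..} - {0}" "X \<longlonglongrightarrow> 0" for X :: "nat \<Rightarrow> real" and x
    using l[of x] that unfolding tendsto_at_iff_sequentially by (auto simp: o_def)
  have l_meas: "l \<in> borel_measurable borel"
  proof (rule borel_measurable_LIMSEQ_metric)
    show "(\<lambda>k. q (inverse (real (Suc k))) x) \<longlonglongrightarrow> l x" for x
      by (rule seq[OF _ LIMSEQ_inverse_real_of_nat]) simp
    show "q (inverse (real (Suc k))) \<in> borel_measurable borel" for k by (rule q_meas) simp
  qed
  interpret P0: body n "parallel_body n L 0" r by (rule parallel_body) simp
  have dom: "integrable (leb n) (\<lambda>x. 4 / r * exp (- (1/4 * p 0 x)))"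
    unfolding p_def by (intro integrable_mult_right P0.integrable_exp_gauge) simp
  have lim: "((\<lambda>t. \<integral>x. q t x \<partial>leb n) \<longlongrightarrow> (\<integral>x. l x \<partial>leb n)) (at_right 0)"
    unfolding tendsto_at_iff_sequentially
  proof (intro allI impI)
    fix X :: "nat \<Rightarrow> real" assume X: "\<forall>i. X i \<in> {0<..} - {0}" "X \<longlonglongrightarrow> 0"
    have "eventually (\<lambda>i. X i < r) sequentially" using X(2) r by (rule order_tendstoD)
    then obtain N where N: "\<And>i. i \<ge> N \<Longrightarrow> X i < r" by (auto simp: eventually_sequentially)
    define Y where "Y i = X (i + N)" for i
    have Y: "0 < Y i" "Y i \<le> r" for i using X(1) N[of "i + N"] by (auto simp: Y_def less_imp_le)
    have "(\<lambda>i. \<integral>x. q (Y i) x \<partial>leb n) \<longlonglongrightarrow> (\<integral>x. l x \<partial>leb n)"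
    proof (rule integral_dominated_convergence[OF _ _ dom])
      show "l \<in> borel_measurable (leb n)" using l_meas by simp
      show "q (Y i) \<in> borel_measurable (leb n)" for i using q_meas[OF Y(1)] by simp
      show "AE x in leb n. (\<lambda>i. q (Y i) x) \<longlonglongrightarrow> l x"
      proof (rule AE_I2)
        fix x
        have "Y \<longlonglongrightarrow> 0" unfolding Y_def using X(2) by (rule LIMSEQ_ignore_initial_segment)
        then show "(\<lambda>i. q (Y i) x) \<longlonglongrightarrow> l x" using Y(1) by (intro seq) auto
      qed
      show "AE x in leb n. norm (q (Y i) x) \<le> 4 / r * exp (- (1/4 * p 0 x))" for i
        using q_dominated[OF Y] by auto
    qed
    then have "(\<lambda>i. \<integral>x. q (X i) x \<partial>leb n) \<longlonglongrightarrow> (\<integral>x. l x \<partial>leb n)"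
      unfolding Y_def by (rule LIMSEQ_offset)
    then show "((\<lambda>t. \<integral>x. q t x \<partial>leb n) \<circ> X) \<longlonglongrightarrow> (\<integral>x. l x \<partial>leb n)" by (simp add: o_def)
  qed
  have int: "(\<integral>x. q t x \<partial>leb n) = fact n * ((measure (leb n) (parallel_body n L t) - measure (leb n) L) / t)" if t: "0 < t" for t
  proof -
    interpret Pt: body n "parallel_body n L t" r using t by (intro parallel_body) simp
    have i: "integrable (leb n) (\<lambda>x. exp (- p t x))" "integrable (leb n) (\<lambda>x. exp (- p 0 x))"
      using Pt.integrable_exp_gauge[of 1] P0.integrable_exp_gauge[of 1] by (simp_all add: p_def)
    have "(\<integral>x. q t x \<partial>leb n) = ((\<integral>x. exp (- p t x) \<partial>leb n) - (\<integral>x. exp (- p 0 x) \<partial>leb n)) / t"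
      unfolding q_def using i by simp
    also have "\<dots> = (fact n * measure (leb n) (parallel_body n L t) - fact n * measure (leb n) L) / t"
      unfolding p_def Pt.integral_exp_gauge P0.integral_exp_gauge by (simp add: parallel_0)
    finally show ?thesis by (simp add: right_diff_distrib)
  qed
  have lim_q: "((\<lambda>t. (\<integral>x. q t x \<partial>leb n) / fact n) \<longlongrightarrow> (\<integral>x. l x \<partial>leb n) / fact n) (at_right 0)"
    by (intro tendsto_intros lim) simp
  have ev: "eventually (\<lambda>t. (\<integral>x. q t x \<partial>leb n) / fact n
      = (measure (leb n) (parallel_body n L t) - measure (leb n) L) / t) (at_right 0)"
    unfolding eventually_at_right_field using int by (intro exI[of _ 1]) auto
  show ?thesis using Lim_transform_eventually[OF lim_q ev] by blast
qed

lemma parallel_volume_le: "0 < t \<Longrightarrow> measure (leb n) (parallel_body n L t) \<le> (1 + t / r) ^ n * measure (leb n) L"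
proof -
  assume t: "0 < t"
  interpret Pt: body n "parallel_body n L t" r using t by (intro parallel_body) simp
  have s: "0 < 1 + t / r" using t r by (simp add: add_pos_pos)
  have "parallel_body n L t \<subseteq> {x. (1 / (1 + t / r)) *\<^sub>R trunc n x \<in> L}"
    using parallel_outer[of t] t Pt.LRn by (auto simp: trunc_id subset_iff)
  moreover have "{x. (1 / (1 + t / r)) *\<^sub>R trunc n x \<in> L} \<in> sets borel"
    using measurable_sets[OF trunc_scale_measurable L_borel, of "1 / (1 + t / r)"] by (simp add: vimage_def)
  ultimately have "emeasure (leb n) (parallel_body n L t) \<le> emeasure (leb n) {x. (1 / (1 + t / r)) *\<^sub>R trunc n x \<in> L}"
    by (intro emeasure_mono) auto
  also have "\<dots> = ennreal ((1 + t / r) ^ n) * emeasure (leb n) L" using s by (rule emeasure_leb_scale) simp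
  finally have "enn2real (emeasure (leb n) (parallel_body n L t)) \<le> enn2real (ennreal ((1 + t / r) ^ n) * emeasure (leb n) L)"
    using emeasure_L_finite by (intro enn2real_mono) (auto simp: ennreal_mult_less_top)
  then show ?thesis using s by (simp add: measure_def enn2real_mult)
qed

text \<open>The upper bound is the derivative of \<open>(1 + t / r)\<^sup>n V\<close> at \<open>t = 0\<close>.\<close>

theorem surface_bounds:
  assumes lim: "((\<lambda>t. (measure (leb n) (parallel_body n L t) - measure (leb n) L) / t) \<longlongrightarrow> S) (at_right 0)"
  shows "0 \<le> S" "S \<le> real n * measure (leb n) L / r"
proof -
  let ?V = "measure (leb n) L"
  show "0 \<le> S"
  proof (rule tendsto_lowerbound[OF lim])
    show "eventually (\<lambda>t. 0 \<le> (measure (leb n) (parallel_body n L t) - ?V) / t) (at_right 0)"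
      unfolding eventually_at_right_field
    proof (intro exI[of _ 1] conjI allI impI)
      fix t :: real assume t: "0 < t" "t < 1"
      interpret Pt: body n "parallel_body n L t" r using t by (intro parallel_body) simp
      have "?V \<le> measure (leb n) (parallel_body n L t)"
        using parallel_mono[of 0 t] t Pt.emeasure_L_finite unfolding parallel_0
        by (intro measure_mono_fmeasurable fmeasurableI) auto
      then show "0 \<le> (measure (leb n) (parallel_body n L t) - ?V) / t" using t by simp
    qed simp
  qed simp
  have "((\<lambda>t. (1 + t / r) ^ n * ?V) has_real_derivative (real n * ?V / r)) (at 0)"
    using r by (auto intro!: derivative_eq_intros)
  then have "((\<lambda>t. (1 + t / r) ^ n * ?V) has_real_derivative (real n * ?V / r)) (at 0 within {0<..})"
    by (rule has_field_derivative_at_within)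
  then have up: "((\<lambda>t. ((1 + t / r) ^ n * ?V - ?V) / t) \<longlongrightarrow> real n * ?V / r) (at_right 0)"
    by (simp add: has_field_derivative_iff)
  show "S \<le> real n * ?V / r"
  proof (rule tendsto_le[OF _ up lim])
    show "eventually (\<lambda>t. (measure (leb n) (parallel_body n L t) - ?V) / t \<le> ((1 + t / r) ^ n * ?V - ?V) / t) (at_right 0)"
      unfolding eventually_at_right_field using parallel_volume_le
      by (intro exI[of _ 1]) (auto intro!: divide_right_mono)
  qed simp
qed

end

section \<open>Surface area of the cube\<close>

lemma closed_ball_unit: "closed_ball n 0 1 = ball1 n"
  by (auto simp: closed_ball_def ball1_def L2_set_def ip_def power2_eq_square)

lemma closed_ball_eq:
  assumes "0 < s"
  shows "closed_ball n a s = {x \<in> Rn n. ip n (x - a) (x - a) \<le> s\<^sup>2}"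
proof -
  have "L2_set (x - a) {..<n} \<le> s \<longleftrightarrow> ip n (x - a) (x - a) \<le> s\<^sup>2" for x
  proof -
    have "L2_set (x - a) {..<n} = sqrt (ip n (x - a) (x - a))"
      by (simp add: L2_set_def ip_def power2_eq_square)
    moreover have "sqrt (ip n (x - a) (x - a)) \<le> s \<longleftrightarrow> sqrt (ip n (x - a) (x - a)) \<le> sqrt (s\<^sup>2)" using assms by simp
    ultimately show ?thesis by (simp only: real_sqrt_le_iff)
  qed
  then show ?thesis by (auto simp: closed_ball_def)
qed

lemma parallel_body_closed_ball:
  "{x + t *\<^sub>R u | x u. x \<in> K \<and> u \<in> closed_ball n 0 1} = parallel_body n K t"
  by (simp add: parallel_body_def closed_ball_unit)

text \<open>The definition of surface area by \<open>Lim\<close> carries information only once the limit is known to exist.\<close>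

lemma (in body) surface_area_tendsto:
  "((\<lambda>t. (measure (leb n) (parallel_body n L t) - measure (leb n) L) / t) \<longlongrightarrow> surface_area n L) (at_right 0)"
proof -
  obtain S where S: "((\<lambda>t. (measure (leb n) (parallel_body n L t) - measure (leb n) L) / t) \<longlongrightarrow> S) (at_right 0)"
    using surface_limit_exists by blast
  have ev: "eventually (\<lambda>t. (measure (leb n) (parallel_body n L t) - measure (leb n) L) / t
      = (vol n (parallel_body n L t) - vol n L) / t) (at_right 0)"
    unfolding eventually_at_right_field
  proof (intro exI[of _ 1] conjI allI impI)
    fix t :: real assume t: "0 < t" "t < 1"
    interpret Pt: body n "parallel_body n L t" r using t by (intro parallel_body) simp
    show "(measure (leb n) (parallel_body n L t) - measure (leb n) L) / t = (vol n (parallel_body n L t) - vol n L) / t"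
      using vol_eq[OF Pt.L_borel Pt.LRn] vol_eq[OF L_borel LRn] by simp
  qed simp
  have "((\<lambda>t. (vol n (parallel_body n L t) - vol n L) / t) \<longlongrightarrow> S) (at_right 0)"
    by (rule Lim_transform_eventually[OF S ev])
  then have "surface_area n L = S"
    unfolding surface_area_def parallel_body_closed_ball by (intro tendsto_Lim) auto
  then show ?thesis using S by simp
qed

lemma cube_eq: "cube n = Rn n \<inter> cubeset n 1"
  by (auto simp: cube_def cubeset_def)

lemma body_cube: "body n (cube n) 1"
proof
  have "closed (cubeset n 1)"
  proof -
    have "cubeset n 1 = (\<Inter>i<n. {x. -1 \<le> x i} \<inter> {x. x i \<le> 1})" by (auto simp: cubeset_def)
    also have "closed \<dots>"
      by (intro closed_INT ballI closed_Int closed_Collect_le continuous_on_const continuous_coord)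
    finally show ?thesis .
  qed
  then have "closed (cube n)" unfolding cube_eq by (intro closed_Int closed_Rn)
  then show "compact (cube n)"
    by (rule compact_box_subset[where R = "\<lambda>i. if i < n then 1 else 0"]) (auto simp: cube_def mem_Rn abs_le_iff minus_le_iff)
  show "convex (cube n)"
  proof (rule convexI)
    fix x y a b assume xy: "x \<in> cube n" "y \<in> cube n" and ab: "(0::real) \<le> a" "0 \<le> b" "a + b = 1"
    have "-1 \<le> a * x i + b * y i \<and> a * x i + b * y i \<le> 1" if "i < n" for i
    proof -
      have xi: "-1 \<le> x i" "x i \<le> 1" "-1 \<le> y i" "y i \<le> 1" using xy that by (auto simp: cube_def)
      have "a * x i + b * y i \<le> a * 1 + b * 1" using xi ab by (intro add_mono mult_left_mono) auto
      moreover have "a * (-1) + b * (-1) \<le> a * x i + b * y i" using xi ab by (intro add_mono mult_left_mono) auto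
      ultimately show ?thesis using ab by simp
    qed
    then show "a *\<^sub>R x + b *\<^sub>R y \<in> cube n" using xy by (auto simp: cube_def)
  qed
  show "cube n \<subseteq> Rn n" by (auto simp: cube_def)
  fix x assume x: "x \<in> Rn n" "ip n x x \<le> 1\<^sup>2"
  have "\<bar>x i\<bar> \<le> 1" if "i < n" for i
  proof -
    have "(x i)\<^sup>2 \<le> 1" using abs_coord_le[OF that, of x] x by simp
    then show ?thesis by (simp add: abs_square_le_1)
  qed
  then show "x \<in> cube n" using x by (auto simp: cube_def abs_le_iff minus_le_iff)
qed simp

lemma trunc_preimage: "S \<in> sets borel \<Longrightarrow> emeasure (leb n) {x. trunc n x \<in> S} = emeasure (leb n) S"
  using emeasure_leb_scale[of 1 S n] by simp

lemma measure_cube: "measure (leb n) (cube n) = 2 ^ n"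
proof -
  interpret C: body n "cube n" 1 by (rule body_cube)
  have "{x. trunc n x \<in> cube n} = cubeset n 1" by (auto simp: cube_def cubeset_def trunc_def mem_Rn)
  then have "emeasure (leb n) (cube n) = emeasure (leb n) (cubeset n 1)"
    using trunc_preimage[OF C.L_borel, of n] by simp
  then show ?thesis using emeasure_cubeset[of 1 n] by (simp add: measure_def)
qed

text \<open>Besides the cube, the parallel body contains the \<open>n\<close> disjoint sets \<open>D i\<close>, each a pair of slabs of height
  \<open>t\<close> on opposite facets.\<close>

lemma parallel_cube_volume:
  assumes t: "0 < t"
  shows "2 ^ n + t * (real n * 2 ^ n) \<le> measure (leb n) (parallel_body n (cube n) t)"
proof -
  interpret C: body n "cube n" 1 by (rule body_cube)
  interpret P: body n "parallel_body n (cube n) t" 1 using t by (intro C.parallel_body) simp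
  define I where "I i j = (if j = i then {-1-t..<-1} \<union> {1<..1+t} else {-1..1::real})" for i j :: nat
  define D where "D i = {x::nat \<Rightarrow> real. \<forall>j<n. x j \<in> I i j}" for i
  have I_borel: "I i j \<in> sets borel" for i j by (auto simp: I_def)
  have D_borel: "D i \<in> sets borel" for i
  proof -
    have [measurable]: "I i j \<in> sets borel" for j by (rule I_borel)
    have "Measurable.pred borel (\<lambda>x::nat \<Rightarrow> real. \<forall>j\<in>{..<n}. x j \<in> I i j)" by measurable
    then show ?thesis by (simp add: pred_def Ball_def D_def)
  qed
  have emD: "emeasure (leb n) (D i) = ennreal (t * 2 ^ n)" if i: "i < n" for i
  proof -
    have "emeasure (leb n) (D i) = (\<Prod>j<n. emeasure lborel (I i j))"
      unfolding D_def by (rule emeasure_leb_box) (rule I_borel)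
    also have "\<dots> = emeasure lborel (I i i) * (\<Prod>j\<in>{..<n}-{i}. emeasure lborel (I i j))"
      using i by (subst prod.remove[of _ i]) auto
    also have "emeasure lborel (I i i) = ennreal (2 * t)"
    proof -
      have "emeasure lborel ({-1-t..<-1} \<union> {1<..1+t}) = emeasure lborel {-1-t..<-1} + emeasure lborel {1<..1+t}"
        by (rule plus_emeasure[symmetric]) auto
      also have "\<dots> = ennreal t + ennreal t" using t by simp
      also have "\<dots> = ennreal (2 * t)" using t by (simp add: ennreal_plus[symmetric] del: ennreal_plus)
      finally show ?thesis by (simp add: I_def)
    qed
    also have "(\<Prod>j\<in>{..<n}-{i}. emeasure lborel (I i j)) = (\<Prod>j\<in>{..<n}-{i}. ennreal 2)"
      by (intro prod.cong) (auto simp: I_def)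
    also have "\<dots> = ennreal (2 ^ (n - 1))" using i by (simp add: ennreal_power[symmetric])
    also have "ennreal (2 * t) * ennreal (2 ^ (n - 1)) = ennreal (t * (2 ^ (n - 1) * 2))"
      using t by (simp add: ennreal_mult[symmetric] mult_ac)
    also have "(2::real) ^ (n - 1) * 2 = 2 ^ n" using i by (intro power_minus_mult) simp
    finally show ?thesis .
  qed
  have disj: "disjoint_family_on D {..<n}"
    unfolding disjoint_family_on_def
  proof (intro ballI impI)
    fix i j assume "i \<in> {..<n}" "j \<in> {..<n}" "i \<noteq> j"
    then have "x i \<in> I i i \<Longrightarrow> x i \<notin> I j i" for x by (auto simp: I_def)
    then show "D i \<inter> D j = {}" using \<open>i \<in> {..<n}\<close> by (force simp: D_def)
  qed
  have disj2: "cubeset n 1 \<inter> (\<Union>i<n. D i) = {}"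
  proof -
    have "x \<notin> D i" if "x \<in> cubeset n 1" "i < n" for x i
    proof
      assume "x \<in> D i"
      then have "x i \<in> I i i" using that by (simp add: D_def)
      then show False using that by (auto simp: I_def cubeset_def)
    qed
    then show ?thesis by blast
  qed
  have sub: "cubeset n 1 \<union> (\<Union>i<n. D i) \<subseteq> {x. trunc n x \<in> parallel_body n (cube n) t}"
  proof
    fix x assume "x \<in> cubeset n 1 \<union> (\<Union>i<n. D i)"
    then consider "x \<in> cubeset n 1" | i where "i < n" "x \<in> D i" by blast
    then show "x \<in> {x. trunc n x \<in> parallel_body n (cube n) t}"
    proof cases
      case 1
      then have "trunc n x \<in> cube n" by (auto simp: cube_def cubeset_def trunc_def mem_Rn)
      then show ?thesis using C.parallel_mono[of 0 t] t C.parallel_0 by auto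
    next
      case 2
      define s where "s = (if x i < 0 then -1 else 1 :: real)"
      have xi: "x i \<in> {-1-t..<-1} \<union> {1<..1+t}" using 2 by (auto simp: D_def I_def)
      have dx: "\<bar>x i - s\<bar> \<le> t" using xi t by (auto simp: s_def)
      define y where "y = (trunc n x)(i := s)"
      define v where "v = (\<lambda>j. if j = i then (x i - s) / t else 0)"
      have "y \<in> cube n" using 2 unfolding cube_def y_def
        by (auto simp: trunc_def mem_Rn D_def I_def s_def)
      moreover have "v \<in> ball1 n"
      proof -
        have "ip n v v = ((x i - s) / t)\<^sup>2"
          using 2(1) by (simp add: ip_def v_def power2_eq_square if_distrib[of "\<lambda>z. z * _"] cong: if_cong)
        also have "\<dots> \<le> 1" using dx t by (simp add: abs_square_le_1)
        finally show ?thesis using 2(1) by (simp add: ball1_def mem_Rn v_def)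
      qed
      moreover have "trunc n x = y + t *\<^sub>R v"
        using 2(1) t by (auto simp: fun_eq_iff y_def v_def trunc_def)
      ultimately show ?thesis unfolding parallel_body_def by blast
    qed
  qed
  have pre: "{x. trunc n x \<in> parallel_body n (cube n) t} \<in> sets borel"
    using measurable_sets[OF C.trunc_scale_measurable P.L_borel, of 1] by (simp add: vimage_def)
  have "ennreal (2 ^ n + t * (real n * 2 ^ n)) = ennreal (2 ^ n) + (\<Sum>i<n. ennreal (t * 2 ^ n))"
    using t by (simp add: ennreal_plus ennreal_of_nat_eq_real_of_nat ennreal_mult[symmetric] mult_ac)
  also have "\<dots> = emeasure (leb n) (cubeset n 1) + (\<Sum>i<n. emeasure (leb n) (D i))"
    using emeasure_cubeset[of 1 n] emD by simp
  also have "(\<Sum>i<n. emeasure (leb n) (D i)) = emeasure (leb n) (\<Union>i<n. D i)"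
    using D_borel disj by (intro sum_emeasure) auto
  also have "emeasure (leb n) (cubeset n 1) + emeasure (leb n) (\<Union>i<n. D i) = emeasure (leb n) (cubeset n 1 \<union> (\<Union>i<n. D i))"
    using disj2 D_borel by (intro plus_emeasure) auto
  also have "\<dots> \<le> emeasure (leb n) {x. trunc n x \<in> parallel_body n (cube n) t}"
    using sub pre by (intro emeasure_mono) auto
  also have "\<dots> = emeasure (leb n) (parallel_body n (cube n) t)" by (rule trunc_preimage[OF P.L_borel])
  finally have "enn2real (ennreal (2 ^ n + t * (real n * 2 ^ n))) \<le> enn2real (emeasure (leb n) (parallel_body n (cube n) t))"
    using P.emeasure_L_finite by (intro enn2real_mono) auto
  moreover have "0 \<le> 2 ^ n + t * (real n * 2 ^ n)" using t by simp
  ultimately show ?thesis by (simp only: enn2real_ennreal measure_def)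
qed

lemma surface_area_cube_ge: "real n * 2 ^ n \<le> surface_area n (cube n)"
proof -
  interpret C: body n "cube n" 1 by (rule body_cube)
  show ?thesis
  proof (rule tendsto_lowerbound[OF C.surface_area_tendsto])
    show "eventually (\<lambda>t. real n * 2 ^ n \<le> (measure (leb n) (parallel_body n (cube n) t) - measure (leb n) (cube n)) / t) (at_right 0)"
      unfolding eventually_at_right_field measure_cube
      using parallel_cube_volume by (intro exI[of _ 1]) (auto simp: pos_le_divide_eq algebra_simps)
  qed simp
qed

section \<open>From the John ellipsoid to the volume bound\<close>

lemma lin_GL:
  assumes "dt n A \<noteq> 0"
  shows "lin n A \<in> GL n"
proof -
  obtain B where B: "\<And>i j. i < n \<Longrightarrow> j < n \<Longrightarrow> mm n A B i j = (if i = j then 1 else 0)"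
    "\<And>i j. i < n \<Longrightarrow> j < n \<Longrightarrow> mm n B A i j = (if i = j then 1 else 0)" using dt_inverse[OF assms] by blast
  have AB: "lin n A (lin n B x) = x" "lin n B (lin n A x) = x" if "x \<in> Rn n" for x
    unfolding lin_mm[symmetric] using lin_id[OF B(1) that] lin_id[OF B(2) that] by blast+
  have "linear (lin n A)" by (rule linearI) (simp_all add: lin_arith)
  moreover have "bij_betw (lin n A) (Rn n) (Rn n)"
    by (rule bij_betw_byWitness[where f' = "lin n B"]) (auto simp: AB)
  ultimately show ?thesis by (simp add: GL_def)
qed

lemma emeasure_lin_image:
  assumes "dt n A \<noteq> 0" and S: "S \<in> sets borel" "S \<subseteq> Rn n"
  shows "lin n A ` S \<in> sets borel" "emeasure (leb n) (lin n A ` S) = ennreal \<bar>dt n A\<bar> * emeasure (leb n) S"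
proof -
  obtain B where B: "\<And>i j. i < n \<Longrightarrow> j < n \<Longrightarrow> mm n A B i j = (if i = j then 1 else 0)"
    "\<And>i j. i < n \<Longrightarrow> j < n \<Longrightarrow> mm n B A i j = (if i = j then 1 else 0)" using dt_inverse[OF assms(1)] by blast
  have AB: "lin n A (lin n B x) = x" "lin n B (lin n A x) = x" if "x \<in> Rn n" for x
    unfolding lin_mm[symmetric] using lin_id[OF B(1) that] lin_id[OF B(2) that] by blast+
  have Rn_borel: "Rn n \<in> sets borel" by (rule borel_closed[OF closed_Rn])
  have "lin n A ` S = Rn n \<inter> {x. lin n B x \<in> S}"
  proof (intro equalityI subsetI)
    fix y assume y: "y \<in> Rn n \<inter> {x. lin n B x \<in> S}"
    then have "y = lin n A (lin n B y)" using AB(1)[of y] by simp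
    then show "y \<in> lin n A ` S" using y by blast
  qed (use S AB in auto)
  moreover have "{x. lin n B x \<in> S} \<in> sets borel"
    using measurable_sets[OF lin_measurable S(1), of n B] by (simp add: vimage_def)
  ultimately show im: "lin n A ` S \<in> sets borel" using Rn_borel by auto
  have pre: "{x. lin n A x \<in> lin n A ` S} \<in> sets borel"
    using measurable_sets[OF lin_measurable im, of n A] by (simp add: vimage_def)
  have "emeasure (leb n) {x. lin n A x \<in> lin n A ` S} = emeasure (leb n) S"
  proof (rule emeasure_eq_AE)
    show "AE x in leb n. x \<in> {x. lin n A x \<in> lin n A ` S} \<longleftrightarrow> x \<in> S"
      using AE_leb_Rn[of n]
    proof eventually_elim
      fix x assume x: "x \<in> Rn n"
      show "x \<in> {x. lin n A x \<in> lin n A ` S} \<longleftrightarrow> x \<in> S"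
      proof
        assume "x \<in> {x. lin n A x \<in> lin n A ` S}"
        then obtain y where y: "y \<in> S" "lin n A x = lin n A y" by auto
        then have "x = y" using AB(2)[OF x] AB(2)[of y] S(2) by auto
        then show "x \<in> S" using y by simp
      qed auto
    qed
  qed (use pre S in auto)
  then show "emeasure (leb n) (lin n A ` S) = ennreal \<bar>dt n A\<bar> * emeasure (leb n) S"
    using emeasure_leb_lin[OF im assms(1)] by simp
qed

lemma body_ball1: "body n (ball1 n) 1"
proof
  have "ball1 n = Rn n \<inter> {x. ip n x x \<le> 1}" by (auto simp: ball1_def)
  also have "closed \<dots>"
    by (intro closed_Int closed_Rn closed_Collect_le continuous_ip continuous_on_const continuous_on_id)
  finally have cl: "closed (ball1 n)" .
  show "compact (ball1 n)"
  proof (rule compact_box_subset[OF cl, where R = "\<lambda>i. if i < n then 1 else 0"])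
    fix x i assume x: "x \<in> ball1 n"
    show "\<bar>x i\<bar> \<le> (if i < n then 1 else 0)"
    proof (cases "i < n")
      case True
      then have "(x i)\<^sup>2 \<le> 1" using abs_coord_le[of i n x] x by (auto simp: ball1_def)
      then show ?thesis using True by (simp add: abs_square_le_1)
    qed (use x in \<open>auto simp: ball1_def mem_Rn\<close>)
  qed
  show "convex (ball1 n)"
  proof (rule convexI)
    interpret C: body n "cube n" 1 by (rule body_cube)
    fix x y a b assume "x \<in> ball1 n" "y \<in> ball1 n" "(0::real) \<le> a" "0 \<le> b" "a + b = 1"
    then show "a *\<^sub>R x + b *\<^sub>R y \<in> ball1 n" using C.ball1_convex_combination[of x y b] by (simp add: eq_diff_eq[symmetric])
  qed
qed (auto simp: ball1_def)

lemma (in body) measure_pos: "0 < n \<Longrightarrow> 0 < measure (leb n) L"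
proof -
  assume n: "0 < n"
  define \<beta> where "\<beta> = r / real n"
  have \<beta>: "0 < \<beta>" using n r by (simp add: \<beta>_def)
  have "cubeset n \<beta> \<subseteq> {x. trunc n x \<in> L}"
  proof (intro subsetI CollectI ball)
    fix x assume x: "x \<in> cubeset n \<beta>"
    have "ip n (trunc n x) (trunc n x) \<le> (\<Sum>i<n. \<beta>\<^sup>2)"
      unfolding ip_def
    proof (rule sum_mono)
      fix i assume "i \<in> {..<n}"
      then have "\<bar>x i\<bar> \<le> \<beta>" using x by (auto simp: cubeset_def abs_le_iff minus_le_iff)
      then have "\<bar>x i\<bar>\<^sup>2 \<le> \<beta>\<^sup>2" by (intro power_mono) auto
      then show "trunc n x i * trunc n x i \<le> \<beta>\<^sup>2" using \<open>i \<in> {..<n}\<close> by (simp add: trunc_def power2_eq_square)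
    qed
    also have "\<dots> = r\<^sup>2 / real n" using n by (simp add: \<beta>_def power2_eq_square)
    also have "\<dots> \<le> r\<^sup>2 / 1" using n by (intro divide_left_mono) auto
    finally show "ip n (trunc n x) (trunc n x) \<le> r\<^sup>2" by simp
  qed simp
  moreover have "{x. trunc n x \<in> L} \<in> sets borel"
    using measurable_sets[OF trunc_scale_measurable L_borel, of 1] by (simp add: vimage_def)
  ultimately have "emeasure (leb n) (cubeset n \<beta>) \<le> emeasure (leb n) {x. trunc n x \<in> L}" by (intro emeasure_mono) auto
  then have "ennreal ((2 * \<beta>) ^ n) \<le> emeasure (leb n) L"
    using \<beta> by (simp add: emeasure_cubeset trunc_preimage)
  then have "enn2real (ennreal ((2 * \<beta>) ^ n)) \<le> measure (leb n) L"
    unfolding measure_def using emeasure_L_finite by (intro enn2real_mono) auto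
  moreover have "0 < (2 * \<beta>) ^ n" using \<beta> by simp
  ultimately show ?thesis by simp
qed

lemma compactin_Rn_iff: "compactin (Euclidean_space n) K \<Longrightarrow> compact K \<and> K \<subseteq> Rn n"
proof -
  assume K: "compactin (Euclidean_space n) K"
  then have "compactin (powertop_real UNIV) K" "K \<subseteq> Rn n"
    unfolding Euclidean_space_def compactin_subtopology by auto
  then have "compactin euclidean K" by (simp only: euclidean_product_topology)
  then show ?thesis using \<open>K \<subseteq> Rn n\<close> by simp
qed

lemma measure_lin_image:
  assumes "dt n A \<noteq> 0" "S \<in> sets borel" "S \<subseteq> Rn n"
  shows "measure (leb n) (lin n A ` S) = \<bar>dt n A\<bar> * measure (leb n) S"
  unfolding measure_def emeasure_lin_image(2)[OF assms] by (simp add: enn2real_mult)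

lemma scaleR_image_lin:
  assumes "S \<subseteq> Rn n"
  shows "(\<lambda>x. s *\<^sub>R x) ` S = lin n (\<lambda>i j. s * (if i = j then 1 else 0)) ` S"
  using assms by (intro image_cong refl) (auto simp: lin_scale trunc_id)

lemma dt_scale: "dt n (\<lambda>i j. s * (if i = j then 1 else 0)) = s ^ n"
  by (simp only: dt_smult dt_id mult_1_right)

lemma measure_scaleR_image:
  assumes "0 < s" "S \<in> sets borel" "S \<subseteq> Rn n"
  shows "measure (leb n) ((\<lambda>x. s *\<^sub>R x) ` S) = s ^ n * measure (leb n) S"
  unfolding scaleR_image_lin[OF assms(3)] using assms by (subst measure_lin_image) (auto simp: dt_scale)

lemma measure_closed_ball:
  assumes s: "0 < s" and a: "a \<in> Rn n"
  shows "measure (leb n) (closed_ball n a s) = s ^ n * measure (leb n) (ball1 n)" "closed_ball n a s \<in> sets borel"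
proof -
  interpret B: body n "ball1 n" 1 by (rule body_ball1)
  let ?S = "(\<lambda>x. s *\<^sub>R x) ` ball1 n"
  have S: "?S = {x \<in> Rn n. ip n x x \<le> s\<^sup>2}"
  proof (intro equalityI subsetI)
    fix x assume x: "x \<in> {x \<in> Rn n. ip n x x \<le> s\<^sup>2}"
    have "(1 / s) *\<^sub>R x \<in> ball1 n"
      using x s by (simp add: ball1_def ip_scaleR_left ip_scaleR_right power2_eq_square field_simps)
    moreover have "x = s *\<^sub>R ((1 / s) *\<^sub>R x)" using s by simp
    ultimately show "x \<in> ?S" by blast
  next
    fix x assume "x \<in> ?S"
    then obtain y where y: "y \<in> ball1 n" "x = s *\<^sub>R y" by blast
    have "s * s * ip n y y \<le> s * s * 1" using y s by (intro mult_left_mono) (auto simp: ball1_def)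
    then show "x \<in> {x \<in> Rn n. ip n x x \<le> s\<^sup>2}"
      using y by (simp add: ball1_def ip_scaleR_left ip_scaleR_right power2_eq_square mult.assoc)
  qed
  show cb: "closed_ball n a s \<in> sets borel"
  proof -
    have "closed_ball n a s = Rn n \<inter> {x. ip n (x - a) (x - a) \<le> s\<^sup>2}" using closed_ball_eq[OF s] by auto
    also have "\<dots> \<in> sets borel"
    proof -
      have 1: "(\<lambda>x. ip n (x - a) (x - a)) \<in> borel_measurable borel" unfolding ip_def by simp
      have "{x \<in> space borel. ip n (x - a) (x - a) \<le> s\<^sup>2} \<in> sets borel" using 1 by measurable
      then show ?thesis using borel_closed[OF closed_Rn[of n]] by auto
    qed
    finally show ?thesis .
  qed
  have "{x. (\<lambda>i. if i < n then x i + a i else x i) \<in> closed_ball n a s} = ?S"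
  proof -
    have "(\<lambda>i. if i < n then x i + a i else x i) \<in> Rn n \<longleftrightarrow> x \<in> Rn n" for x by (auto simp: mem_Rn)
    moreover have "ip n ((\<lambda>i. if i < n then x i + a i else x i) - a) ((\<lambda>i. if i < n then x i + a i else x i) - a) = ip n x x" for x
      by (simp add: ip_def)
    ultimately show ?thesis unfolding S closed_ball_eq[OF s] by auto
  qed
  then have "emeasure (leb n) (closed_ball n a s) = emeasure (leb n) ?S"
    using emeasure_leb_translate[OF cb, of n a] by simp
  then show "measure (leb n) (closed_ball n a s) = s ^ n * measure (leb n) (ball1 n)"
    using measure_scaleR_image[OF s B.L_borel B.LRn] by (simp add: measure_def)
qed

text \<open>The ellipsoids that compete here are centred at the origin, although the John ellipsoid itself may be a
  ball with any centre; volumes do not depend on the centre.\<close>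

lemma John_maximal:
  assumes n: "0 < n" and E: "is_john_ellipsoid n K (closed_ball n a s)" and s: "0 < s" and a: "a \<in> Rn n"
    and A: "dt n A \<noteq> 0" and sub: "\<And>x. x \<in> ball1 n \<Longrightarrow> s *\<^sub>R lin n A x \<in> K"
  shows "\<bar>dt n A\<bar> \<le> 1"
proof -
  interpret B: body n "ball1 n" 1 by (rule body_ball1)
  let ?A = "\<lambda>i j. s * A i j"
  have lA: "lin n ?A x = s *\<^sub>R lin n A x" for x
    by (auto simp: lin_def ip_def fun_eq_iff sum_distrib_left mult.assoc)
  have dA: "dt n ?A = s ^ n * dt n A" by (rule dt_smult)
  then have dA0: "dt n ?A \<noteq> 0" using A s by simp
  have "ellipsoid n (lin n ?A ` ball1 n)"
    unfolding ellipsoid_def closed_ball_unit using lin_GL[OF dA0]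
    by (intro bexI[of _ 0] bexI[of _ "lin n ?A"]) auto
  moreover have "lin n ?A ` ball1 n \<subseteq> K" using sub by (auto simp: lA)
  ultimately have le: "vol n (lin n ?A ` ball1 n) \<le> vol n (closed_ball n a s)"
    using E by (simp add: is_john_ellipsoid_def)
  have "vol n (lin n ?A ` ball1 n) = measure (leb n) (lin n ?A ` ball1 n)"
    using emeasure_lin_image(1)[OF dA0 B.L_borel B.LRn] by (intro vol_eq) auto
  also have "\<dots> = s ^ n * \<bar>dt n A\<bar> * measure (leb n) (ball1 n)"
    using measure_lin_image[OF dA0 B.L_borel B.LRn] s by (simp add: dA abs_mult)
  finally have 1: "vol n (lin n ?A ` ball1 n) = s ^ n * \<bar>dt n A\<bar> * measure (leb n) (ball1 n)" .
  have 2: "vol n (closed_ball n a s) = s ^ n * measure (leb n) (ball1 n)"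
    using measure_closed_ball[OF s a] by (subst vol_eq) (auto simp: closed_ball_def)
  have pos: "0 < s ^ n * measure (leb n) (ball1 n)" using s B.measure_pos[OF n] by simp
  have "(s ^ n * measure (leb n) (ball1 n)) * \<bar>dt n A\<bar> \<le> (s ^ n * measure (leb n) (ball1 n)) * 1"
    using le unfolding 1 2 by (simp add: mult_ac)
  then show ?thesis using pos by (simp only: mult_le_cancel_left_pos)
qed

section \<open>The quantitative volume bound in John position\<close>

text \<open>Put \<open>z = (\<epsilon>/8)\<^sup>n\<close> and \<open>C = n! 2\<^sup>n\<close>.  If the defect \<open>h\<close> satisfies \<open>C h \<le> z / 2\<close>, the Gram
  determinant of an almost orthogonal system is at least \<open>1 - z / 2\<close>, and \<open>corner_volume_bound\<close> gives
  \<open>2\<^sup>n (1 - z) / (1 - z / 2) \<le> 2\<^sup>n (1 - z / 2)\<close>.  Otherwise \<open>slab_volume_deficit\<close> gives a deficit of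
  at least \<open>gap_const n\<close> times \<open>z / (2 C)\<close>.\<close>

lemma (in tight) volume_bound_of_missed_corner:
  assumes n: "0 < n" and K: "body n K 1" and K_slab: "K \<subseteq> slab 1"
    and \<epsilon>: "0 < \<epsilon>" "\<epsilon> \<le> 1"
    and corner: "\<And>A. dt n A \<noteq> 0 \<Longrightarrow> K \<subseteq> lin n A ` cube n \<Longrightarrow> \<exists>y\<in>cube n. exp (- (\<epsilon> / 2)) *\<^sub>R lin n A y \<notin> K"
  shows "measure (leb n) K \<le> 2 ^ n * (1 - (\<epsilon> / 8) ^ n * min (1/2) (gap_const n / (2 * fact n * 4 ^ n)))"
proof -
  interpret K: body n K 1 by (rule K)
  define V where "V = measure (leb n) K"
  define h where "h = orth_defect"
  define z where "z = (\<epsilon> / 8) ^ n"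
  define C where "C = (fact n * 2 ^ n :: real)"
  define m where "m = min (1/2) (gap_const n / (2 * fact n * 4 ^ n))"
  have h0: "0 \<le> h" unfolding h_def by (rule orth_defect_nonneg)
  have z: "0 < z" "z \<le> 1" unfolding z_def using \<epsilon> by (auto intro!: power_le_one)
  have C1: "0 < C" by (simp add: C_def)
  have k0: "0 \<le> gap_const n" by (simp add: gap_const_def)
  have Vh: "V + gap_const n * h \<le> 2 ^ n"
  proof -
    have "V \<le> measure (leb n) (slab 1)" unfolding V_def
      using K_slab slab_volume_deficit(1)[OF n] by (intro measure_mono_fmeasurable fmeasurableI) auto
    then show ?thesis using slab_volume_deficit(2)[OF n] by (simp add: h_def)
  qed
  have "V \<le> 2 ^ n * (1 - z * m)"
  proof (cases "C * h \<le> z / 2")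
    case True
    obtain f where fJ: "\<And>i. i < n \<Longrightarrow> f i \<in> J"
      and fo: "\<And>i l. i < n \<Longrightarrow> l < i \<Longrightarrow> (ip n (u (f i)) (u (f l)))\<^sup>2 \<le> 2 ^ n * h"
      using almost_orthogonal_system[of n] unfolding h_def by auto
    define W where "W i = u (f i)" for i
    define G where "G = mm n W (\<lambda>i j. W j i)"
    have G: "G i j = ip n (W i) (W j)" for i j by (simp add: G_def mm_def ip_def)
    have dG: "dt n G = dt n W * dt n W" unfolding G_def dt_mm using dt_transpose[of n W] by (simp only:)
    have fo': "\<bar>ip n (W i) (W l)\<bar> \<le> sqrt (2 ^ n * h)" if "i < n" "l < n" "i \<noteq> l" for i l
    proof -
      have "(ip n (W i) (W l))\<^sup>2 \<le> 2 ^ n * h"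
      proof (cases "l < i")
        case True
        then show ?thesis using fo[OF that(1) True] by (simp add: W_def)
      next
        case False
        then have "i < l" using that by simp
        then show ?thesis using fo[OF that(2)] unfolding W_def ip_commute[of n "u (f i)"] by blast
      qed
      then have "sqrt ((ip n (W i) (W l))\<^sup>2) \<le> sqrt (2 ^ n * h)" by (rule real_sqrt_le_mono)
      then show ?thesis by simp
    qed
    have "1 * (2 ^ n * h) \<le> fact n * (2 ^ n * h)" using h0 by (intro mult_right_mono) auto
    moreover have "C * h = fact n * (2 ^ n * h)" unfolding C_def by (rule mult.assoc)
    ultimately have h1: "2 ^ n * h \<le> 1" using True z by linarith
    have "1 - fact n * (sqrt (2 ^ n * h))\<^sup>2 \<le> dt n G"
    proof (rule dt_almost_identity)
      show "G i i = 1" if "i < n" for i using u_unit[OF fJ[OF that]] by (simp add: G W_def)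
      show "\<bar>G i j\<bar> \<le> sqrt (2 ^ n * h)" if "i < n" "j < n" "i \<noteq> j" for i j
        unfolding G using that by (rule fo')
      show "sqrt (2 ^ n * h) \<le> 1" using h1 by simp
    qed
    then have "1 - C * h \<le> dt n W * dt n W" using h0 by (simp add: dG C_def mult.assoc)
    then have dW2: "1 - z / 2 \<le> \<bar>dt n W\<bar> * \<bar>dt n W\<bar>" using True by simp
    have dW: "1 - z / 2 \<le> \<bar>dt n W\<bar>"
    proof (rule ccontr)
      assume less: "\<not> 1 - z / 2 \<le> \<bar>dt n W\<bar>"
      then have "\<bar>dt n W\<bar> * \<bar>dt n W\<bar> \<le> \<bar>dt n W\<bar> * 1" using z by (intro mult_left_mono) auto
      then show False using dW2 less by linarith
    qed
    then have dW0: "dt n W \<noteq> 0" using z by auto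
    obtain B where B: "\<And>i j. i < n \<Longrightarrow> j < n \<Longrightarrow> mm n W B i j = (if i = j then 1 else 0)"
      "\<And>i j. i < n \<Longrightarrow> j < n \<Longrightarrow> mm n B W i j = (if i = j then 1 else 0)" using dt_inverse[OF dW0] by blast
    have WB: "lin n W (lin n B x) = x" if "x \<in> Rn n" for x
      unfolding lin_mm[symmetric] using B(1) that by (rule lin_id)
    have BW: "lin n B (lin n W x) = x" if "x \<in> Rn n" for x
      unfolding lin_mm[symmetric] using B(2) that by (rule lin_id)
    have "dt n W * dt n B = dt n (\<lambda>i j. if i = j then 1 else 0)"
      unfolding dt_mm[symmetric] using B(1) by (rule dt_cong)
    then have dB: "dt n B \<noteq> 0" by (auto simp: dt_id)
    have ipW: "\<bar>ip n (W i) x\<bar> \<le> 1" if "x \<in> K" "i < n" for x i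
    proof -
      have "\<bar>ip n x (u (f i))\<bar> \<le> 1" using K_slab that fJ by (auto simp: slab_def)
      then show ?thesis unfolding W_def by (subst ip_commute)
    qed
    have "K \<subseteq> lin n B ` cube n"
    proof
      fix x assume x: "x \<in> K"
      have "lin n W x \<in> cube n"
        unfolding cube_def using ipW[OF x] by (auto simp: lin_def abs_le_iff mem_Rn minus_le_iff)
      moreover have "x = lin n B (lin n W x)" using BW x K.LRn by auto
      ultimately show "x \<in> lin n B ` cube n" by blast
    qed
    then obtain y where y: "y \<in> cube n" "exp (- (\<epsilon> / 2)) *\<^sub>R lin n B y \<notin> K" using corner[OF dB] by blast
    have yR: "y \<in> Rn n" using y(1) by (simp add: cube_def)
    define \<mu> where "\<mu> = exp (\<epsilon> / 2)"
    have \<mu>1: "1 < \<mu>" using \<epsilon> by (simp add: \<mu>_def)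
    have \<mu>i: "1 / \<mu> = exp (- (\<epsilon> / 2))" by (simp add: \<mu>_def exp_minus inverse_eq_divide)
    have bound: "V \<le> (2 ^ n - (1 - 1 / \<mu>) ^ n) / \<bar>dt n W\<bar>"
      unfolding V_def
    proof (rule corner_volume_bound[OF K.comp K.conv K.LRn K.zero_L dW0 ipW _ _ _ \<mu>1])
      show "y \<in> cubeset n 1" using y(1) by (auto simp: cube_def cubeset_def)
      show "lin n W (lin n B y) = (\<lambda>i. if i < n then y i else 0)"
        unfolding WB[OF yR] using yR by (auto simp: mem_Rn fun_eq_iff)
      show "(1 / \<mu>) *\<^sub>R lin n B y \<notin> K" unfolding \<mu>i by (rule y(2))
    qed simp_all
    have "\<epsilon> / 4 \<le> 1 - 1 / \<mu>"
    proof -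
      have "1 + \<epsilon> / 2 \<le> \<mu>" unfolding \<mu>_def by (rule exp_ge_add_one_self)
      then have "1 / \<mu> \<le> 1 / (1 + \<epsilon> / 2)" using \<epsilon> by (intro divide_left_mono) auto
      also have "\<dots> \<le> 1 - \<epsilon> / 4"
      proof -
        have "\<epsilon> * \<epsilon> \<le> \<epsilon> * 1" using \<epsilon> by (intro mult_left_mono) auto
        then have "1 \<le> (1 - \<epsilon> / 4) * (1 + \<epsilon> / 2)" using \<epsilon> by (simp add: algebra_simps)
        then show ?thesis using \<epsilon> by (subst pos_divide_le_eq) auto
      qed
      finally show ?thesis by simp
    qed
    then have "(\<epsilon> / 4) ^ n \<le> (1 - 1 / \<mu>) ^ n" using \<epsilon> by (intro power_mono) auto
    moreover have "(\<epsilon> / 4) ^ n = 2 ^ n * z" unfolding z_def power_mult_distrib[symmetric] by simp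
    ultimately have num: "2 ^ n - (1 - 1 / \<mu>) ^ n \<le> 2 ^ n * (1 - z)" by (simp add: right_diff_distrib)
    have "(2 ^ n - (1 - 1 / \<mu>) ^ n) / \<bar>dt n W\<bar> \<le> 2 ^ n * (1 - z) / (1 - z / 2)"
      using num dW z by (intro frac_le) auto
    also have "\<dots> \<le> 2 ^ n * (1 - z / 2)"
    proof -
      have "1 - z \<le> (1 - z / 2) * (1 - z / 2)" by (simp add: algebra_simps)
      then have "2 ^ n * (1 - z) \<le> 2 ^ n * (1 - z / 2) * (1 - z / 2)" by (simp add: mult.assoc)
      then show ?thesis using z by (subst pos_divide_le_eq) auto
    qed
    finally have V: "V \<le> 2 ^ n * (1 - z / 2)" using bound by linarith
    have "z * m \<le> z * (1/2)" using z by (intro mult_left_mono) (auto simp: m_def)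
    then have "2 ^ n * (1 - z / 2) \<le> 2 ^ n * (1 - z * m)" by (intro mult_left_mono) auto
    then show ?thesis using V by linarith
  next
    case False
    then have "z / (2 * C) \<le> h" using C1 by (simp add: pos_divide_le_eq mult_ac)
    then have 1: "gap_const n * (z / (2 * C)) \<le> gap_const n * h" using k0 by (rule mult_left_mono)
    have "2 ^ n * (z * m) \<le> 2 ^ n * (z * (gap_const n / (2 * fact n * 4 ^ n)))"
      using z by (intro mult_left_mono) (auto simp: m_def)
    also have "\<dots> = gap_const n * (z / (2 * C))"
    proof -
      have "(4::real) ^ n = 2 ^ n * 2 ^ n" unfolding power_mult_distrib[symmetric] by simp
      then show ?thesis by (simp add: C_def)
    qed
    finally show ?thesis using 1 Vh by (simp add: right_diff_distrib)
  qed
  then show ?thesis by (simp only: V_def z_def m_def)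
qed

lemma John_position_volume_bound:
  assumes n: "0 < n" and K: "body n K 1" and sym: "\<And>x. x \<in> K \<Longrightarrow> - x \<in> K"
    and max: "\<And>A. dt n A \<noteq> 0 \<Longrightarrow> lin n A ` ball1 n \<subseteq> K \<Longrightarrow> \<bar>dt n A\<bar> \<le> 1"
    and \<epsilon>: "0 \<le> \<epsilon>" "\<epsilon> \<le> 1"
    and corner: "\<And>A. 0 < \<epsilon> \<Longrightarrow> dt n A \<noteq> 0 \<Longrightarrow> K \<subseteq> lin n A ` cube n \<Longrightarrow> \<exists>y\<in>cube n. exp (- (\<epsilon> / 2)) *\<^sub>R lin n A y \<notin> K"
  shows "measure (leb n) K \<le> 2 ^ n * (1 - (\<epsilon> / 8) ^ n * min (1/2) (gap_const n / (2 * fact n * 4 ^ n)))"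
proof -
  interpret K: body n K 1 by (rule K)
  have "ball1 n \<subseteq> K" using K.ball by (auto simp: ball1_def)
  then obtain J :: "(nat \<times> nat \<Rightarrow> real) set" and c u where fr: "tight_frame n J c u"
    and le: "\<And>j x. j \<in> J \<Longrightarrow> x \<in> K \<Longrightarrow> ip n x (u j) \<le> 1"
    using John_decomposition[OF n K.comp K.conv K.LRn _ max] by blast
  interpret tight n J c u by (rule tight.intro) (rule fr)
  have K_slab: "K \<subseteq> slab 1"
  proof
    fix x assume x: "x \<in> K"
    have "\<bar>ip n x (u j)\<bar> \<le> 1" if j: "j \<in> J" for j
    proof -
      have "ip n (- x) (u j) = - ip n x (u j)" by (simp add: ip_def sum_negf)
      then show ?thesis using le[OF j x] le[OF j sym[OF x]] by linarith
    qed
    then show "x \<in> slab 1" by (simp add: slab_def)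
  qed
  show ?thesis
  proof (cases "\<epsilon> = 0")
    case True
    have "measure (leb n) K \<le> measure (leb n) (slab 1)"
      using K_slab slab_volume_deficit(1)[OF n] by (intro measure_mono_fmeasurable fmeasurableI) auto
    also have "\<dots> \<le> 2 ^ n"
    proof -
      have "0 \<le> gap_const n * orth_defect" using orth_defect_nonneg by (simp add: gap_const_def)
      then show ?thesis using slab_volume_deficit(2)[OF n] by linarith
    qed
    finally show ?thesis unfolding True using n by (simp add: power_0_left)
  next
    case False
    then show ?thesis using volume_bound_of_missed_corner[OF n K K_slab _ \<epsilon>(2) corner] \<epsilon>(1) by simp
  qed
qed

section \<open>The size of the constant\<close>

text \<open>The constant works out as \<open>1 / (1492992 n\<^sup>6)\<close> times \<open>(2 / (3 n))\<^sup>n\<close>, and \<open>1492992 \<le> 3\<close> to the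
  power \<open>13\<close>.\<close>

lemma gap_const_ge:
  assumes n: "3 \<le> n"
  shows "1 \<le> real n ^ (2 * n + 19) * gap_const n"
proof -
  define N where "N = real n"
  have N: "3 \<le> N" using n by (simp add: N_def)
  have a: "N ^ 19 * ((1/72) * ((1 / (3 * N))\<^sup>2 / (16 * N))\<^sup>2) = N ^ 13 / 1492992"
    using N by (simp add: field_simps eval_nat_numeral)
  have b: "N ^ (2 * n) * (2 * (1 / (3 * N))) ^ n = (2 * N / 3) ^ n"
  proof -
    have "N\<^sup>2 * (2 * (1 / (3 * N))) = 2 * N / 3" using N by (simp add: power2_eq_square)
    then show ?thesis by (simp only: power_mult power_mult_distrib[symmetric])
  qed
  have "N ^ (2 * n + 19) * gap_const n
      = (N ^ 19 * ((1/72) * ((1 / (3 * N))\<^sup>2 / (16 * N))\<^sup>2)) * (N ^ (2 * n) * (2 * (1 / (3 * N))) ^ n)"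
    unfolding gap_const_def N_def[symmetric] power_add by (simp only: mult_ac)
  also have "\<dots> = N ^ 13 / 1492992 * (2 * N / 3) ^ n" unfolding a b ..
  also have "1 * 1 \<le> \<dots>"
  proof (rule mult_mono)
    have "(3::real) ^ 13 \<le> N ^ 13" using N by (intro power_mono) auto
    then show "1 \<le> N ^ 13 / 1492992" by simp
    show "1 \<le> (2 * N / 3) ^ n" using N by (intro one_le_power) simp
  qed (use N in auto)
  finally show ?thesis by (simp add: N_def)
qed

text \<open>All quantities are bounded by powers of \<open>n \<ge> 3\<close>, using \<open>8 \<le> n\<^sup>2\<close> and \<open>n! \<le> n\<^sup>n\<close>; the largest exponent
  that arises is \<open>7 n + 20 \<le> 2 n\<^sup>3\<close>.\<close>

lemma gamma_le:
  assumes n: "3 \<le> n"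
  shows "real n powr (- 2 * real n ^ 3) \<le> (1/8) ^ n * min (1/2) (gap_const n / (2 * fact n * 4 ^ n))"
proof -
  define N where "N = real n"
  define e where "e = 2 * n ^ 3"
  define F where "F = (2 * fact n * 4 ^ n :: real)"
  have N: "3 \<le> N" using n by (simp add: N_def)
  have e: "7 * n + 20 \<le> e"
  proof -
    have "3 * 3 \<le> n * n" by (rule mult_mono[OF n n]) auto
    then have "3 * 3 * n \<le> n * n * n" by (rule mult_right_mono) simp
    moreover have "e = 2 * (n * n * n)" by (simp add: e_def power3_eq_cube mult.assoc)
    ultimately show ?thesis using n by linarith
  qed
  have "9 \<le> N * N" using mult_mono[OF N N] N by simp
  then have sq: "8 \<le> N\<^sup>2" "4 \<le> N\<^sup>2" by (simp_all add: power2_eq_square)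
  have p8: "8 ^ n \<le> N ^ (2 * n)" unfolding power_mult using sq by (intro power_mono) auto
  have p4: "4 ^ n \<le> N ^ (2 * n)" unfolding power_mult using sq by (intro power_mono) auto
  have pf: "fact n \<le> N ^ n" unfolding N_def using fact_le_power[of n, where 'a = real] by simp
  have F0: "0 < F" by (simp add: F_def)
  have F: "F \<le> N ^ (3 * n + 1)"
  proof -
    have "F \<le> N * N ^ n * N ^ (2 * n)" unfolding F_def using N pf p4 by (intro mult_mono) auto
    also have "\<dots> = N ^ (1 + n + 2 * n)" by (simp only: power_add power_one_right)
    also have "1 + n + 2 * n = 3 * n + 1" by simp
    finally show ?thesis .
  qed
  have e1: "8 ^ n * 2 \<le> N ^ e"
  proof -
    have "8 ^ n * 2 \<le> N ^ (2 * n) * N" using N p8 by (intro mult_mono) auto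
    also have "\<dots> = N ^ (2 * n + 1)" by simp
    also have "\<dots> \<le> N ^ e" using N e by (intro power_increasing) auto
    finally show ?thesis .
  qed
  have k0: "0 \<le> gap_const n" by (simp add: gap_const_def)
  have e2: "8 ^ n * F \<le> N ^ e * gap_const n"
  proof -
    have "8 ^ n * F \<le> N ^ (2 * n) * N ^ (3 * n + 1)" using p8 F F0 N by (intro mult_mono) auto
    also have "\<dots> = N ^ (5 * n + 1) * 1" by (simp add: power_add[symmetric])
    also have "\<dots> \<le> N ^ (5 * n + 1) * (N ^ (2 * n + 19) * gap_const n)"
      using gap_const_ge[OF n] N unfolding N_def by (intro mult_left_mono) auto
    also have "\<dots> = N ^ ((5 * n + 1) + (2 * n + 19)) * gap_const n" by (simp only: power_add mult.assoc)
    also have "(5 * n + 1) + (2 * n + 19) = 7 * n + 20" by simp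
    also have "N ^ (7 * n + 20) * gap_const n \<le> N ^ e * gap_const n" using N e k0 by (intro mult_right_mono power_increasing) auto
    finally show ?thesis .
  qed
  have Ne: "0 < N ^ e" using N by simp
  have "N powr (- 2 * N ^ 3) = N powr (- real e)" by (simp add: e_def N_def)
  also have "\<dots> = 1 / N ^ e" using N by (simp add: powr_minus_divide powr_realpow)
  finally have \<gamma>: "N powr (- 2 * N ^ 3) = 1 / N ^ e" .
  have "1 / N ^ e \<le> 1 / (8 ^ n * 2)" using e1 by (intro divide_left_mono) (use Ne in auto)
  then have 1: "1 / N ^ e \<le> (1/8) ^ n * (1/2)" by (simp add: power_divide)
  have "1 / X \<le> g / Y" if "Y \<le> X * g" "0 < X" "0 < Y" for X Y g :: real
    using that by (simp add: field_simps)
  from this[OF e2 Ne] have 2: "1 / N ^ e \<le> (1/8) ^ n * (gap_const n / F)" using F0 by (simp add: power_divide)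
  show ?thesis using 1 2 unfolding N_def[symmetric] F_def[symmetric] \<gamma> by (simp add: min_def)
qed

section \<open>The reverse isoperimetric inequality\<close>

lemma scaled_body:
  assumes K: "body n K s" and s: "0 < s"
  shows "body n ((\<lambda>x. (1 / s) *\<^sub>R x) ` K) 1"
proof -
  interpret K: body n K s by (rule K)
  show ?thesis
  proof
    show "compact ((\<lambda>x. (1 / s) *\<^sub>R x) ` K)"
      unfolding scaleR_image_lin[OF K.LRn]
      by (intro compact_continuous_image K.comp continuous_lin continuous_on_id)
    show "convex ((\<lambda>x. (1 / s) *\<^sub>R x) ` K)" by (rule convex_scaling[OF K.conv])
    show "(\<lambda>x. (1 / s) *\<^sub>R x) ` K \<subseteq> Rn n" using K.LRn by (auto simp: mem_Rn)
    fix x assume x: "x \<in> Rn n" "ip n x x \<le> 1\<^sup>2"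
    have "ip n (s *\<^sub>R x) (s *\<^sub>R x) = s\<^sup>2 * ip n x x" by (simp add: ip_scaleR_left ip_scaleR_right power2_eq_square)
    also have "\<dots> \<le> s\<^sup>2 * 1" using x by (intro mult_left_mono) auto
    finally have "s *\<^sub>R x \<in> K" using x by (intro K.ball) (auto simp: mem_Rn)
    moreover have "x = (1 / s) *\<^sub>R (s *\<^sub>R x)" using s by simp
    ultimately show "x \<in> (\<lambda>x. (1 / s) *\<^sub>R x) ` K" by blast
  qed simp
qed

text \<open>If \<open>a + x\<close> and \<open>a - x\<close> are in \<open>K\<close>, then so is the midpoint \<open>x\<close> of \<open>a + x\<close> and \<open>-(a - x)\<close>.\<close>

lemma body_of_John_ball:
  assumes K: "convex_body n K" and sym: "origin_symmetric K"
    and sub: "closed_ball n a s \<subseteq> K" and s: "0 < s" and a: "a \<in> Rn n"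
  shows "body n K s"
proof
  have c: "compact K \<and> K \<subseteq> Rn n" using K by (intro compactin_Rn_iff) (simp add: convex_body_def)
  then show "compact K" "K \<subseteq> Rn n" by auto
  show conv: "convex K" using K by (simp add: convex_body_def)
  show "0 < s" by (rule s)
  fix x assume x: "x \<in> Rn n" "ip n x x \<le> s\<^sup>2"
  have neg: "- y \<in> K" if "y \<in> K" for y using sym that unfolding origin_symmetric_def by blast
  have "a + x \<in> closed_ball n a s" unfolding closed_ball_eq[OF s] using a x by (auto simp: mem_Rn)
  then have 1: "a + x \<in> K" using sub by blast
  have "ip n (- x) (- x) = ip n x x" by (simp add: ip_def)
  then have "a - x \<in> closed_ball n a s" unfolding closed_ball_eq[OF s] using a x by (auto simp: mem_Rn)
  then have "- (a - x) \<in> K" using sub neg by blast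
  then have "(1/2) *\<^sub>R (a + x) + (1/2) *\<^sub>R (- (a - x)) \<in> K" by (intro convexD[OF conv 1]) auto
  moreover have "(1/2) *\<^sub>R (a + x) + (1/2) *\<^sub>R (- (a - x)) = x"
    by (simp add: fun_eq_iff add_divide_distrib diff_divide_distrib)
  ultimately show "x \<in> K" by simp
qed

text \<open>If no such point existed, \<open>\<Phi>\<close> would show that the distance is at most \<open>\<epsilon>/2\<close>.  The factor is
  \<open>exp (\<epsilon>/2)\<close> and not \<open>exp \<epsilon>\<close> because the hypothesis only excludes distances less than \<open>\<epsilon>\<close>.\<close>

lemma missed_corner_of_distance:
  assumes \<epsilon>: "0 < \<epsilon>" and dist: "\<epsilon> \<le> banach_mazur_distance n K (cube n)"
    and \<Phi>: "\<Phi> \<in> GL n" "K \<subseteq> \<Phi> ` cube n"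
  shows "\<exists>y\<in>cube n. exp (- (\<epsilon> / 2)) *\<^sub>R \<Phi> y \<notin> K"
proof (rule ccontr)
  assume "\<not> ?thesis"
  then have all: "exp (- (\<epsilon> / 2)) *\<^sub>R \<Phi> y \<in> K" if "y \<in> cube n" for y using that by blast
  let ?S = "{l. l \<ge> 1 \<and> (\<exists>\<Phi> \<in> GL n. K \<subseteq> \<Phi> ` cube n \<and> \<Phi> ` cube n \<subseteq> (\<lambda>x. l *\<^sub>R x) ` K)}"
  have "\<Phi> ` cube n \<subseteq> (\<lambda>x. exp (\<epsilon> / 2) *\<^sub>R x) ` K"
  proof
    fix x assume "x \<in> \<Phi> ` cube n"
    then obtain y where y: "y \<in> cube n" "x = \<Phi> y" by blast
    have "exp (\<epsilon> / 2) * exp (- (\<epsilon> / 2)) = 1" by (simp add: exp_minus)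
    then have "x = exp (\<epsilon> / 2) *\<^sub>R (exp (- (\<epsilon> / 2)) *\<^sub>R \<Phi> y)" by (simp only: scaleR_scaleR scaleR_one y(2))
    then show "x \<in> (\<lambda>x. exp (\<epsilon> / 2) *\<^sub>R x) ` K" using all[OF y(1)] by blast
  qed
  then have mem: "exp (\<epsilon> / 2) \<in> ?S" using \<Phi> \<epsilon> by (intro CollectI conjI bexI[of _ \<Phi>]) auto
  have "Inf ?S \<le> exp (\<epsilon> / 2)" using mem by (rule cInf_lower) (auto intro!: bdd_belowI[of _ 1])
  moreover have "1 \<le> Inf ?S" using mem by (intro cInf_greatest) blast+
  ultimately have "ln (Inf ?S) \<le> ln (exp (\<epsilon> / 2))" by (intro ln_mono) auto
  then show False using dist \<epsilon> unfolding banach_mazur_distance_def by simp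
qed

theorem volume_ratio_bound:
  assumes n: "3 \<le> n" and K: "convex_body n K" and sym: "origin_symmetric K"
    and E: "is_john_ellipsoid n K (closed_ball n a s)" and s: "0 < s" and a: "a \<in> Rn n"
    and \<epsilon>: "0 \<le> \<epsilon>" "\<epsilon> < 1" and dist: "\<epsilon> \<le> banach_mazur_distance n K (cube n)"
  shows "measure (leb n) K / s ^ n \<le> (1 - real n powr (- 2 * real n ^ 3) * \<epsilon> ^ n) * 2 ^ n"
proof -
  have n0: "0 < n" using n by simp
  have "closed_ball n a s \<subseteq> K" using E by (simp add: is_john_ellipsoid_def)
  then have bK: "body n K s" using K sym s a by (intro body_of_John_ball)
  interpret K: body n K s by (rule bK)
  define L where "L = (\<lambda>x. (1 / s) *\<^sub>R x) ` K"
  have bL: "body n L 1" unfolding L_def using bK s by (rule scaled_body)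
  have LK: "x \<in> L \<longleftrightarrow> s *\<^sub>R x \<in> K" for x
  proof
    assume "x \<in> L"
    then obtain y where "y \<in> K" "x = (1 / s) *\<^sub>R y" by (auto simp: L_def)
    moreover have "s *\<^sub>R (1 / s) *\<^sub>R y = y" using s by simp
    ultimately show "s *\<^sub>R x \<in> K" by simp
  next
    assume "s *\<^sub>R x \<in> K"
    moreover have "x = (1 / s) *\<^sub>R (s *\<^sub>R x)" using s by simp
    ultimately show "x \<in> L" unfolding L_def by blast
  qed
  have neg: "- x \<in> L" if "x \<in> L" for x
  proof -
    have "- (s *\<^sub>R x) \<in> K" using sym that unfolding origin_symmetric_def LK by blast
    moreover have "- (s *\<^sub>R x) = s *\<^sub>R (- x)" by (rule scaleR_minus_right[symmetric])
    ultimately show ?thesis unfolding LK by (simp only:)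
  qed
  have max: "\<bar>dt n A\<bar> \<le> 1" if A: "dt n A \<noteq> 0" "lin n A ` ball1 n \<subseteq> L" for A
    using A(2) LK by (intro John_maximal[OF n0 E s a A(1)]) blast
  have corner: "\<exists>y\<in>cube n. exp (- (\<epsilon> / 2)) *\<^sub>R lin n A y \<notin> L"
    if e0: "0 < \<epsilon>" and A: "dt n A \<noteq> 0" "L \<subseteq> lin n A ` cube n" for A
  proof -
    define A' where "A' = (\<lambda>i j. s * A i j)"
    have lA: "lin n A' x = s *\<^sub>R lin n A x" for x
      by (auto simp: A'_def lin_def ip_def fun_eq_iff sum_distrib_left mult.assoc)
    have "dt n A' \<noteq> 0" unfolding A'_def dt_smult using A s by simp
    then have GL: "lin n A' \<in> GL n" by (rule lin_GL)
    have "K \<subseteq> lin n A' ` cube n"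
    proof
      fix x assume "x \<in> K"
      then have "(1 / s) *\<^sub>R x \<in> L" by (auto simp: L_def)
      then obtain y where y: "y \<in> cube n" "(1 / s) *\<^sub>R x = lin n A y" using A(2) by blast
      have "x = s *\<^sub>R ((1 / s) *\<^sub>R x)" using s by simp
      then have "x = lin n A' y" by (simp only: y(2) lA)
      then show "x \<in> lin n A' ` cube n" using y(1) by blast
    qed
    then obtain y where y: "y \<in> cube n" "exp (- (\<epsilon> / 2)) *\<^sub>R lin n A' y \<notin> K"
      using missed_corner_of_distance[OF e0 dist GL] by blast
    have "exp (- (\<epsilon> / 2)) *\<^sub>R lin n A' y = s *\<^sub>R (exp (- (\<epsilon> / 2)) *\<^sub>R lin n A y)"
      unfolding lA scaleR_scaleR by (simp only: mult.commute)
    then show ?thesis using y LK by auto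
  qed
  define m where "m = min (1/2) (gap_const n / (2 * fact n * 4 ^ n))"
  have "measure (leb n) L \<le> 2 ^ n * (1 - (\<epsilon> / 8) ^ n * m)"
    unfolding m_def using n0 bL neg max \<epsilon>(1) less_imp_le[OF \<epsilon>(2)] corner by (rule John_position_volume_bound)
  also have "(\<epsilon> / 8) ^ n * m = (1/8) ^ n * m * \<epsilon> ^ n" by (simp add: power_divide)
  also have "2 ^ n * (1 - (1/8) ^ n * m * \<epsilon> ^ n) \<le> 2 ^ n * (1 - real n powr (- 2 * real n ^ 3) * \<epsilon> ^ n)"
    using gamma_le[OF n] \<epsilon> unfolding m_def by (intro mult_left_mono diff_left_mono mult_right_mono) auto
  also have "measure (leb n) L = measure (leb n) K / s ^ n"
    unfolding L_def using s by (subst measure_scaleR_image[OF _ K.L_borel K.LRn]) (auto simp: power_divide)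
  finally show ?thesis by (simp only: mult.commute)
qed

theorem theorem1p2:
  shows "\<exists>c::real. c > 0 \<and>
    (\<forall>(n::nat) (K :: (nat \<Rightarrow> real) set) (\<epsilon>::real).
       n \<ge> 3 \<longrightarrow>
       convex_body n K \<longrightarrow>
       origin_symmetric K \<longrightarrow>
       (\<exists>E. is_john_ellipsoid n K E \<and> euclidean_ball n E) \<longrightarrow>
       \<epsilon> \<in> {0..<1} \<longrightarrow>
       banach_mazur_distance n K (cube n) \<ge> \<epsilon> \<longrightarrow>
       (let \<gamma> = real n powr (- c * real n ^ 3) in
         surface_area n K ^ n / vol n K ^ (n - 1)
           \<le> (1 - \<gamma> * \<epsilon> ^ n) * (surface_area n (cube n) ^ n / vol n (cube n) ^ (n - 1))))"
proof (intro exI[of _ 2] conjI allI impI)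
  fix n :: nat and K :: "(nat \<Rightarrow> real) set" and \<epsilon> :: real
  assume n: "3 \<le> n" and K: "convex_body n K" and sym: "origin_symmetric K"
    and "\<exists>E. is_john_ellipsoid n K E \<and> euclidean_ball n E"
    and \<epsilon>: "\<epsilon> \<in> {0..<1}" and dist: "\<epsilon> \<le> banach_mazur_distance n K (cube n)"
  then obtain a s where a: "a \<in> Rn n" and s: "0 < s" and E: "is_john_ellipsoid n K (closed_ball n a s)"
    by (auto simp: euclidean_ball_def)
  define g where "g = 1 - real n powr (- 2 * real n ^ 3) * \<epsilon> ^ n"
  have n0: "0 < n" using n by simp
  have "closed_ball n a s \<subseteq> K" using E by (simp add: is_john_ellipsoid_def)
  then interpret K: body n K s using K sym s a by (intro body_of_John_ball)
  interpret C: body n "cube n" 1 by (rule body_cube)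
  define V where "V = measure (leb n) K"
  have V: "vol n K = V" unfolding V_def by (rule vol_eq[OF K.L_borel K.LRn])
  have VC: "vol n (cube n) = 2 ^ n" using vol_eq[OF C.L_borel C.LRn] measure_cube by simp
  have V0: "0 < V" unfolding V_def using n0 by (rule K.measure_pos)
  have bound: "V / s ^ n \<le> g * 2 ^ n"
    unfolding V_def g_def using \<epsilon> by (intro volume_ratio_bound[OF n K sym E s a _ _ dist]) auto
  have "0 \<le> V / s ^ n" using V0 s by simp
  then have "0 \<le> g * 2 ^ n" using bound by linarith
  then have "0 * 2 ^ n \<le> g * 2 ^ n" by simp
  then have g0: "0 \<le> g" by (rule mult_right_le_imp_le) simp
  have S: "0 \<le> surface_area n K" "surface_area n K \<le> real n * V / s"
    unfolding V_def using K.surface_bounds[OF K.surface_area_tendsto] by auto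
  have "surface_area n K ^ n / V ^ (n - 1) \<le> (real n * V / s) ^ n / V ^ (n - 1)"
    using S V0 by (intro divide_right_mono power_mono) auto
  also have "\<dots> = real n ^ n * (V / s ^ n)"
  proof -
    have "V ^ n = V ^ (n - 1) * V" by (rule power_minus_mult[OF n0, symmetric])
    then show ?thesis using V0 by (simp add: power_divide power_mult_distrib)
  qed
  also have "\<dots> \<le> real n ^ n * (g * 2 ^ n)" using bound by (intro mult_left_mono) auto
  also have "\<dots> = g * ((real n * 2 ^ n) ^ n / (2 ^ n) ^ (n - 1))"
  proof -
    have "((2::real) ^ n) ^ n = (2 ^ n) ^ (n - 1) * 2 ^ n" by (rule power_minus_mult[OF n0, symmetric])
    then show ?thesis by (simp add: power_mult_distrib)
  qed
  also have "\<dots> \<le> g * (surface_area n (cube n) ^ n / (2 ^ n) ^ (n - 1))"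
    using g0 surface_area_cube_ge[of n] by (intro mult_left_mono divide_right_mono power_mono) auto
  finally show "let \<gamma> = real n powr (- 2 * real n ^ 3) in
      surface_area n K ^ n / vol n K ^ (n - 1)
        \<le> (1 - \<gamma> * \<epsilon> ^ n) * (surface_area n (cube n) ^ n / vol n (cube n) ^ (n - 1))"
    unfolding Let_def V VC g_def .
qed simp

end
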